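(* Let $\Sigma$ be a Riemann surface, let $D=\sum_i(\theta_i-1)p_i$ be an $\mathbb{R}$-divisor on $\Sigma$ with $0\le\theta_i\neq 1$ and $\{p_i\}\subset\Sigma$ a closed discrete subset, and let $\mathrm{d}\sigma^2$ be a singular conformal hyperbolic metric on $\Sigma$ representing $D$. (a) Let $F:\Sigma\setminus\mathrm{supp}\,D\to\mathbb{D}$ be a developing map of $\mathrm{d}\sigma^2$. If $p$ is a conical singularity of $\mathrm{d}\sigma^2$ with cone angle $2\pi\alpha>0$, then there exist a neighborhood $U$ of $p$ with complex coordinate $z$, $z(p)=0$, and $\mathfrak{L}\in\mathrm{PSU}(1,1)$ such that $G=\mathfrak{L}\circ F$ has the form $G(z)=z^{\alpha}$ on $U\setminus\{p\}$. (b) Let $F:\Sigma\setminus\mathrm{supp}\,D\to\mathbb{H}$ be a developing map of $\mathrm{d}\sigma^2$ with values in the upper half-plane model. If $q$ is a cusp singularity of $\mathrm{d}\sigma^2$, then there exist a neighborhood $V$ of $q$ with complex coordinate $z$, $z(q)=0$, and $\mathfrak{L}\in\mathrm{PSL}(2,\mathbb{R})$ such that $G=\mathfrak{L}\circ F$ has the form $G(z)=-\sqrt{-1}\,\log z$ on $V\setminus\{q\}$.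
   Context: Hyperbolic plane models: $\mathbb{D}=\{z\in\mathbb{C}:|z|<1\}$ with $\mathrm{d}\sigma^2_{\mathbb{D}}=\frac{4|\mathrm{d}z|^2}{(1-|z|^2)^2}$, and $\mathbb{H}=\{z\in\mathbb{C}:\mathrm{Im}\,z>0\}$ with $\mathrm{d}\sigma^2_{\mathbb{H}}=\frac{|\mathrm{d}z|^2}{(\mathrm{Im}\,z)^2}$. Their groups of orientation-preserving isometries are $\mathrm{PSU}(1,1)=\{z\mapsto\frac{az+b}{\overline{b}z+\overline{a}} : a,b\in\mathbb{C},\ |a|^2-|b|^2=1\}$ and $\mathrm{PSL}(2,\mathbb{R})=\{z\mapsto\frac{az+b}{cz+d} : a,b,c,d\in\mathbb{R},\ ad-bc=1\}$ respectively. Metrics representing a divisor: let $D=\sum_i(\theta_i-1)p_i$ with $0\le\theta_i\ne1$ and $\mathrm{supp}\,D=\{p_i\}$ closed and discrete (finite or countably infinite). $\mathrm{d}\sigma^2$ is a (singular) conformal hyperbolic metric on $\Sigma$ representing $D$ if: (i) $\mathrm{d}\sigma^2$ is a $C^\infty$ conformal metric of constant curvature $-1$ on $\Sigma\setminus\mathrm{supp}\,D$; (ii) if $\theta_i>0$, then $\mathrm{d}\sigma^2$ has a conical singularity at $p_i$ with cone angle $2\pi\theta_i$, i.e. in a neighborhood $U$ of $p_i$ with complex coordinate $z$, $z(p_i)=0$, one has $\mathrm{d}\sigma^2=e^{2u}|\mathrm{d}z|^2$ where $u-(\theta_i-1)\ln|z|$ extends to a continuous function on $U$; (iii) if $\theta_i=0$,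 then $\mathrm{d}\sigma^2$ has a cusp singularity at $p_i$, i.e. in a neighborhood $V$ of $p_i$ with complex coordinate $z$, $z(p_i)=0$, one has $\mathrm{d}\sigma^2=e^{2u}|\mathrm{d}z|^2$ where $u+\ln|z|+\ln(-\ln|z|)$ extends to a continuous function on $V$. Developing map: a multi-valued locally univalent meromorphic function $F$ on a Riemann surface is called projective if any two of its function elements $\mathfrak{F}_1,\mathfrak{F}_2$ near a point are related by $\mathfrak{F}_1=\mathfrak{L}\circ\mathfrak{F}_2$ for some $\mathfrak{L}\in\mathrm{PGL}(2,\mathbb{C})$. A developing map of $\mathrm{d}\sigma^2$ is a projective function $F:\Sigma\setminus\mathrm{supp}\,D\to\mathbb{D}$ with $\mathrm{d}\sigma^2=F^*\mathrm{d}\sigma^2_{\mathbb{D}}$ (respectively $F:\Sigma\setminus\mathrm{supp}\,D\to\mathbb{H}$ with $\mathrm{d}\sigma^2=F^*\mathrm{d}\sigma^2_{\mathbb{H}}$). Equivalently, $F$ is a locally injective holomorphic function from the universal cover of $\Sigma\setminus\mathrm{supp}\,D$ to $\mathbb{D}$ (respectively $\mathbb{H}$) whose pullback of the hyperbolic metric is the lift of $\mathrm{d}\sigma^2$. On a punctured neighborhood $U\setminus\{p\}$ of a singularity, $F$ is understood as the multi-valued function obtained by analytically continuing a chosen function element of $F$ along paths in $U\setminus\{p\}$; "$G(z)=z^\alpha$" and "$G(z)=-\sqrt{-1}\log z$" are equalities of such multi-valued functions (i.e. some, with its continuations, function element of $G$ is a branch of the right-hand side). *)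

theory Defs
  imports "HOL-Complex_Analysis.Complex_Analysis"
begin

section \<open>Riemann surfaces\<close>

text \<open>
  A Riemann surface is an abstract topology \<open>X\<close> with a holomorphic atlas \<open>A\<close>. A chart is a pair
  of its domain \<open>U\<close> and its coordinate function \<open>z\<close>; the values of \<open>z\<close> outside \<open>U\<close> are
  irrelevant.
\<close>

type_synonym 'a chart = "'a set \<times> ('a \<Rightarrow> complex)"

definition is_chart :: "'a topology \<Rightarrow> 'a set \<Rightarrow> ('a \<Rightarrow> complex) \<Rightarrow> bool" where
  "is_chart X U z \<longleftrightarrow> openin X U \<and> open (z ` U) \<and>
     homeomorphic_map (subtopology X U) (top_of_set (z ` U)) z"

definition compatible :: "'a chart \<Rightarrow> 'a chart \<Rightarrow> bool" where
  "compatible c d \<longleftrightarrow> (case (c, d) of ((U, z), (W, w)) \<Rightarrow>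
     (w \<circ> inv_into U z) holomorphic_on z ` (U \<inter> W) \<and>
     (z \<circ> inv_into W w) holomorphic_on w ` (U \<inter> W))"

definition riemann_surface :: "'a topology \<Rightarrow> 'a chart set \<Rightarrow> bool" where
  "riemann_surface X A \<longleftrightarrow>
     topspace X \<noteq> {} \<and> Hausdorff_space X \<and> connected_space X \<and>
     (\<forall>(U, z)\<in>A. is_chart X U z) \<and> \<Union> (fst ` A) = topspace X \<and>
     (\<forall>c\<in>A. \<forall>d\<in>A. compatible c d)"

text \<open>The complex coordinates of the surface are the charts of the maximal atlas generated by \<open>A\<close>.\<close>

definition coordinate :: "'a topology \<Rightarrow> 'a chart set \<Rightarrow> 'a set \<Rightarrow> ('a \<Rightarrow> complex) \<Rightarrow> bool" where
  "coordinate X A U z \<longleftrightarrow> is_chart X U z \<and> (\<forall>c\<in>A. compatible (U, z) c)"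

definition holomorphic_in :: "'a chart set \<Rightarrow> 'a set \<Rightarrow> ('a \<Rightarrow> complex) \<Rightarrow> bool" where
  "holomorphic_in A V f \<longleftrightarrow> (\<forall>(U, z)\<in>A. (f \<circ> inv_into U z) holomorphic_on z ` (U \<inter> V))"

text \<open>The derivative \<open>df/dz\<close> at the point \<open>x\<close> of \<open>U\<close>.\<close>

definition coord_deriv :: "'a set \<Rightarrow> ('a \<Rightarrow> complex) \<Rightarrow> ('a \<Rightarrow> complex) \<Rightarrow> 'a \<Rightarrow> complex" where
  "coord_deriv U z f x = deriv (f \<circ> inv_into U z) (z x)"


section \<open>Divisors\<close>

text \<open>
  The divisor \<open>\<Sum>\<^sub>i (\<theta>\<^sub>i - 1) p\<^sub>i\<close> is the function with value \<open>\<theta>\<^sub>i - 1\<close> at \<open>p\<^sub>i\<close> and \<open>0\<close> elsewhere,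
  so that \<open>\<theta>\<^sub>i \<noteq> 1\<close> says that \<open>p\<^sub>i\<close> is in the support.
\<close>

definition supp :: "('a \<Rightarrow> real) \<Rightarrow> 'a set" where
  "supp D = {p. D p \<noteq> 0}"

definition real_divisor :: "'a topology \<Rightarrow> ('a \<Rightarrow> real) \<Rightarrow> bool" where
  "real_divisor X D \<longleftrightarrow> closedin X (supp D) \<and>
     subtopology X (supp D) = discrete_topology (supp D) \<and> countable (supp D)"


section \<open>Singular conformal hyperbolic metrics\<close>

text \<open>
  A conformal metric is given by its densities: \<open>ds z x\<close> is the factor \<open>\<rho>\<close> at the point \<open>x\<close> in the
  expression \<open>\<rho> |dz|\<^sup>2\<close> of the metric in the coordinate \<open>z\<close>. In the notation \<open>e\<^sup>2\<^sup>u |dz|\<^sup>2\<close> one has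
  \<open>u = ln \<rho> / 2\<close>.
\<close>

type_synonym 'a density = "('a \<Rightarrow> complex) \<Rightarrow> 'a \<Rightarrow> real"

definition log_factor :: "'a density \<Rightarrow> ('a \<Rightarrow> complex) \<Rightarrow> 'a \<Rightarrow> real" where
  "log_factor ds z x = ln (ds z x) / 2"

definition dx :: "(complex \<Rightarrow> real) \<Rightarrow> complex \<Rightarrow> real" where
  "dx f w = frechet_derivative f (at w) 1"

definition dy :: "(complex \<Rightarrow> real) \<Rightarrow> complex \<Rightarrow> real" where
  "dy f w = frechet_derivative f (at w) \<i>"

primrec Ck_on :: "nat \<Rightarrow> (complex \<Rightarrow> real) \<Rightarrow> complex set \<Rightarrow> bool" where
  "Ck_on 0 f S \<longleftrightarrow> continuous_on S f"
| "Ck_on (Suc k) f S \<longleftrightarrow>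
     (\<forall>w\<in>S. f differentiable (at w)) \<and> Ck_on k (dx f) S \<and> Ck_on k (dy f) S"

definition smooth_on :: "(complex \<Rightarrow> real) \<Rightarrow> complex set \<Rightarrow> bool" where
  "smooth_on f S \<longleftrightarrow> (\<forall>k. Ck_on k f S)"

definition laplacian :: "(complex \<Rightarrow> real) \<Rightarrow> complex \<Rightarrow> real" where
  "laplacian f w = dx (dx f) w + dy (dy f) w"

text \<open>The Gaussian curvature of \<open>e\<^sup>2\<^sup>u |dw|\<^sup>2\<close> on a plane domain.\<close>

definition gauss_curvature :: "(complex \<Rightarrow> real) \<Rightarrow> complex \<Rightarrow> real" where
  "gauss_curvature u w = - laplacian u w / exp (2 * u w)"

text \<open>
  A \<open>C\<^sup>\<infinity>\<close> conformal metric on the open set \<open>Y\<close>: positive smooth densities with the transformation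
  law of \<open>\<rho> |dz|\<^sup>2\<close> under changes of coordinates.
\<close>

definition conformal_metric_on ::
  "'a topology \<Rightarrow> 'a chart set \<Rightarrow> 'a set \<Rightarrow> 'a density \<Rightarrow> bool" where
  "conformal_metric_on X A Y ds \<longleftrightarrow>
     (\<forall>U z. coordinate X A U z \<longrightarrow>
        (\<forall>x\<in>U \<inter> Y. ds z x > 0) \<and>
        smooth_on (ds z \<circ> inv_into U z) (z ` (U \<inter> Y))) \<and>
     (\<forall>U z W w. coordinate X A U z \<and> coordinate X A W w \<longrightarrow>
        (\<forall>x\<in>U \<inter> W \<inter> Y. ds z x = ds w x * (cmod (coord_deriv U z w x))\<^sup>2))"

definition hyperbolic_metric_on ::
  "'a topology \<Rightarrow> 'a chart set \<Rightarrow> 'a set \<Rightarrow> 'a density \<Rightarrow> bool" where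
  "hyperbolic_metric_on X A Y ds \<longleftrightarrow>
     conformal_metric_on X A Y ds \<and>
     (\<forall>U z. coordinate X A U z \<longrightarrow>
        (\<forall>x\<in>U \<inter> Y. gauss_curvature (log_factor ds z \<circ> inv_into U z) (z x) = -1))"

text \<open>
  \<open>S\<close> is the set of singular points of the metric. The cone angle is \<open>2 * pi * \<theta>\<close>.
\<close>

definition conical_singularity ::
  "'a topology \<Rightarrow> 'a chart set \<Rightarrow> 'a set \<Rightarrow> 'a density \<Rightarrow> 'a \<Rightarrow> real \<Rightarrow> bool" where
  "conical_singularity X A S ds p \<theta> \<longleftrightarrow>
     (\<exists>U z h. coordinate X A U z \<and> U \<inter> S = {p} \<and> z p = 0 \<and>
        continuous_map (subtopology X U) euclideanreal h \<and>
        (\<forall>x\<in>U - {p}. h x = log_factor ds z x - (\<theta> - 1) * ln (cmod (z x))))"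

text \<open>The condition \<open>|z| < 1\<close> makes \<open>ln (- ln |z|)\<close> meaningful.\<close>

definition cusp_singularity ::
  "'a topology \<Rightarrow> 'a chart set \<Rightarrow> 'a set \<Rightarrow> 'a density \<Rightarrow> 'a \<Rightarrow> bool" where
  "cusp_singularity X A S ds p \<longleftrightarrow>
     (\<exists>V z h. coordinate X A V z \<and> V \<inter> S = {p} \<and> z p = 0 \<and> (\<forall>x\<in>V. cmod (z x) < 1) \<and>
        continuous_map (subtopology X V) euclideanreal h \<and>
        (\<forall>x\<in>V - {p}. h x = log_factor ds z x + ln (cmod (z x)) + ln (- ln (cmod (z x)))))"

definition hyperbolic_metric_representing ::
  "'a topology \<Rightarrow> 'a chart set \<Rightarrow> ('a \<Rightarrow> real) \<Rightarrow> 'a density \<Rightarrow> bool" where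
  "hyperbolic_metric_representing X A D ds \<longleftrightarrow>
     hyperbolic_metric_on X A (topspace X - supp D) ds \<and>
     (\<forall>p\<in>supp D. 0 < D p + 1 \<longrightarrow> conical_singularity X A (supp D) ds p (D p + 1)) \<and>
     (\<forall>p\<in>supp D. D p + 1 = 0 \<longrightarrow> cusp_singularity X A (supp D) ds p)"


section \<open>Multi-valued holomorphic functions\<close>

text \<open>
  A function element on the open set \<open>Y\<close> is a domain \<open>V\<close> in \<open>Y\<close> with a holomorphic function on \<open>V\<close>.
  Only finite values are needed, since developing maps take values in the disc or the half-plane.
\<close>

type_synonym 'a elem = "'a set \<times> ('a \<Rightarrow> complex)"

definition function_element :: "'a topology \<Rightarrow> 'a chart set \<Rightarrow> 'a set \<Rightarrow> 'a elem \<Rightarrow> bool" where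
  "function_element X A Y e \<longleftrightarrow> (case e of (V, f) \<Rightarrow>
     openin X V \<and> connectedin X V \<and> V \<noteq> {} \<and> V \<subseteq> Y \<and> holomorphic_in A V f)"

definition same_germ :: "'a topology \<Rightarrow> 'a \<Rightarrow> 'a elem \<Rightarrow> 'a elem \<Rightarrow> bool" where
  "same_germ X p e e' \<longleftrightarrow> p \<in> fst e \<and> p \<in> fst e' \<and>
     eventually (\<lambda>x. snd e x = snd e' x) (nhdsin X p)"

definition continuation_along ::
  "'a topology \<Rightarrow> 'a chart set \<Rightarrow> 'a set \<Rightarrow> (real \<Rightarrow> 'a) \<Rightarrow> (real \<Rightarrow> 'a elem) \<Rightarrow> bool" where
  "continuation_along X A Y \<gamma> E \<longleftrightarrow>
     pathin (subtopology X Y) \<gamma> \<and>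
     (\<forall>t\<in>{0..1}. function_element X A Y (E t) \<and> \<gamma> t \<in> fst (E t) \<and>
        (\<exists>\<epsilon>>0. \<forall>s\<in>{0..1}. \<bar>s - t\<bar> < \<epsilon> \<longrightarrow> same_germ X (\<gamma> s) (E s) (E t)))"

text \<open>All function elements on \<open>Y\<close> obtained from \<open>e\<close> by continuation along paths in \<open>Y\<close>.\<close>

definition continuations ::
  "'a topology \<Rightarrow> 'a chart set \<Rightarrow> 'a set \<Rightarrow> 'a elem \<Rightarrow> 'a elem set" where
  "continuations X A Y e = {e'. \<exists>\<gamma> E. continuation_along X A Y \<gamma> E \<and> E 0 = e \<and> E 1 = e'}"

text \<open>
  A multi-valued function on \<open>Y\<close> is identified with the set of its function elements: all
  continuations of one element, which has to be continuable along every path in \<open>Y\<close>.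
\<close>

definition multivalued_function ::
  "'a topology \<Rightarrow> 'a chart set \<Rightarrow> 'a set \<Rightarrow> 'a elem set \<Rightarrow> bool" where
  "multivalued_function X A Y F \<longleftrightarrow>
     (\<exists>e. function_element X A Y e \<and> F = continuations X A Y e) \<and>
     (\<forall>e\<in>F. \<forall>\<gamma>. pathin (subtopology X Y) \<gamma> \<and> \<gamma> 0 \<in> fst e \<longrightarrow>
        (\<exists>E. continuation_along X A Y \<gamma> E \<and> E 0 = e))"

definition locally_injective :: "'a topology \<Rightarrow> 'a elem \<Rightarrow> bool" where
  "locally_injective X e \<longleftrightarrow>
     (\<forall>x\<in>fst e. \<exists>N. openin X N \<and> x \<in> N \<and> N \<subseteq> fst e \<and> inj_on (snd e) N)"

definition moebius :: "complex \<Rightarrow> complex \<Rightarrow> complex \<Rightarrow> complex \<Rightarrow> complex \<Rightarrow> complex" where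
  "moebius a b c d w = (a * w + b) / (c * w + d)"

text \<open>
  In the \<open>PGL(2,\<complex>)\<close> relation between two elements the denominator is required not to vanish,
  because the values are finite and division by zero yields \<open>0\<close> in HOL.
\<close>

definition projective_function ::
  "'a topology \<Rightarrow> 'a chart set \<Rightarrow> 'a set \<Rightarrow> 'a elem set \<Rightarrow> bool" where
  "projective_function X A Y F \<longleftrightarrow>
     multivalued_function X A Y F \<and> (\<forall>e\<in>F. locally_injective X e) \<and>
     (\<forall>(V, f)\<in>F. \<forall>(W, g)\<in>F. \<forall>p\<in>V \<inter> W.
        \<exists>a b c d. a * d - b * c \<noteq> 0 \<and>
          eventually (\<lambda>x. c * g x + d \<noteq> 0 \<and> f x = moebius a b c d (g x)) (nhdsin X p))"


section \<open>Developing maps\<close>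

abbreviation unit_disc :: "complex set" where
  "unit_disc \<equiv> {w. cmod w < 1}"

abbreviation upper_half_plane :: "complex set" where
  "upper_half_plane \<equiv> {w. Im w > 0}"

definition disc_density :: "complex \<Rightarrow> real" where
  "disc_density w = 4 / (1 - (cmod w)\<^sup>2)\<^sup>2"

definition half_plane_density :: "complex \<Rightarrow> real" where
  "half_plane_density w = 1 / (Im w)\<^sup>2"

definition PSU11 :: "(complex \<Rightarrow> complex) set" where
  "PSU11 = {moebius a b (cnj b) (cnj a) | a b. (cmod a)\<^sup>2 - (cmod b)\<^sup>2 = 1}"

definition PSL2R :: "(complex \<Rightarrow> complex) set" where
  "PSL2R = {moebius (of_real a) (of_real b) (of_real c) (of_real d) | a b c d :: real.
              a * d - b * c = 1}"

text \<open>The metric \<open>ds\<close> on \<open>Y\<close> is the pullback under \<open>F\<close> of \<open>\<rho> |dw|\<^sup>2\<close> on the plane domain \<open>T\<close>.\<close>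

definition developing_map ::
  "'a topology \<Rightarrow> 'a chart set \<Rightarrow> 'a set \<Rightarrow> 'a density \<Rightarrow>
   complex set \<Rightarrow> (complex \<Rightarrow> real) \<Rightarrow> 'a elem set \<Rightarrow> bool" where
  "developing_map X A Y ds T \<rho> F \<longleftrightarrow>
     projective_function X A Y F \<and>
     (\<forall>(V, f)\<in>F. f ` V \<subseteq> T \<and>
        (\<forall>U z. coordinate X A U z \<longrightarrow>
           (\<forall>x\<in>U \<inter> V. ds z x = \<rho> (f x) * (cmod (coord_deriv U z f x))\<^sup>2)))"

text \<open>
  The multi-valued function \<open>\<phi> (log z)\<close> on \<open>Y\<close>, for an entire function \<open>\<phi>\<close>. The logarithm is only
  asked to exist locally: on an annulus around \<open>z = 0\<close> the function \<open>z\<^sup>2\<close> is a single-valued element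
  of \<open>z\<^sup>\<alpha>\<close> for \<open>\<alpha> = 2\<close>, but there is no logarithm of \<open>z\<close>.
\<close>

definition of_log ::
  "'a topology \<Rightarrow> 'a chart set \<Rightarrow> 'a set \<Rightarrow> (complex \<Rightarrow> complex) \<Rightarrow> ('a \<Rightarrow> complex) \<Rightarrow> 'a elem set" where
  "of_log X A Y \<phi> z = {(W, h). function_element X A Y (W, h) \<and>
     (\<forall>x\<in>W. \<exists>N l. openin X N \<and> x \<in> N \<and> N \<subseteq> W \<and>
        continuous_map (subtopology X N) euclidean l \<and>
        (\<forall>y\<in>N. exp (l y) = z y \<and> h y = \<phi> (l y)))}"

definition multivalued_power ::
  "'a topology \<Rightarrow> 'a chart set \<Rightarrow> 'a set \<Rightarrow> real \<Rightarrow> ('a \<Rightarrow> complex) \<Rightarrow> 'a elem set" where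
  "multivalued_power X A Y \<alpha> = of_log X A Y (\<lambda>l. exp (of_real \<alpha> * l))"

definition multivalued_minus_i_log ::
  "'a topology \<Rightarrow> 'a chart set \<Rightarrow> 'a set \<Rightarrow> ('a \<Rightarrow> complex) \<Rightarrow> 'a elem set" where
  "multivalued_minus_i_log X A Y = of_log X A Y (\<lambda>l. - \<i> * l)"

text \<open>
  \<open>L \<circ> F\<close> has the form \<open>M\<close> on \<open>Y\<close>: for some function element \<open>f\<close> of \<open>F\<close> over a domain in \<open>Y\<close>, the
  multi-valued function on \<open>Y\<close> obtained from \<open>L \<circ> f\<close> by continuation along paths in \<open>Y\<close> is \<open>M\<close>.
\<close>

definition has_form_on ::
  "'a topology \<Rightarrow> 'a chart set \<Rightarrow> 'a set \<Rightarrow> (complex \<Rightarrow> complex) \<Rightarrow> 'a elem set \<Rightarrow> 'a elem set \<Rightarrow> bool" where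
  "has_form_on X A Y L F M \<longleftrightarrow>
     (\<exists>(V, f)\<in>F. V \<subseteq> Y \<and> continuations X A Y (V, L \<circ> f) = M)"

end

theory Submission
  imports Defs "HOL-Real_Asymp.Real_Asymp"
begin

text \<open>
  In a coordinate disc around the singularity, parametrise the punctured disc by \<open>exp\<close> from a left
  half-plane. By monodromy \<open>F\<close> lifts to a single-valued \<open>g\<close> there, and \<open>g (\<zeta> + 2\<pi>i) = M (g \<zeta>)\<close> for a
  Moebius transformation \<open>M\<close>, which is an isometry because the metric is \<open>2\<pi>i\<close>-periodic.

  At a cone the lengths of the horizontal rays are finite, so \<open>g\<close> has a limit in the disc, fixed by
  \<open>M\<close>. Moving it to \<open>0\<close> turns \<open>M\<close> into a rotation, hence \<open>g \<zeta> = exp (\<gamma> \<zeta>) exp (k (exp \<zeta>))\<close> with \<open>k\<close>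
  holomorphic at \<open>0\<close>; comparing with the metric gives \<open>\<gamma> = \<alpha>\<close>, and \<open>w exp (k w / \<alpha>)\<close> is the coordinate.

  At a cusp \<open>M\<close> cannot be elliptic or the identity, since then \<open>g\<close> would have the above form and its
  metric would decay exponentially in \<open>Re \<zeta>\<close>, and it cannot be hyperbolic, since the loops around the
  cusp become arbitrarily short. So \<open>M\<close> is parabolic, normalised to a translation by \<open>\<plusminus> 2\<pi>\<close>, and
  \<open>exp (i g)\<close> is a bounded function on the punctured disc; its extension is the coordinate.
\<close>

section \<open>Holomorphic functions on a left half-plane\<close>

text \<open>A developing map is generated by one element that may lie far from the singularity, so
  its behaviour there is accessible only along a path in the complement of \<open>supp D\<close>;
  this is why the complement of a closed discrete set has to be shown path connected. The target is
  an equality between sets of function elements, not a formula for one branch. Cone and cusp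
  therefore share the normal form \<open>log_form\<close>, with \<phi> l = exp (\<alpha> l) and
  \<phi> l = - i l: once a single element of the shape \<phi> (log u) is found, its continuations
  are compared with all elements of this shape, in both directions. The monodromy is a priori only
  in PGL(2, C). That it is an isometry follows by comparing the coefficients of a real quadratic
  polynomial that vanishes on the open image of \<open>g\<close>. The singularity conditions give
  the metric up to a continuous function, so exponents are determined by limits as Re \<zeta> tends
  to minus infinity.\<close>

abbreviation left_half :: "real \<Rightarrow> complex set" where
  "left_half B \<equiv> {\<zeta>. Re \<zeta> < B}"

lemma open_left_half: "open (left_half B)"
  by (rule open_halfspace_Re_lt)

lemma convex_left_half: "convex (left_half B)"
  by (rule convex_halfspace_Re_lt)

lemma connected_left_half: "connected (left_half B)"
  by (simp add: convex_left_half convex_connected)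

lemma exp_left_half: "Re \<zeta> < B \<Longrightarrow> exp \<zeta> \<in> ball 0 (exp B) - {0}"
  by simp

text \<open>\<open>Ln\<close> jumps across the negative axis, but periodicity makes
  \<open>k \<circ> Ln\<close> independent of the branch; near every point it equals \<open>k\<close>
  composed with a branch that is holomorphic there.\<close>

lemma periodic_descends:
  assumes hol: "k holomorphic_on left_half B"
    and per: "\<And>\<zeta>. Re \<zeta> < B \<Longrightarrow> k (\<zeta> + 2 * of_real pi * \<i>) = k \<zeta>"
  obtains K where "K holomorphic_on ball 0 (exp B) - {0}" "\<And>\<zeta>. Re \<zeta> < B \<Longrightarrow> K (exp \<zeta>) = k \<zeta>"
proof
  let ?K = "k \<circ> Ln"
  have pern: "k (\<zeta> + of_nat n * (2 * of_real pi * \<i>)) = k \<zeta>" if "Re \<zeta> < B" for \<zeta> n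
  proof (induction n)
    case (Suc n)
    have "k (\<zeta> + of_nat n * (2 * of_real pi * \<i>) + 2 * of_real pi * \<i>) = k (\<zeta> + of_nat n * (2 * of_real pi * \<i>))"
      by (rule per) (use that in simp)
    with Suc show ?case by (simp add: algebra_simps)
  qed auto
  have peri: "k \<zeta> = k \<eta>" if that': "Re \<zeta> < B" "exp \<zeta> = exp \<eta>" for \<zeta> \<eta>
  proof -
    obtain n :: int where n: "\<zeta> = \<eta> + (of_int (2 * n) * pi) * \<i>"
      using that'(2) by (auto simp: exp_eq)
    have re: "Re \<eta> < B" using that' n by simp
    show ?thesis
    proof (cases "n \<ge> 0")
      case True
      then have "\<zeta> = \<eta> + of_nat (nat n) * (2 * of_real pi * \<i>)" by (simp add: n)
      then show ?thesis using pern[OF re, of "nat n"] by simp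
    next
      case False
      then have "\<eta> = \<zeta> + of_nat (nat (-n)) * (2 * of_real pi * \<i>)" by (simp add: n)
      then show ?thesis using pern[OF that'(1), of "nat (-n)"] by simp
    qed
  qed
  show K: "?K (exp \<zeta>) = k \<zeta>" if "Re \<zeta> < B" for \<zeta>
    using peri[OF that, of "Ln (exp \<zeta>)"] by simp
  show "?K holomorphic_on ball 0 (exp B) - {0}"
  proof (rule holomorphic_onI)
    fix w :: complex assume w: "w \<in> ball 0 (exp B) - {0}"
    \<comment> \<open>On the half-plane around the ray through \<open>w\<close> the quotient
      \<open>v / w\<close> avoids the cut of \<open>Ln\<close>, so \<open>?l\<close> is a
      holomorphic logarithm near \<open>w\<close>.\<close>
    let ?S = "{v. 0 < Re (v / w)} \<inter> (ball 0 (exp B) - {0})"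
    let ?l = "\<lambda>v. Ln (v / w) + Ln w"
    have nz: "v / w \<notin> \<real>\<^sub>\<le>\<^sub>0" if "v \<in> ?S" for v
      using that by (auto simp: complex_nonpos_Reals_iff)
    have opS: "open ?S"
    proof -
      have "{v. 0 < Re (v / w)} = (\<lambda>v. Re (v / w)) -` {0<..}" by auto
      moreover have "open \<dots>" using w by (intro open_vimage continuous_intros) auto
      ultimately show ?thesis by auto
    qed
    have lS: "exp (?l v) = v" "Re (?l v) < B" if "v \<in> ?S" for v
    proof -
      show e: "exp (?l v) = v" using that w by (simp add: exp_add)
      have "exp (Re (?l v)) < exp B" using that e by (metis IntD2 DiffD1 mem_ball_0 norm_exp_eq_Re)
      then show "Re (?l v) < B" by simp
    qed
    have wS: "w \<in> ?S" using w by auto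
    have "?l holomorphic_on ?S"
      using w nz by (intro holomorphic_intros) auto
    moreover have "?l ` ?S \<subseteq> left_half B" using lS(2) by blast
    ultimately have "(k \<circ> ?l) holomorphic_on ?S"
      using hol holomorphic_on_compose holomorphic_on_subset by blast
    then have "?K holomorphic_on ?S"
      by (rule holomorphic_transform) (use K lS in \<open>metis comp_apply\<close>)
    then show "?K field_differentiable at w within ball 0 (exp B) - {0}"
      using opS wS by (meson field_differentiable_at_within holomorphic_on_imp_differentiable_at)
  qed
qed

text \<open>With exp (2 pi i \<beta>) = c, the quotient of \<open>q\<close> by exp (\<beta> \<zeta>)
  is periodic and descends to a bounded function on the punctured disc. Its extension vanishes at 0
  to a finite order m, since \<open>q\<close> is not identically zero, and \<gamma> = \<beta> +
  m.\<close>

lemma rotation_form: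
  assumes hol: "q holomorphic_on left_half B"
    and bd: "\<And>\<zeta>. Re \<zeta> < B \<Longrightarrow> cmod (q \<zeta>) < 1"
    and rot: "\<And>\<zeta>. Re \<zeta> < B \<Longrightarrow> q (\<zeta> + 2 * of_real pi * \<i>) = c * q \<zeta>" and c: "cmod c = 1"
    and nz: "Re \<zeta>0 < B" "q \<zeta>0 \<noteq> 0"
  obtains \<gamma> B' k where "0 \<le> \<gamma>" "B' \<le> B" "k holomorphic_on ball 0 (exp B')"
    "\<And>\<zeta>. Re \<zeta> < B' \<Longrightarrow> q \<zeta> = exp (of_real \<gamma> * \<zeta>) * exp (k (exp \<zeta>))"
proof -
  \<comment> \<open>The integer shift keeps exp (2 pi i \<beta>) = c and makes
    \<open>\<beta>\<close> nonpositive; then exp (- \<beta> \<zeta>) is bounded on the half-plane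
    and the singularity of the quotient at 0 is removable.\<close>
  define \<beta> where "\<beta> = Arg c / (2 * pi) - 1"
  have \<beta>: "\<beta> \<le> 0" using mpi_less_Arg[of c] Arg_le_pi[of c] by (simp add: \<beta>_def field_simps)
  have c_eq: "exp (of_real \<beta> * (2 * of_real pi * \<i>)) = c"
  proof -
    have "of_real \<beta> * (2 * of_real pi * \<i>) = \<i> * Arg c - 2 * of_real pi * \<i>"
      by (simp add: \<beta>_def field_simps)
    then show ?thesis
      using c Arg_eq[of c] by (simp add: exp_diff) (metis c norm_zero zero_neq_one)
  qed
  define k0 where "k0 = (\<lambda>\<zeta>. exp (- of_real \<beta> * \<zeta>) * q \<zeta>)"
  have "k0 holomorphic_on left_half B"
    unfolding k0_def by (intro holomorphic_intros hol)
  moreover have "k0 (\<zeta> + 2 * of_real pi * \<i>) = k0 \<zeta>" if "Re \<zeta> < B" for \<zeta>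
  proof -
    have "exp (- of_real \<beta> * (\<zeta> + 2 * of_real pi * \<i>)) = exp (- of_real \<beta> * \<zeta>) / c"
      by (simp add: c_eq[symmetric] exp_diff[symmetric] ring_distribs)
    then show ?thesis using rot[OF that] c by (auto simp: k0_def)
  qed
  ultimately obtain K where K: "K holomorphic_on ball 0 (exp B) - {0}"
    and Keq: "\<And>\<zeta>. Re \<zeta> < B \<Longrightarrow> K (exp \<zeta>) = k0 \<zeta>"
    using periodic_descends by blast
  have Kbd: "cmod (K w) \<le> exp (- \<beta> * B)" if "w \<in> ball 0 (exp B) - {0}" for w
  proof -
    define \<zeta> where "\<zeta> = Ln w"
    have \<zeta>: "w = exp \<zeta>" using that by (simp add: \<zeta>_def)
    with that have re: "Re \<zeta> < B" by simp
    have "cmod (K w) \<le> exp (- \<beta> * Re \<zeta>) * 1"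
      unfolding \<zeta> Keq[OF re] k0_def norm_mult
      by (intro mult_mono) (use bd[OF re] in auto)
    also have "\<dots> \<le> exp (- \<beta> * B)" using re \<beta> by (auto intro: mult_left_mono_neg)
    finally show ?thesis .
  qed
  have "\<exists>G. G holomorphic_on ball 0 (exp B) \<and> (\<forall>z\<in>ball 0 (exp B) - {0}. G z = K z)"
  proof (subst holomorphic_on_extend_bounded)
    show "\<exists>M. \<forall>\<^sub>F z in at 0. norm (K z) \<le> M"
    proof
      have "\<forall>\<^sub>F z in at 0. z \<in> ball 0 (exp B) - {0::complex}"
        using eventually_at_in_open[of "ball 0 (exp B)" "0::complex"] by simp
      then show "\<forall>\<^sub>F z in at 0. norm (K z) \<le> exp (- \<beta> * B)"
        by eventually_elim (rule Kbd)
    qed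
  qed (use K in auto)
  then obtain G where G: "G holomorphic_on ball 0 (exp B)"
    and GK: "\<And>z. z \<in> ball 0 (exp B) - {0} \<Longrightarrow> G z = K z" by blast
  have Gq: "G (exp \<zeta>) = k0 \<zeta>" if "Re \<zeta> < B" for \<zeta>
    using GK[of "exp \<zeta>"] Keq[OF that] that by simp
  have "\<exists>w\<in>ball 0 (exp B). G w \<noteq> 0"
    using Gq[OF nz(1)] nz by (intro bexI[of _ "exp \<zeta>0"]) (auto simp: k0_def)
  have z0: "0 \<in> ball (0::complex) (exp B)" by simp
  \<comment> \<open>Splitting off the power of w leaves a zero-free factor on a small disc, which
    has a logarithm \<open>k\<close> there.\<close>
  from conjunct2[OF zorder_exist_zero[OF G open_ball connected_ball z0 \<open>\<exists>w\<in>ball 0 (exp B). G w \<noteq> 0\<close>]]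
  obtain r where r: "r > 0" "cball (0::complex) r \<subseteq> ball 0 (exp B)" "zor_poly G 0 holomorphic_on cball 0 r"
      and r4: "\<forall>w\<in>cball 0 r. G w = zor_poly G 0 w * (w - 0) ^ nat (zorder G 0) \<and> zor_poly G 0 w \<noteq> 0"
    by blast
  obtain k where k: "k holomorphic_on ball 0 r" "\<And>w. w \<in> ball 0 r \<Longrightarrow> exp (k w) = zor_poly G 0 w"
    by (rule holomorphic_logarithm_exists[of "ball 0 r" "zor_poly G 0" 0])
       (use r r4 holomorphic_on_subset[OF r(3) ball_subset_cball] in auto)
  define m where "m = nat (zorder G 0)"
  define \<gamma> where "\<gamma> = \<beta> + m"
  define B' where "B' = ln r"
  have rB: "exp B' = r" using r by (simp add: B'_def)
  have "B' \<le> B"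
  proof -
    have "complex_of_real r \<in> cball 0 r" using r(1) by simp
    then have "complex_of_real r \<in> ball 0 (exp B)" using r(2) by blast
    then have "exp B' < exp B" using r rB by simp
    then show ?thesis by simp
  qed
  have form: "q \<zeta> = exp (of_real \<gamma> * \<zeta>) * exp (k (exp \<zeta>))" if "Re \<zeta> < B'" for \<zeta>
  proof -
    have w: "exp \<zeta> \<in> ball 0 r" using exp_left_half[OF that] rB by auto
    have "exp (- of_real \<beta> * \<zeta>) * q \<zeta> = exp (k (exp \<zeta>)) * exp \<zeta> ^ m"
      using Gq[of \<zeta>] bspec[OF r4, of "exp \<zeta>"] k(2)[OF w] w that \<open>B' \<le> B\<close> by (auto simp: k0_def m_def)
    also have "exp \<zeta> ^ m = exp (of_nat m * \<zeta>)" by (simp add: exp_of_nat_mult)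
    finally have "exp (of_real \<beta> * \<zeta>) * (exp (- of_real \<beta> * \<zeta>) * q \<zeta>)
        = exp (of_real \<beta> * \<zeta>) * (exp (k (exp \<zeta>)) * exp (of_nat m * \<zeta>))" by simp
    then show ?thesis
      by (simp add: \<gamma>_def exp_add ring_distribs mult.assoc[symmetric] exp_minus)
  qed
  \<comment> \<open>A negative exponent would make the modulus of \<open>q\<close> unbounded along
    the real axis towards minus infinity.\<close>
  have "0 \<le> \<gamma>"
  proof (rule ccontr)
    assume neg: "\<not> 0 \<le> \<gamma>"
    have "isCont k 0" using k(1) r(1)
      by (metis centre_in_ball continuous_on_eq_continuous_at holomorphic_on_imp_continuous_on open_ball)
    moreover have "((\<lambda>x::real. exp (complex_of_real x)) \<longlongrightarrow> 0) at_bot"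
    proof (rule tendsto_norm_zero_cancel)
      show "((\<lambda>x. cmod (exp (complex_of_real x))) \<longlongrightarrow> 0) at_bot"
        unfolding norm_exp_eq_Re Re_complex_of_real by (rule exp_at_bot)
    qed
    ultimately have "((\<lambda>x::real. cmod (exp (k (exp (complex_of_real x))))) \<longlongrightarrow> cmod (exp (k 0))) at_bot"
      by (intro tendsto_norm tendsto_exp) (rule isCont_tendsto_compose)
    moreover have "filterlim (\<lambda>x. exp (\<gamma> * x)) at_top at_bot" using neg by real_asymp
    ultimately have "filterlim (\<lambda>x::real. cmod (exp (k (exp (complex_of_real x)))) * exp (\<gamma> * x)) at_top at_bot"
      using filterlim_tendsto_pos_mult_at_top[of "\<lambda>x::real. cmod (exp (k (exp (complex_of_real x))))"
        "cmod (exp (k 0))" at_bot "\<lambda>x. exp (\<gamma> * x)"] norm_exp_eq_Re[of "k 0"] by simp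
    then have "\<forall>\<^sub>F x in at_bot. 1 < cmod (exp (k (exp (complex_of_real x)))) * exp (\<gamma> * x)"
      by (simp add: filterlim_at_top_dense)
    moreover have "\<forall>\<^sub>F x in at_bot. x < B'" by (rule eventually_gt_at_bot)
    ultimately have "\<forall>\<^sub>F x::real in at_bot. False"
    proof eventually_elim
      case (elim x)
      then show False using form[of "of_real x"] bd[of "of_real x"] \<open>B' \<le> B\<close>
        by (simp add: norm_mult mult.commute)
    qed
    then show False by simp
  qed
  show ?thesis
    by (rule that[OF \<open>0 \<le> \<gamma>\<close> \<open>B' \<le> B\<close> _ form]) (use k rB in auto)
qed

section \<open>Moebius monodromy\<close>

text \<open>The relation is asked near a single point only, because this is what two elements of a
  projective function over one point provide.\<close>

definition moebius_monodromy :: "real \<Rightarrow> (complex \<Rightarrow> complex) \<Rightarrow> bool" where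
  "moebius_monodromy B g \<longleftrightarrow> (\<exists>\<zeta> a b c d. Re \<zeta> < B \<and> a * d - b * c \<noteq> 0 \<and>
     (\<forall>\<^sub>F \<eta> in nhds \<zeta>. c * g \<eta> + d \<noteq> 0 \<and> g (\<eta> + 2 * of_real pi * \<i>) = moebius a b c d (g \<eta>)))"

lemma shift_holomorphic:
  assumes "g holomorphic_on left_half B"
  shows "(\<lambda>\<zeta>. g (\<zeta> + 2 * of_real pi * \<i>)) holomorphic_on left_half B"
proof -
  have "(g \<circ> (\<lambda>\<zeta>. \<zeta> + 2 * of_real pi * \<i>)) holomorphic_on left_half B"
    by (rule holomorphic_on_compose_gen[OF _ assms]) (auto intro!: holomorphic_intros)
  then show ?thesis by (simp add: o_def)
qed

lemma has_deriv_left_half: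
  assumes "g holomorphic_on left_half B" "Re \<zeta> < B"
  shows "(g has_field_derivative deriv g \<zeta>) (at \<zeta>)"
  using assms open_left_half by (auto intro: holomorphic_derivI)

lemma has_deriv_shift:
  assumes "g holomorphic_on left_half B" "Re \<zeta> < B"
  shows "((\<lambda>\<zeta>. g (\<zeta> + 2 * of_real pi * \<i>)) has_field_derivative deriv g (\<zeta> + 2 * of_real pi * \<i>)) (at \<zeta>)"
proof -
  have 1: "(g has_field_derivative deriv g (\<zeta> + 2 * of_real pi * \<i>)) (at (\<zeta> + 2 * of_real pi * \<i>))"
    using has_deriv_left_half[OF assms(1), of "\<zeta> + 2 * of_real pi * \<i>"] assms(2) by simp
  have 2: "((\<lambda>\<zeta>. \<zeta> + 2 * of_real pi * \<i>) has_field_derivative 1) (at \<zeta>)"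
    by (auto intro!: derivative_eq_intros)
  show ?thesis using DERIV_chain2[where g = "\<lambda>\<zeta>. \<zeta> + 2 * of_real pi * \<i>" and x = \<zeta>, OF 1 2]
    by (simp only: mult_1_right)
qed

text \<open>Dividing by a square root of the determinant normalises it to 1. With denominators
  cleared, both sides are holomorphic, so the identity theorem spreads the relation over the
  half-plane; a zero of \<open>c * g + d\<close> would also be one of \<open>a * g + b\<close>,
  against the determinant. The last relation is the chain rule with derivative 1 / (c w +
  d)^2.\<close>

lemma moebius_monodromyE:
  assumes hol: "g holomorphic_on left_half B" and mon: "moebius_monodromy B g"
  obtains a b c d where "a * d - b * c = 1"
    "\<And>\<zeta>. Re \<zeta> < B \<Longrightarrow> c * g \<zeta> + d \<noteq> 0"
    "\<And>\<zeta>. Re \<zeta> < B \<Longrightarrow> g (\<zeta> + 2 * of_real pi * \<i>) * (c * g \<zeta> + d) = a * g \<zeta> + b"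
    "\<And>\<zeta>. Re \<zeta> < B \<Longrightarrow> deriv g (\<zeta> + 2 * of_real pi * \<i>) * (c * g \<zeta> + d)\<^sup>2 = deriv g \<zeta>"
proof -
  obtain \<zeta>0 a' b' c' d' where 0: "Re \<zeta>0 < B" "a' * d' - b' * c' \<noteq> 0"
    "\<forall>\<^sub>F \<eta> in nhds \<zeta>0. c' * g \<eta> + d' \<noteq> 0 \<and> g (\<eta> + 2 * of_real pi * \<i>) = moebius a' b' c' d' (g \<eta>)"
    using mon by (auto simp: moebius_monodromy_def)
  define s where "s = csqrt (a' * d' - b' * c')"
  have s: "s * s = a' * d' - b' * c'" "s \<noteq> 0"
    using 0(2) power2_csqrt[of "a' * d' - b' * c'"] by (auto simp: s_def power2_eq_square simp del: power2_csqrt)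
  define a b c d where abcd: "a = a' / s" "b = b' / s" "c = c' / s" "d = d' / s"
  have det: "a * d - b * c = 1"
  proof -
    have "a * d - b * c = (a' * d' - b' * c') / (s * s)" by (simp add: abcd diff_divide_distrib)
    then show ?thesis using s 0(2) by simp
  qed
  obtain O' where O': "open O'" "\<zeta>0 \<in> O'"
    "\<And>\<eta>. \<eta> \<in> O' \<Longrightarrow> c' * g \<eta> + d' \<noteq> 0 \<and> g (\<eta> + 2 * of_real pi * \<i>) = moebius a' b' c' d' (g \<eta>)"
    using 0(3) by (auto simp: eventually_nhds)
  have eq: "g (\<zeta> + 2 * of_real pi * \<i>) * (c * g \<zeta> + d) = a * g \<zeta> + b" if "Re \<zeta> < B" for \<zeta>
  proof (rule analytic_continuation_open[of "O' \<inter> left_half B" "left_half B" "\<lambda>\<zeta>. g (\<zeta> + 2 * of_real pi * \<i>) * (c * g \<zeta> + d)" "\<lambda>\<zeta>. a * g \<zeta> + b"])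
    show "O' \<inter> left_half B \<noteq> {}" using 0(1) O'(2) by auto
    show "(\<lambda>\<zeta>. g (\<zeta> + 2 * of_real pi * \<i>) * (c * g \<zeta> + d)) holomorphic_on left_half B"
      by (intro holomorphic_intros hol shift_holomorphic)
    show "(\<lambda>\<zeta>. a * g \<zeta> + b) holomorphic_on left_half B"
      by (intro holomorphic_intros hol)
    show "g (z + 2 * of_real pi * \<i>) * (c * g z + d) = a * g z + b" if "z \<in> O' \<inter> left_half B" for z
    proof -
      have "c * g z + d = (c' * g z + d') / s" "a * g z + b = (a' * g z + b') / s"
        by (simp_all add: abcd add_divide_distrib)
      then show ?thesis using O'(3)[of z] that by (auto simp: moebius_def)
    qed
  qed (use O' open_left_half connected_left_half that in \<open>auto intro: open_Int\<close>)
  have nz: "c * g \<zeta> + d \<noteq> 0" if "Re \<zeta> < B" for \<zeta>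
  proof
    assume z: "c * g \<zeta> + d = 0"
    with eq[OF that] have "a * g \<zeta> + b = 0" by simp
    have "a * d - b * c = a * (c * g \<zeta> + d) - c * (a * g \<zeta> + b)" by (simp add: algebra_simps)
    then show False using det z \<open>a * g \<zeta> + b = 0\<close> by simp
  qed
  have der: "deriv g (\<zeta> + 2 * of_real pi * \<i>) * (c * g \<zeta> + d)\<^sup>2 = deriv g \<zeta>" if re: "Re \<zeta> < B" for \<zeta>
  proof -
    let ?g1 = "g (\<zeta> + 2 * of_real pi * \<i>)" and ?d1 = "deriv g (\<zeta> + 2 * of_real pi * \<i>)"
    have h1: "((\<lambda>\<zeta>. g (\<zeta> + 2 * of_real pi * \<i>) * (c * g \<zeta> + d)) has_field_derivative
        ?d1 * (c * g \<zeta> + d) + c * deriv g \<zeta> * ?g1) (at \<zeta>)"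
      by (auto intro!: derivative_eq_intros has_deriv_shift[OF hol re] has_deriv_left_half[OF hol re])
    have h2: "((\<lambda>\<zeta>. a * g \<zeta> + b) has_field_derivative a * deriv g \<zeta>) (at \<zeta>)"
      by (auto intro!: derivative_eq_intros has_deriv_left_half[OF hol re])
    have ev: "\<forall>\<^sub>F \<eta> in nhds \<zeta>. g (\<eta> + 2 * of_real pi * \<i>) * (c * g \<eta> + d) = a * g \<eta> + b"
      using eventually_nhds_in_open[OF open_left_half, of \<zeta> B] re eq
      by (auto elim!: eventually_mono)
    have "?d1 * (c * g \<zeta> + d) + c * deriv g \<zeta> * ?g1 = a * deriv g \<zeta>"
      by (rule DERIV_unique[OF DERIV_cong_ev[OF refl ev refl, THEN iffD1, OF h1] h2])
    then have "(?d1 * (c * g \<zeta> + d) + c * deriv g \<zeta> * ?g1) * (c * g \<zeta> + d) = a * deriv g \<zeta> * (c * g \<zeta> + d)"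
      by simp
    then have "?d1 * (c * g \<zeta> + d)\<^sup>2 + c * deriv g \<zeta> * (?g1 * (c * g \<zeta> + d)) = a * deriv g \<zeta> * (c * g \<zeta> + d)"
      by (simp add: power2_eq_square algebra_simps)
    then have "?d1 * (c * g \<zeta> + d)\<^sup>2 = (a * d - b * c) * deriv g \<zeta>"
      unfolding eq[OF re] by (simp add: algebra_simps)
    then show ?thesis using det by simp
  qed
  show ?thesis by (rule that[OF det nz eq der])
qed

text \<open>The second difference in the real direction isolates \<open>A\<close>; first differences
  in both directions then isolate \<open>b\<close>. The isometry condition on the monodromy takes
  the form of such an equation.\<close>

lemma quadratic_zero_on_open:
  fixes A C :: real and b :: complex
  assumes "open S" "S \<noteq> {}" and eq: "\<And>w. w \<in> S \<Longrightarrow> A * (cmod w)\<^sup>2 + Im (b * w) + C = 0"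
  shows "A = 0" "b = 0" "C = 0"
proof -
  obtain w0 e where e: "e > 0" "ball w0 e \<subseteq> S" using assms by (meson equals0I openE)
  define d where "d = e / 2"
  have d: "d > 0" "cmod (complex_of_real d) < e" "cmod (complex_of_real d * \<i>) < e"
    using e by (auto simp: d_def norm_mult)
  have P: "A * ((Re w)\<^sup>2 + (Im w)\<^sup>2) + (Re b * Im w + Im b * Re w) + C = 0" if "dist w0 w < e" for w
    using eq[of w] that e(2) by (auto simp: cmod_power2)
  let ?x = "Re w0" and ?y = "Im w0"
  have 1: "A * (?x\<^sup>2 + ?y\<^sup>2) + (Re b * ?y + Im b * ?x) + C = 0" using P[of w0] e by simp
  have 2: "A * ((?x+d)\<^sup>2 + ?y\<^sup>2) + (Re b * ?y + Im b * (?x+d)) + C = 0"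
    using P[of "w0 + of_real d"] d by (simp add: dist_norm)
  have 3: "A * ((?x-d)\<^sup>2 + ?y\<^sup>2) + (Re b * ?y + Im b * (?x-d)) + C = 0"
    using P[of "w0 - of_real d"] d by (simp add: dist_norm)
  have 4: "A * (?x\<^sup>2 + (?y+d)\<^sup>2) + (Re b * (?y+d) + Im b * ?x) + C = 0"
    using P[of "w0 + of_real d * \<i>"] d by (simp add: dist_norm)
  have "2 * A * d\<^sup>2 = A * ((?x+d)\<^sup>2 + ?y\<^sup>2) + (Re b * ?y + Im b * (?x+d)) + C
      + (A * ((?x-d)\<^sup>2 + ?y\<^sup>2) + (Re b * ?y + Im b * (?x-d)) + C)
      - 2 * (A * (?x\<^sup>2 + ?y\<^sup>2) + (Re b * ?y + Im b * ?x) + C)"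
    by (simp add: power2_eq_square algebra_simps)
  also have "\<dots> = 0" unfolding 1 2 3 by simp
  finally have "2 * A * d\<^sup>2 = 0" .
  then show A: "A = 0" using d by simp
  have "Im b * d = 0" using 1 2 A by algebra
  moreover have "Re b * d = 0" using 1 4 A by algebra
  ultimately show "b = 0" using d by (simp add: complex_eq_iff)
  then show "C = 0" using 1 A by simp
qed

lemma open_image_left_half:
  assumes hol: "g holomorphic_on left_half B" and nz: "Re \<zeta> < B" "deriv g \<zeta> \<noteq> 0"
  shows "open (g ` left_half B)"
proof (rule open_mapping_thm[OF hol open_left_half connected_left_half open_left_half order_refl])
  show "\<not> g constant_on left_half B"
  proof
    assume "g constant_on left_half B"
    then obtain c where c: "\<And>\<eta>. Re \<eta> < B \<Longrightarrow> g \<eta> = c" by (auto simp: constant_on_def)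
    have "\<forall>\<^sub>F \<eta> in nhds \<zeta>. g \<eta> = c"
      using eventually_nhds_in_open[OF open_left_half, of \<zeta> B] nz(1) c by (auto elim!: eventually_mono)
    then have "deriv g \<zeta> = deriv (\<lambda>_. c) \<zeta>" by (rule deriv_cong_ev) simp
    then show False using nz(2) by simp
  qed
qed

text \<open>Periodicity of \<open>\<mu>\<close> forces |c w + d|^2 - |a w + b|^2 = 1 - |w|^2 for all
  w in the open image of \<open>g\<close>. The coefficients of this identity together with the
  determinant give d = cnj a and c = cnj b.\<close>

lemma disc_monodromy:
  assumes hol: "g holomorphic_on left_half B" and mon: "moebius_monodromy B g"
    and met: "\<And>\<zeta>. Re \<zeta> < B \<Longrightarrow> 2 * cmod (deriv g \<zeta>) = \<mu> \<zeta> * (1 - (cmod (g \<zeta>))\<^sup>2)"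
    and disc: "\<And>\<zeta>. Re \<zeta> < B \<Longrightarrow> cmod (g \<zeta>) < 1"
    and pos: "\<And>\<zeta>. Re \<zeta> < B \<Longrightarrow> \<mu> \<zeta> > 0"
    and per: "\<And>\<zeta>. Re \<zeta> < B \<Longrightarrow> \<mu> (\<zeta> + 2 * of_real pi * \<i>) = \<mu> \<zeta>"
  obtains a b where "(cmod a)\<^sup>2 - (cmod b)\<^sup>2 = 1"
    "\<And>\<zeta>. Re \<zeta> < B \<Longrightarrow> cnj b * g \<zeta> + cnj a \<noteq> 0"
    "\<And>\<zeta>. Re \<zeta> < B \<Longrightarrow> g (\<zeta> + 2 * of_real pi * \<i>) * (cnj b * g \<zeta> + cnj a) = a * g \<zeta> + b"
proof -
  obtain a b c d where abcd: "a * d - b * c = 1"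
    "\<And>\<zeta>. Re \<zeta> < B \<Longrightarrow> c * g \<zeta> + d \<noteq> 0"
    "\<And>\<zeta>. Re \<zeta> < B \<Longrightarrow> g (\<zeta> + 2 * of_real pi * \<i>) * (c * g \<zeta> + d) = a * g \<zeta> + b"
    "\<And>\<zeta>. Re \<zeta> < B \<Longrightarrow> deriv g (\<zeta> + 2 * of_real pi * \<i>) * (c * g \<zeta> + d)\<^sup>2 = deriv g \<zeta>"
    by (rule moebius_monodromyE[OF hol mon]) (rule that)
  have nz: "deriv g \<zeta> \<noteq> 0" if "Re \<zeta> < B" for \<zeta>
  proof
    assume "deriv g \<zeta> = 0"
    with met[OF that] pos[OF that] have "(cmod (g \<zeta>))\<^sup>2 = 1" by simp
    with disc[OF that] show False using abs_square_less_1[of "cmod (g \<zeta>)"] by simp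
  qed
  have key: "(cmod (c * g \<zeta> + d))\<^sup>2 - (cmod (a * g \<zeta> + b))\<^sup>2 = 1 - (cmod (g \<zeta>))\<^sup>2" if re: "Re \<zeta> < B" for \<zeta>
  proof -
    let ?g1 = "g (\<zeta> + 2 * of_real pi * \<i>)" and ?d1 = "deriv g (\<zeta> + 2 * of_real pi * \<i>)"
    have "\<mu> \<zeta> * (1 - (cmod (g \<zeta>))\<^sup>2) = 2 * cmod (?d1 * (c * g \<zeta> + d)\<^sup>2)"
      using met[OF re] abcd(4)[OF re] by simp
    also have "\<dots> = \<mu> \<zeta> * (1 - (cmod ?g1)\<^sup>2) * (cmod (c * g \<zeta> + d))\<^sup>2"
      using met[of "\<zeta> + 2 * of_real pi * \<i>"] re per[OF re] by (simp add: norm_mult norm_power)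
    also have "\<dots> = \<mu> \<zeta> * ((cmod (c * g \<zeta> + d))\<^sup>2 - (cmod (?g1 * (c * g \<zeta> + d)))\<^sup>2)"
      by (simp add: norm_mult power_mult_distrib right_diff_distrib mult_ac)
    finally show ?thesis using pos[OF re] abcd(3)[OF re] by simp
  qed
  have op: "open (g ` left_half B)" "g ` left_half B \<noteq> {}"
  proof -
    have "Re (of_real (B - 1)) < B" by simp
    then show "open (g ` left_half B)" using open_image_left_half[OF hol _ nz] by blast
    show "g ` left_half B \<noteq> {}" using \<open>Re (of_real (B - 1)) < B\<close> by blast
  qed
  \<comment> \<open>Since Im (2 i x) = 2 Re x, the factor 2 i brings the mixed terms of the squared
    moduli into the required linear form.\<close>
  have "((cmod c)\<^sup>2 - (cmod a)\<^sup>2 + 1) * (cmod w)\<^sup>2 + Im ((2 * \<i> * (c * cnj d - a * cnj b)) * w)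
      + ((cmod d)\<^sup>2 - (cmod b)\<^sup>2 - 1) = 0" if "w \<in> g ` left_half B" for w
  proof -
    have "(cmod (c * w + d))\<^sup>2 - (cmod (a * w + b))\<^sup>2 = 1 - (cmod w)\<^sup>2"
      using that key by auto
    then show ?thesis
      unfolding cmod_power2 by (simp add: power2_eq_square algebra_simps)
  qed
  note q = quadratic_zero_on_open[OF op this]
  have diff: "u * cnj u - v * cnj v = complex_of_real ((cmod u)\<^sup>2 - (cmod v)\<^sup>2)" for u v
    unfolding complex_norm_square[symmetric] by (rule of_real_diff[symmetric])
  have "(cmod a)\<^sup>2 - (cmod c)\<^sup>2 = 1" using q(1) by simp
  then have ac: "a * cnj a - c * cnj c = 1" unfolding diff by (simp only: of_real_1)
  have cd: "c * cnj d = a * cnj b" using q(2) by simp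
  have cd': "cnj c * d = cnj a * b" using arg_cong[OF cd, of cnj] by simp
  \<comment> \<open>Expanding \<open>cnj a\<close> times the determinant and replacing
    \<open>cnj a * b\<close> by \<open>cnj c * d\<close> exposes the factor |a|^2 - |c|^2 = 1 in
    front of \<open>d\<close>. The computation of \<open>c\<close> below is analogous.\<close>
  have "cnj a = cnj a * (a * d - b * c)" using abcd(1) by simp
  also have "\<dots> = a * cnj a * d - (cnj a * b) * c" by (simp add: algebra_simps)
  also have "\<dots> = (a * cnj a - c * cnj c) * d" unfolding cd'[symmetric] by (simp add: algebra_simps)
  finally have d: "cnj a = d" using ac by simp
  have "(cmod d)\<^sup>2 - (cmod b)\<^sup>2 = 1" using q(3) by simp
  then have db: "d * cnj d - b * cnj b = 1" unfolding diff by (simp only: of_real_1)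
  have "cnj b = cnj b * (a * d - b * c)" using abcd(1) by simp
  also have "\<dots> = (a * cnj b) * d - b * cnj b * c" by (simp add: algebra_simps)
  also have "\<dots> = (d * cnj d - b * cnj b) * c" unfolding cd[symmetric] by (simp add: algebra_simps)
  finally have c: "cnj b = c" using db by simp
  have "(cmod a)\<^sup>2 - (cmod b)\<^sup>2 = 1" using q(3) d by (metis complex_mod_cnj eq_iff_diff_eq_0)
  then show ?thesis by (rule that) (use abcd c d in auto)
qed

text \<open>Periodicity of \<open>\<mu>\<close> says that the imaginary part of (a w + b) cnj (c w +
  d) equals that of w on the open image of \<open>g\<close>. Its coefficients and the determinant
  make all four entries real.\<close>

lemma half_plane_monodromy:
  fixes g :: "complex \<Rightarrow> complex"
  assumes hol: "g holomorphic_on left_half B" and mon: "moebius_monodromy B g"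
    and met: "\<And>\<zeta>. Re \<zeta> < B \<Longrightarrow> cmod (deriv g \<zeta>) = \<mu> \<zeta> * Im (g \<zeta>)"
    and im: "\<And>\<zeta>. Re \<zeta> < B \<Longrightarrow> Im (g \<zeta>) > 0"
    and pos: "\<And>\<zeta>. Re \<zeta> < B \<Longrightarrow> \<mu> \<zeta> > 0"
    and per: "\<And>\<zeta>. Re \<zeta> < B \<Longrightarrow> \<mu> (\<zeta> + 2 * of_real pi * \<i>) = \<mu> \<zeta>"
  obtains a b c d :: real where "a * d - b * c = 1"
    "\<And>\<zeta>. Re \<zeta> < B \<Longrightarrow> c * g \<zeta> + d \<noteq> 0"
    "\<And>\<zeta>. Re \<zeta> < B \<Longrightarrow> g (\<zeta> + 2 * of_real pi * \<i>) * (c * g \<zeta> + d) = a * g \<zeta> + b"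
proof -
  obtain a b c d :: complex where abcd: "a * d - b * c = 1"
    "\<And>\<zeta>. Re \<zeta> < B \<Longrightarrow> c * g \<zeta> + d \<noteq> 0"
    "\<And>\<zeta>. Re \<zeta> < B \<Longrightarrow> g (\<zeta> + 2 * of_real pi * \<i>) * (c * g \<zeta> + d) = a * g \<zeta> + b"
    "\<And>\<zeta>. Re \<zeta> < B \<Longrightarrow> deriv g (\<zeta> + 2 * of_real pi * \<i>) * (c * g \<zeta> + d)\<^sup>2 = deriv g \<zeta>"
    by (rule moebius_monodromyE[OF hol mon]) (rule that)
  have nz: "deriv g \<zeta> \<noteq> 0" if "Re \<zeta> < B" for \<zeta>
    using met[OF that] pos[OF that] im[OF that] by auto
  have key: "Im ((a * g \<zeta> + b) * cnj (c * g \<zeta> + d)) = Im (g \<zeta>)" if re: "Re \<zeta> < B" for \<zeta>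
  proof -
    let ?g1 = "g (\<zeta> + 2 * of_real pi * \<i>)" and ?d1 = "deriv g (\<zeta> + 2 * of_real pi * \<i>)"
    have "\<mu> \<zeta> * Im (g \<zeta>) = cmod (?d1 * (c * g \<zeta> + d)\<^sup>2)"
      using met[OF re] abcd(4)[OF re] by simp
    also have "\<dots> = \<mu> \<zeta> * (Im ?g1 * (cmod (c * g \<zeta> + d))\<^sup>2)"
      using met[of "\<zeta> + 2 * of_real pi * \<i>"] re per[OF re] by (simp add: norm_mult norm_power)
    also have "Im ?g1 * (cmod (c * g \<zeta> + d))\<^sup>2 = Im (?g1 * ((c * g \<zeta> + d) * cnj (c * g \<zeta> + d)))"
      unfolding complex_norm_square[symmetric] by simp
    also have "?g1 * ((c * g \<zeta> + d) * cnj (c * g \<zeta> + d)) = (a * g \<zeta> + b) * cnj (c * g \<zeta> + d)"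
      using abcd(3)[OF re] by (metis mult.assoc)
    finally show ?thesis using pos[OF re] by simp
  qed
  have op: "open (g ` left_half B)" "g ` left_half B \<noteq> {}"
  proof -
    have "Re (of_real (B - 1)) < B" by simp
    then show "open (g ` left_half B)" using open_image_left_half[OF hol _ nz] by blast
    show "g ` left_half B \<noteq> {}" using \<open>Re (of_real (B - 1)) < B\<close> by blast
  qed
  \<comment> \<open>The term in \<open>cnj w\<close> is rewritten as one in \<open>w\<close> by
    conjugation, which changes the sign of its imaginary part.\<close>
  have "Im (a * cnj c) * (cmod w)\<^sup>2 + Im ((a * cnj d - cnj b * c - 1) * w)
      + Im (b * cnj d) = 0" if "w \<in> g ` left_half B" for w
  proof -
    have "Im ((a * w + b) * cnj (c * w + d)) = Im w"
      using that key by auto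
    then show ?thesis
      unfolding cmod_power2 by (simp add: power2_eq_square algebra_simps)
  qed
  note q = quadratic_zero_on_open[OF op this]
  have 1: "cnj a * c = a * cnj c" using q(1) by (simp add: complex_eq_iff algebra_simps)
  have 2: "cnj b * d = b * cnj d" using q(3) by (simp add: complex_eq_iff algebra_simps)
  have 3: "a * cnj d - cnj b * c = 1" using q(2) by simp
  have 4: "cnj a * d - b * cnj c = 1" using arg_cong[OF 3, of cnj] by simp
  have 5: "cnj a * cnj d - cnj b * cnj c = 1" using arg_cong[OF abcd(1), of cnj] by simp
  \<comment> \<open>Each entry is multiplied by the conjugated determinant \<open>5\<close>; the
    relations \<open>1\<close> to \<open>4\<close> then turn the product into the conjugate of the
    entry.\<close>
  have "a = a * (cnj a * cnj d - cnj b * cnj c)" using 5 by simp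
  also have "\<dots> = cnj a * (a * cnj d) - cnj b * (a * cnj c)" by (simp add: algebra_simps)
  also have "\<dots> = cnj a * (a * cnj d - cnj b * c)" unfolding 1[symmetric] by (simp add: algebra_simps)
  finally have a: "cnj a = a" using 3 by simp
  have "c = c * (cnj a * cnj d - cnj b * cnj c)" using 5 by simp
  also have "\<dots> = (cnj a * c) * cnj d - cnj b * c * cnj c" by (simp add: algebra_simps)
  also have "\<dots> = cnj c * (a * cnj d - cnj b * c)" unfolding 1 by (simp add: algebra_simps)
  finally have c: "cnj c = c" using 3 by simp
  have "b = b * (cnj a * cnj d - cnj b * cnj c)" using 5 by simp
  also have "\<dots> = cnj a * (b * cnj d) - b * cnj b * cnj c" by (simp add: algebra_simps)
  also have "\<dots> = cnj b * (cnj a * d - b * cnj c)" unfolding 2[symmetric] by (simp add: algebra_simps)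
  finally have b: "cnj b = b" using 4 by simp
  have "d = d * (cnj a * cnj d - cnj b * cnj c)" using 5 by simp
  also have "\<dots> = cnj a * d * cnj d - (cnj b * d) * cnj c" by (simp add: algebra_simps)
  also have "\<dots> = cnj d * (cnj a * d - b * cnj c)" unfolding 2 by (simp add: algebra_simps)
  finally have d: "cnj d = d" using 4 by simp
  have r: "a = of_real (Re a)" "b = of_real (Re b)" "c = of_real (Re c)" "d = of_real (Re d)"
    using a b c d by (auto simp: complex_eq_iff)
  show ?thesis
  proof (rule that[of "Re a" "Re d" "Re b" "Re c"])
    have "complex_of_real (Re a * Re d - Re b * Re c) = 1"
      unfolding of_real_mult of_real_diff using abcd(1) r by metis
    then show "Re a * Re d - Re b * Re c = 1" using of_real_eq_1_iff by blast
  qed (use abcd(2,3) r in auto)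
qed

section \<open>Cusps\<close>

text \<open>The map \<open>u\<close> expresses the new coordinate in the old one, and \<open>l\<close> is a branch of the logarithm of
  the new coordinate, lifted to the half-plane.\<close>

definition log_form :: "real \<Rightarrow> (complex \<Rightarrow> complex) \<Rightarrow> (complex \<Rightarrow> complex) \<Rightarrow> bool" where
  "log_form B \<phi> g \<longleftrightarrow> (\<exists>B' u l. B' \<le> B \<and> u holomorphic_on ball 0 (exp B') \<and> u 0 = 0 \<and> deriv u 0 \<noteq> 0 \<and>
     l holomorphic_on left_half B' \<and>
     (\<forall>\<zeta>. Re \<zeta> < B' \<longrightarrow> exp (l \<zeta>) = u (exp \<zeta>) \<and> g \<zeta> = \<phi> (l \<zeta>)))"

lemma exp_real_tendsto_at_bot: "((\<lambda>x. exp (complex_of_real x)) \<longlongrightarrow> 0) at_bot"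
  by (rule tendsto_norm_zero_cancel) (simp add: exp_at_bot)

lemma exp_real_at_0: "filterlim (\<lambda>x. exp (complex_of_real x)) (at 0) at_bot"
  by (simp add: filterlim_at exp_real_tendsto_at_bot)

lemma deriv_eq_on_open:
  assumes "(f has_field_derivative D) (at x)" "open S" "x \<in> S" "\<And>y. y \<in> S \<Longrightarrow> g y = f y"
  shows "deriv g x = D"
  by (rule DERIV_imp_deriv, rule has_field_derivative_transform_within_open[OF assms(1-3)])
     (simp add: assms(4))

lemma rotation_form_deriv:
  assumes k: "k holomorphic_on ball 0 (exp B)"
    and form: "\<And>\<zeta>. Re \<zeta> < B \<Longrightarrow> q \<zeta> = exp (of_real \<gamma> * \<zeta>) * exp (k (exp \<zeta>))"
    and re: "Re \<zeta> < B"
  shows "deriv q \<zeta> = q \<zeta> * (of_real \<gamma> + deriv k (exp \<zeta>) * exp \<zeta>)"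
proof -
  have w: "exp \<zeta> \<in> ball 0 (exp B)" using re by simp
  have dk: "(k has_field_derivative deriv k (exp \<zeta>)) (at (exp \<zeta>))"
    using holomorphic_derivI[OF k open_ball w] .
  have dk': "((\<lambda>\<zeta>. k (exp \<zeta>)) has_field_derivative deriv k (exp \<zeta>) * exp \<zeta>) (at \<zeta>)"
    by (rule DERIV_chain2[OF dk DERIV_exp])
  show ?thesis
  proof (rule deriv_eq_on_open[OF _ open_left_half _ form])
    show "((\<lambda>\<zeta>. exp (of_real \<gamma> * \<zeta>) * exp (k (exp \<zeta>))) has_field_derivative
        q \<zeta> * (of_real \<gamma> + deriv k (exp \<zeta>) * exp \<zeta>)) (at \<zeta>)"
      by (auto intro!: derivative_eq_intros dk' simp: form[OF re] algebra_simps)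
  qed (use re in auto)
qed

lemma holomorphic_at_0_tendsto:
  assumes k: "k holomorphic_on ball 0 (exp B)"
  shows "((\<lambda>x. k (exp (complex_of_real x))) \<longlongrightarrow> k 0) at_bot"
proof -
  have "isCont k 0"
    by (rule bspec[OF continuous_on_eq_continuous_at[OF open_ball, THEN iffD1, OF holomorphic_on_imp_continuous_on[OF k]]]) simp
  then show ?thesis by (rule isCont_tendsto_compose) (rule exp_real_tendsto_at_bot)
qed

text \<open>On the real axis, multiplying the metric equation by - x leaves the limit exp h0 (1 -
  Q^2) > 0 on one side, whereas the form given by \<open>rotation_form\<close> makes - x times the
  derivative tend to 0.\<close>

lemma no_rotation_at_cusp:
  fixes q :: "complex \<Rightarrow> complex" and h :: "complex \<Rightarrow> real"
  assumes hol: "q holomorphic_on left_half B" and B: "B \<le> 0"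
    and bd: "\<And>\<zeta>. Re \<zeta> < B \<Longrightarrow> cmod (q \<zeta>) < 1"
    and rot: "\<And>\<zeta>. Re \<zeta> < B \<Longrightarrow> q (\<zeta> + 2 * of_real pi * \<i>) = c * q \<zeta>" and c: "cmod c = 1"
    and met: "\<And>\<zeta>. Re \<zeta> < B \<Longrightarrow> 2 * cmod (deriv q \<zeta>) = exp (h (exp \<zeta>)) / (- Re \<zeta>) * (1 - (cmod (q \<zeta>))\<^sup>2)"
    and h: "(h \<longlongrightarrow> h0) (at 0)"
  shows False
proof -
  have dnz: "deriv q \<zeta> \<noteq> 0" if "Re \<zeta> < B" for \<zeta>
  proof
    assume "deriv q \<zeta> = 0"
    with met[OF that] that B have "(cmod (q \<zeta>))\<^sup>2 = 1" by simp
    with bd[OF that] show False using abs_square_less_1[of "cmod (q \<zeta>)"] by simp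
  qed
  have "\<exists>\<zeta>0. Re \<zeta>0 < B \<and> q \<zeta>0 \<noteq> 0"
  proof (rule ccontr)
    assume "\<not> ?thesis"
    then have z: "\<And>\<zeta>. \<zeta> \<in> left_half B \<Longrightarrow> q \<zeta> = 0" by auto
    have "deriv q (of_real (B - 1)) = 0"
      by (rule deriv_eq_on_open[OF DERIV_const open_left_half _ z]) auto
    then show False using dnz[of "of_real (B - 1)"] by simp
  qed
  then obtain \<zeta>0 where \<zeta>0: "Re \<zeta>0 < B" "q \<zeta>0 \<noteq> 0" by blast
  obtain \<gamma> k B' where g: "0 \<le> \<gamma>" "B' \<le> B" "k holomorphic_on ball 0 (exp B')"
    and form: "\<And>\<zeta>. Re \<zeta> < B' \<Longrightarrow> q \<zeta> = exp (of_real \<gamma> * \<zeta>) * exp (k (exp \<zeta>))"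
    by (rule rotation_form[OF hol bd rot c \<zeta>0]; (assumption | rule that))
  let ?e = "\<lambda>x. exp (complex_of_real x)"
  let ?m = "\<lambda>x. cmod (exp (k (?e x)))"
  let ?d = "\<lambda>x. deriv k (?e x)"
  note dq = rotation_form_deriv[OF g(3) form]
  have k': "deriv k holomorphic_on ball 0 (exp B')" using g(3) by (intro holomorphic_deriv) auto
  have dlim: "(?d \<longlongrightarrow> deriv k 0) at_bot" by (rule holomorphic_at_0_tendsto[OF k'])
  have mlim: "(?m \<longlongrightarrow> cmod (exp (k 0))) at_bot"
    by (intro tendsto_norm tendsto_exp holomorphic_at_0_tendsto[OF g(3)])
  have qx: "cmod (q (of_real x)) = exp (\<gamma> * x) * ?m x" if "x < B'" for x
    using form[of "of_real x"] that by (simp add: norm_mult)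
  have evB: "\<forall>\<^sub>F x in at_bot. x < B'" by (rule eventually_gt_at_bot)
  \<comment> \<open>The limit \<open>Q\<close> of the modulus must stay below 1; otherwise both
    sides could tend to 0 without contradiction.\<close>
  have main: "\<exists>Q. 0 \<le> Q \<and> Q < 1 \<and> ((\<lambda>x. cmod (q (of_real x))) \<longlongrightarrow> Q) at_bot \<and>
      ((\<lambda>x. - x * cmod (deriv q (of_real x))) \<longlongrightarrow> 0) at_bot"
  proof (cases "\<gamma> = 0")
    case True
    have "cmod (exp (k w)) < 1" if w: "w \<in> ball 0 (exp B')" "w \<noteq> 0" for w
    proof -
      have "Re (Ln w) < B'" using w ln_less_cancel_iff[of "cmod w" "exp B'"] by simp
      then show ?thesis using form[of "Ln w"] bd[of "Ln w"] w(2) g(2) True by simp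
    qed note lt = this
    have le: "cmod (exp (k 0)) \<le> 1"
    proof (rule tendsto_upperbound[OF mlim])
      show "\<forall>\<^sub>F x in at_bot. ?m x \<le> 1"
        using evB by eventually_elim (use lt in \<open>simp add: less_imp_le\<close>)
    qed simp
    \<comment> \<open>For \<gamma> = 0, \<open>q\<close> is a function of exp \<zeta> that is
      holomorphic at 0. A value of modulus 1 there would make it constant by the maximum principle,
      but the metric equation keeps the derivative of \<open>q\<close> nonzero.\<close>
    have "cmod (exp (k 0)) \<noteq> 1"
    proof
      assume 1: "cmod (exp (k 0)) = 1"
      have "(\<lambda>w. exp (k w)) constant_on ball 0 (exp B')"
      proof (rule maximum_modulus_principle[where \<xi> = 0 and U = "ball 0 (exp B')"])
        show "(\<lambda>w. exp (k w)) holomorphic_on ball 0 (exp B')"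
          by (intro holomorphic_intros g(3))
        show "cmod (exp (k z)) \<le> cmod (exp (k 0))" if "z \<in> ball 0 (exp B')" for z
          unfolding 1 using lt[OF that] 1 by (cases "z = 0") auto
      qed auto
      then obtain C where C: "\<And>w. w \<in> ball 0 (exp B') \<Longrightarrow> exp (k w) = C"
        by (auto simp: constant_on_def)
      have "deriv q (of_real (B' - 1)) = 0"
      proof (rule deriv_eq_on_open[OF DERIV_const open_left_half])
        show "q y = C" if "y \<in> left_half B'" for y
          using form[of y] C[of "exp y"] that True by simp
      qed simp
      then show False using dnz[of "of_real (B' - 1)"] g(2) by simp
    qed
    with le have Q: "cmod (exp (k 0)) < 1" by linarith
    have L1: "((\<lambda>x. (- x * exp x) * (?m x * cmod (?d x))) \<longlongrightarrow> 0 * (cmod (exp (k 0)) * cmod (deriv k 0))) at_bot"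
      by (intro tendsto_mult mlim tendsto_norm dlim) real_asymp
    have L2: "\<forall>\<^sub>F x in at_bot. (- x * exp x) * (?m x * cmod (?d x)) = - x * cmod (deriv q (of_real x))"
      using evB by eventually_elim (simp add: dq norm_mult qx True)
    have "((\<lambda>x. - x * cmod (deriv q (of_real x))) \<longlongrightarrow> 0) at_bot"
      by (rule tendsto_eq_rhs[OF Lim_transform_eventually[OF L1 L2]]) simp
    moreover have "((\<lambda>x. cmod (q (of_real x))) \<longlongrightarrow> cmod (exp (k 0))) at_bot"
      by (rule Lim_transform_eventually[OF mlim]) (use evB in \<open>eventually_elim, simp add: qx True\<close>)
    ultimately show ?thesis using Q norm_ge_zero by blast
  next
    case False
    with g(1) have gp: "\<gamma> > 0" by simp
    have L1: "((\<lambda>x. (- x * exp (\<gamma> * x)) * (?m x * cmod (of_real \<gamma> + ?d x * ?e x))) \<longlongrightarrow>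
        0 * (cmod (exp (k 0)) * cmod (of_real \<gamma> + deriv k 0 * 0))) at_bot"
      by (intro tendsto_mult mlim tendsto_norm tendsto_add tendsto_const dlim exp_real_tendsto_at_bot)
         (use gp in real_asymp)
    have L2: "\<forall>\<^sub>F x in at_bot. (- x * exp (\<gamma> * x)) * (?m x * cmod (of_real \<gamma> + ?d x * ?e x))
        = - x * cmod (deriv q (of_real x))"
      using evB by eventually_elim (simp add: dq norm_mult qx)
    have 1: "((\<lambda>x. - x * cmod (deriv q (of_real x))) \<longlongrightarrow> 0) at_bot"
      by (rule tendsto_eq_rhs[OF Lim_transform_eventually[OF L1 L2]]) simp
    have L1: "((\<lambda>x. exp (\<gamma> * x) * ?m x) \<longlongrightarrow> 0 * cmod (exp (k 0))) at_bot"
      by (intro tendsto_mult mlim) (use gp in real_asymp)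
    have L2: "\<forall>\<^sub>F x in at_bot. exp (\<gamma> * x) * ?m x = cmod (q (of_real x))"
      using evB by eventually_elim (simp add: qx)
    have "((\<lambda>x. cmod (q (of_real x))) \<longlongrightarrow> 0) at_bot"
      by (rule tendsto_eq_rhs[OF Lim_transform_eventually[OF L1 L2]]) simp
    with 1 show ?thesis by (intro exI[of _ 0]) auto
  qed
  then obtain Q where Q: "0 \<le> Q" "Q < 1" "((\<lambda>x. cmod (q (of_real x))) \<longlongrightarrow> Q) at_bot"
      "((\<lambda>x. - x * cmod (deriv q (of_real x))) \<longlongrightarrow> 0) at_bot" by blast
  have hl: "((\<lambda>x. h (?e x)) \<longlongrightarrow> h0) at_bot"
    by (rule filterlim_compose[OF h exp_real_at_0])
  have L1: "((\<lambda>x. exp (h (?e x)) * (1 - (cmod (q (of_real x)))\<^sup>2)) \<longlongrightarrow> exp h0 * (1 - Q\<^sup>2)) at_bot"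
    by (intro tendsto_intros hl Q)
  have L2: "\<forall>\<^sub>F x in at_bot. exp (h (?e x)) * (1 - (cmod (q (of_real x)))\<^sup>2) = 2 * (- x * cmod (deriv q (of_real x)))"
    using evB
  proof eventually_elim
    case (elim x)
    then have "x < 0" "x < B" using g(2) B by auto
    then show ?case using met[of "of_real x"] by (simp add: field_simps)
  qed
  have "((\<lambda>x. 2 * (- x * cmod (deriv q (of_real x)))) \<longlongrightarrow> exp h0 * (1 - Q\<^sup>2)) at_bot"
    by (rule Lim_transform_eventually[OF L1 L2])
  moreover have "((\<lambda>x. 2 * (- x * cmod (deriv q (of_real x)))) \<longlongrightarrow> 2 * 0) at_bot"
    by (intro tendsto_mult tendsto_const Q(4))
  ultimately have "exp h0 * (1 - Q\<^sup>2) = 2 * 0"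
    by (rule tendsto_unique[rotated]) simp
  moreover have "Q\<^sup>2 < 1" using Q(1,2) abs_square_less_1[of Q] by simp
  ultimately show False by simp
qed

text \<open>The Cayley transform that sends w0 to 0 is an isometry between the two models, so the
  same \<open>\<mu>\<close> occurs on both sides; the 2 stems from the 4 in the density of the disc.
  A monodromy fixing w0 becomes a rotation about 0.\<close>

lemma cayley_disc:
  fixes g :: "complex \<Rightarrow> complex"
  assumes hol: "g holomorphic_on left_half B"
    and im: "\<And>\<zeta>. Re \<zeta> < B \<Longrightarrow> Im (g \<zeta>) > 0"
    and met: "\<And>\<zeta>. Re \<zeta> < B \<Longrightarrow> cmod (deriv g \<zeta>) = \<mu> \<zeta> * Im (g \<zeta>)"
    and w0: "Im w0 > 0"
  defines "q \<equiv> \<lambda>\<zeta>. (g \<zeta> - w0) / (g \<zeta> - cnj w0)"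
  shows "q holomorphic_on left_half B" "\<And>\<zeta>. Re \<zeta> < B \<Longrightarrow> g \<zeta> - cnj w0 \<noteq> 0"
    "\<And>\<zeta>. Re \<zeta> < B \<Longrightarrow> cmod (q \<zeta>) < 1"
    "\<And>\<zeta>. Re \<zeta> < B \<Longrightarrow> 2 * cmod (deriv q \<zeta>) = \<mu> \<zeta> * (1 - (cmod (q \<zeta>))\<^sup>2)"
proof -
  show nz: "g \<zeta> - cnj w0 \<noteq> 0" if "Re \<zeta> < B" for \<zeta>
    using im[OF that] w0 by (auto simp: complex_eq_iff)
  show "q holomorphic_on left_half B"
    unfolding q_def using nz by (intro holomorphic_intros hol) auto
  fix \<zeta> assume re: "Re \<zeta> < B"
  have sq: "(cmod (g \<zeta> - cnj w0))\<^sup>2 - (cmod (g \<zeta> - w0))\<^sup>2 = 4 * Im (g \<zeta>) * Im w0"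
    unfolding cmod_power2 by (simp add: power2_eq_square algebra_simps)
  have "(cmod (q \<zeta>))\<^sup>2 = (cmod (g \<zeta> - w0))\<^sup>2 / (cmod (g \<zeta> - cnj w0))\<^sup>2"
    by (simp add: q_def norm_divide power_divide)
  then have q1: "1 - (cmod (q \<zeta>))\<^sup>2 = 4 * Im (g \<zeta>) * Im w0 / (cmod (g \<zeta> - cnj w0))\<^sup>2"
    unfolding sq[symmetric] using nz[OF re] by (simp add: diff_divide_distrib)
  also have "\<dots> > 0" using im[OF re] w0 nz[OF re] by simp
  finally show "cmod (q \<zeta>) < 1" using abs_square_less_1[of "cmod (q \<zeta>)"] by simp
  have "((\<lambda>\<zeta>. (g \<zeta> - w0) / (g \<zeta> - cnj w0)) has_field_derivative
      deriv g \<zeta> * (w0 - cnj w0) / (g \<zeta> - cnj w0)\<^sup>2) (at \<zeta>)"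
    using nz[OF re]
    by (auto intro!: derivative_eq_intros has_deriv_left_half[OF hol re] simp: power2_eq_square algebra_simps)
  then have "deriv q \<zeta> = deriv g \<zeta> * (w0 - cnj w0) / (g \<zeta> - cnj w0)\<^sup>2"
    unfolding q_def by (rule DERIV_imp_deriv)
  moreover have "cmod (w0 - cnj w0) = 2 * Im w0"
    using w0 by (simp add: complex_diff_cnj norm_mult)
  ultimately have "2 * cmod (deriv q \<zeta>) = \<mu> \<zeta> * (4 * Im (g \<zeta>) * Im w0 / (cmod (g \<zeta> - cnj w0))\<^sup>2)"
    using met[OF re] by (simp add: norm_mult norm_divide norm_power)
  then show "2 * cmod (deriv q \<zeta>) = \<mu> \<zeta> * (1 - (cmod (q \<zeta>))\<^sup>2)" unfolding q1 .
qed

lemma left_half_deriv_bound: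
  assumes hol: "f holomorphic_on left_half X" and bd: "\<And>\<zeta>. Re \<zeta> < X \<Longrightarrow> cmod (deriv f \<zeta>) \<le> C"
    and re: "Re \<zeta> < X"
  shows "cmod (f (\<zeta> + 2 * of_real pi * \<i>) - f \<zeta>) \<le> C * (2 * pi)"
proof -
  have "cmod (f (\<zeta> + 2 * of_real pi * \<i>) - f \<zeta>) \<le> C * cmod ((\<zeta> + 2 * of_real pi * \<i>) - \<zeta>)"
  proof (rule field_differentiable_bound[OF convex_left_half])
    show "(f has_field_derivative deriv f z) (at z within left_half X)" if "z \<in> left_half X" for z
      using has_deriv_left_half[OF hol, of z] that by (auto intro: has_field_derivative_at_within)
  qed (use bd re in auto)
  then show ?thesis by (simp add: norm_mult)
qed

text \<open>If \<open>\<kappa> \<noteq> 1\<close>, the logarithm of \<open>q\<close> minus the fixed point changes by \<open>ln \<kappa>\<close> along every loop, but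
  the loops become arbitrarily short.\<close>

lemma affine_cusp_log_form:
  fixes q :: "complex \<Rightarrow> complex" and h :: "complex \<Rightarrow> real" and \<kappa> \<tau> :: real
  assumes hol: "q holomorphic_on left_half B" and B: "B \<le> 0"
    and im: "\<And>\<zeta>. Re \<zeta> < B \<Longrightarrow> Im (q \<zeta>) > 0"
    and met: "\<And>\<zeta>. Re \<zeta> < B \<Longrightarrow> cmod (deriv q \<zeta>) = exp (h (exp \<zeta>)) / (- Re \<zeta>) * Im (q \<zeta>)"
    and h: "(h \<longlongrightarrow> h0) (at 0)"
    and aff: "\<And>\<zeta>. Re \<zeta> < B \<Longrightarrow> q (\<zeta> + 2 * of_real pi * \<i>) = of_real \<kappa> * q \<zeta> + of_real \<tau>"
  obtains s where "s > 0" "log_form B (\<lambda>l. - \<i> * l) (\<lambda>\<zeta>. of_real s * q \<zeta>)"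
proof -
  have reB: "Re (of_real (B - 1)) < B" by simp
  have \<kappa>: "\<kappa> > 0"
  proof -
    have "0 < Im (q (of_real (B - 1) + 2 * of_real pi * \<i>))" by (rule im) simp
    also have "\<dots> = \<kappa> * Im (q (of_real (B - 1)))" using aff[OF reB] by simp
    finally show ?thesis using im[OF reB] by (simp add: zero_less_mult_iff)
  qed
  have \<kappa>1: "\<kappa> = 1"
  proof (rule ccontr)
    assume ne: "\<kappa> \<noteq> 1"
    \<comment> \<open>Subtracting the fixed point of the affine map turns the monodromy into
      multiplication by \<open>\<kappa>\<close>.\<close>
    define y where "y = (\<lambda>\<zeta>. q \<zeta> - of_real (\<tau> / (1 - \<kappa>)))"
    have imy: "Im (y \<zeta>) = Im (q \<zeta>)" for \<zeta> by (simp add: y_def)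
    have ynp: "y \<zeta> \<notin> \<real>\<^sub>\<le>\<^sub>0" if "Re \<zeta> < B" for \<zeta>
      using im[OF that] by (auto simp: complex_nonpos_Reals_iff imy)
    have yk: "y (\<zeta> + 2 * of_real pi * \<i>) = of_real \<kappa> * y \<zeta>" if "Re \<zeta> < B" for \<zeta>
    proof -
      have t: "\<tau> - \<tau> / (1 - \<kappa>) = - (\<kappa> * (\<tau> / (1 - \<kappa>)))" using ne by (simp add: field_simps)
      have "y (\<zeta> + 2 * of_real pi * \<i>) = of_real \<kappa> * q \<zeta> + of_real (\<tau> - \<tau> / (1 - \<kappa>))"
        by (simp add: y_def aff[OF that])
      also have "\<dots> = of_real \<kappa> * y \<zeta>" unfolding t by (simp add: y_def right_diff_distrib)
      finally show ?thesis .
    qed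
    let ?L = "\<lambda>\<zeta>. Ln (y \<zeta>)"
    have Lhol: "?L holomorphic_on left_half B"
      using ynp unfolding y_def by (intro holomorphic_intros hol) auto
    \<comment> \<open>The modulus of \<open>y\<close> is at least Im q, so dividing the metric
      equation by it leaves the density of the cusp as a bound.\<close>
    have Lder: "cmod (deriv ?L \<zeta>) \<le> exp (h (exp \<zeta>)) / (- Re \<zeta>)" if re: "Re \<zeta> < B" for \<zeta>
    proof -
      have "(y has_field_derivative deriv q \<zeta>) (at \<zeta>)"
        unfolding y_def by (auto intro!: derivative_eq_intros has_deriv_left_half[OF hol re])
      from DERIV_chain2[OF has_field_derivative_Ln[OF ynp[OF re]] this]
      have "deriv ?L \<zeta> = inverse (y \<zeta>) * deriv q \<zeta>" by (rule DERIV_imp_deriv)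
      then have "cmod (deriv ?L \<zeta>) = exp (h (exp \<zeta>)) / (- Re \<zeta>) * (Im (q \<zeta>) / cmod (y \<zeta>))"
        using met[OF re] by (simp add: norm_mult norm_inverse divide_inverse)
      also have "\<dots> \<le> exp (h (exp \<zeta>)) / (- Re \<zeta>) * 1"
      proof (rule mult_left_mono)
        show "Im (q \<zeta>) / cmod (y \<zeta>) \<le> 1"
          using abs_Im_le_cmod[of "y \<zeta>"] im[OF re] by (simp add: imy divide_le_eq_1)
        show "0 \<le> exp (h (exp \<zeta>)) / (- Re \<zeta>)" using re B by (intro divide_nonneg_nonneg) auto
      qed
      finally show ?thesis by simp
    qed
    have "\<forall>\<^sub>F w in at 0. h w < h0 + 1" using order_tendstoD(2)[OF h, of "h0 + 1"] by simp
    then obtain d where d: "d > 0" "\<And>w. w \<noteq> 0 \<Longrightarrow> cmod w < d \<Longrightarrow> h w < h0 + 1"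
      by (auto simp: eventually_at dist_norm)
    \<comment> \<open>One turn changes \<open>Ln y\<close> by ln \<kappa>, while the mean value
      estimate bounds the change by a quantity that vanishes as X tends to minus infinity.\<close>
    have bound: "\<bar>ln \<kappa>\<bar> \<le> exp (h0 + 1) / (- X) * (2 * pi)" if X: "X < B" "X < ln d" for X
    proof -
      have b: "cmod (deriv ?L \<zeta>) \<le> exp (h0 + 1) / (- X)" if re: "Re \<zeta> < X" for \<zeta>
      proof -
        have "cmod (exp \<zeta>) < d" using re X d(1) by (simp add: ln_ge_iff flip: less_log_iff) (metis exp_less_mono exp_ln less_trans)
        then have "h (exp \<zeta>) < h0 + 1" using d(2) by simp
        then have "exp (h (exp \<zeta>)) / (- Re \<zeta>) \<le> exp (h0 + 1) / (- X)"
          using re X B by (intro frac_le) auto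
        then show ?thesis using Lder[of \<zeta>] re X by simp
      qed
      let ?z = "of_real (X - 1) :: complex"
      have z: "Re ?z < X" "Re ?z < B" using X by auto
      have yz: "y ?z \<noteq> 0" using ynp[OF z(2)] by auto
      have "Ln (y (?z + 2 * of_real pi * \<i>)) = of_real (ln \<kappa>) + Ln (y ?z)"
        unfolding yk[OF z(2)] using Ln_times_of_real[OF \<kappa> yz] \<kappa> by (simp add: Ln_of_real)
      moreover have "cmod (Ln (y (?z + 2 * of_real pi * \<i>)) - Ln (y ?z)) \<le> exp (h0 + 1) / (- X) * (2 * pi)"
        by (rule left_half_deriv_bound[OF holomorphic_on_subset[OF Lhol] b z(1)]) (use X in auto)
      ultimately show ?thesis by simp
    qed
    have "((\<lambda>X. exp (h0 + 1) / (- X) * (2 * pi)) \<longlongrightarrow> 0) at_bot" by real_asymp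
    moreover have "\<forall>\<^sub>F X in at_bot. \<bar>ln \<kappa>\<bar> \<le> exp (h0 + 1) / (- X) * (2 * pi)"
      using eventually_gt_at_bot[of B] eventually_gt_at_bot[of "ln d"] by eventually_elim (rule bound)
    ultimately have "\<bar>ln \<kappa>\<bar> \<le> 0"
      by (rule tendsto_lowerbound) simp
    then show False using \<kappa> ne by simp
  qed
  \<comment> \<open>With \<kappa> = 1 and \<tau> = 0 the monodromy is trivial; in the disc this is a
    rotation with factor 1, which a cusp excludes.\<close>
  have \<tau>0: "\<tau> \<noteq> 0"
  proof
    assume "\<tau> = 0"
    let ?\<mu> = "\<lambda>\<zeta>. exp (h (exp \<zeta>)) / (- Re \<zeta>)"
    note c = cayley_disc[OF hol, of ?\<mu> \<i>, OF im met]
    show False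
    proof (rule no_rotation_at_cusp[where h = h and c = 1, OF _ B _ _ _ _ h])
      let ?q = "\<lambda>\<zeta>. (q \<zeta> - \<i>) / (q \<zeta> - cnj \<i>)"
      show "?q holomorphic_on left_half B" by (rule c(1)) auto
      show "cmod (?q \<zeta>) < 1" if "Re \<zeta> < B" for \<zeta> by (rule c(3)) (use that in auto)
      show "2 * cmod (deriv ?q \<zeta>) = ?\<mu> \<zeta> * (1 - (cmod (?q \<zeta>))\<^sup>2)" if "Re \<zeta> < B" for \<zeta>
        by (rule c(4)) (use that in auto)
      show "?q (\<zeta> + 2 * of_real pi * \<i>) = 1 * ?q \<zeta>" if "Re \<zeta> < B" for \<zeta>
        using aff[OF that] \<kappa>1 \<open>\<tau> = 0\<close> by simp
    qed simp
  qed
  \<comment> \<open>This scaling makes the translation length 2 pi, so that exp (i s q) is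
    periodic.\<close>
  define s where "s = 2 * pi / \<bar>\<tau>\<bar>"
  have s: "s > 0" using \<tau>0 by (simp add: s_def)
  let ?p = "\<lambda>\<zeta>. of_real s * q \<zeta>"
  let ?E = "\<lambda>\<zeta>. exp (\<i> * ?p \<zeta>)"
  have shift: "?p (\<zeta> + 2 * of_real pi * \<i>) = ?p \<zeta> + of_real (sgn \<tau>) * (2 * of_real pi)" if "Re \<zeta> < B" for \<zeta>
  proof -
    have "s * \<tau> = sgn \<tau> * (2 * pi)" using \<tau>0 by (simp add: s_def sgn_if)
    then have "of_real s * of_real \<tau> = (of_real (sgn \<tau>) * (2 * of_real pi) :: complex)"
      by (metis of_real_mult of_real_numeral)
    then show ?thesis using aff[OF that] \<kappa>1 by (simp add: ring_distribs)
  qed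
  have Eper: "?E (\<zeta> + 2 * of_real pi * \<i>) = 1 * ?E \<zeta>" if "Re \<zeta> < B" for \<zeta>
  proof -
    have "exp (\<i> * (of_real (sgn \<tau>) * (2 * of_real pi))) = 1"
      using \<tau>0 exp_of_nat2_mult[of 0] by (cases "\<tau> > 0") (auto simp: sgn_if exp_minus mult_ac exp_eq_1)
    then show ?thesis unfolding shift[OF that] by (simp add: ring_distribs exp_add)
  qed
  have Ehol: "?E holomorphic_on left_half B" by (intro holomorphic_intros hol)
  have Ebd: "cmod (?E \<zeta>) < 1" if "Re \<zeta> < B" for \<zeta> using im[OF that] s by simp
  obtain \<gamma> k B' where g: "0 \<le> \<gamma>" "B' \<le> B" "k holomorphic_on ball 0 (exp B')"
    and form: "\<And>\<zeta>. Re \<zeta> < B' \<Longrightarrow> ?E \<zeta> = exp (of_real \<gamma> * \<zeta>) * exp (k (exp \<zeta>))"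
    by (rule rotation_form[OF Ehol Ebd Eper norm_one reB exp_not_eq_zero]; (assumption | rule that))
  \<comment> \<open>\<open>?F\<close> compares two logarithms of \<open>?E\<close>: its exponential
    is 1, hence its derivative vanishes and it is constant.\<close>
  let ?F = "\<lambda>\<zeta>. \<i> * ?p \<zeta> - of_real \<gamma> * \<zeta> - k (exp \<zeta>)"
  have Fhol: "?F holomorphic_on left_half B'"
  proof (intro holomorphic_intros)
    show "q holomorphic_on left_half B'" by (rule holomorphic_on_subset[OF hol]) (use g in auto)
    have "(k \<circ> exp) holomorphic_on left_half B'"
      by (rule holomorphic_on_compose_gen[OF holomorphic_on_exp g(3)]) auto
    then show "(\<lambda>\<zeta>. k (exp \<zeta>)) holomorphic_on left_half B'" by (simp add: o_def)
  qed
  have expF: "exp (?F \<zeta>) = 1" if "Re \<zeta> < B'" for \<zeta>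
    using form[OF that] by (simp add: exp_diff)
  have F0: "(?F has_field_derivative 0) (at \<zeta>)" if re: "Re \<zeta> < B'" for \<zeta>
  proof -
    have d: "(?F has_field_derivative deriv ?F \<zeta>) (at \<zeta>)" by (rule has_deriv_left_half[OF Fhol re])
    have "((\<lambda>\<zeta>. exp (?F \<zeta>)) has_field_derivative exp (?F \<zeta>) * deriv ?F \<zeta>) (at \<zeta>)"
      by (rule DERIV_chain2[OF DERIV_exp d])
    moreover have "((\<lambda>\<zeta>. exp (?F \<zeta>)) has_field_derivative 0) (at \<zeta>)"
      by (rule has_field_derivative_transform_within_open[OF DERIV_const[of 1] open_left_half])
         (use re expF in auto)
    ultimately have "exp (?F \<zeta>) * deriv ?F \<zeta> = 0" by (rule DERIV_unique)
    then show ?thesis using d by simp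
  qed
  have "\<exists>C. \<forall>\<zeta>\<in>left_half B'. ?F \<zeta> = C"
    by (rule has_field_derivative_zero_constant[OF convex_left_half])
       (use F0 in \<open>auto intro: has_field_derivative_at_within\<close>)
  then obtain C where C: "\<And>\<zeta>. Re \<zeta> < B' \<Longrightarrow> ?F \<zeta> = C" by auto
  \<comment> \<open>Comparing the increments of the terms of \<open>?F\<close> under the shift gives
    \<gamma> = sgn \<tau>, and nonnegativity of \<gamma> leaves only 1. So \<open>?E\<close> is w
    exp (k w) at w = exp \<zeta>, with a simple zero at w = 0.\<close>
  have "\<gamma> = 1"
  proof -
    let ?z = "of_real (B' - 1) :: complex"
    have z: "Re ?z < B'" "Re ?z < B" using g by auto
    have e: "exp (?z + 2 * of_real pi * \<i>) = exp ?z" by (simp add: exp_add)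
    have "?F (?z + 2 * of_real pi * \<i>) = ?F ?z" using C[of ?z] C[of "?z + 2 * of_real pi * \<i>"] z by simp
    then have "\<i> * (of_real (sgn \<tau>) * (2 * of_real pi)) = of_real \<gamma> * (2 * of_real pi * \<i>)"
      unfolding e shift[OF z(2)] by (simp add: algebra_simps)
    then have "complex_of_real \<gamma> = of_real (sgn \<tau>)" by simp
    then have "\<gamma> = sgn \<tau>" using of_real_eq_iff by blast
    then show ?thesis using g(1) \<tau>0 by (simp add: sgn_if split: if_splits)
  qed
  have "log_form B (\<lambda>l. - \<i> * l) ?p"
    unfolding log_form_def
  proof (intro exI conjI allI impI)
    show "B' \<le> B" by fact
    show "(\<lambda>w. w * exp (k w)) holomorphic_on ball 0 (exp B')" by (intro holomorphic_intros g)
    have "(k has_field_derivative deriv k 0) (at 0)" using g(3) by (intro holomorphic_derivI) auto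
    then have "((\<lambda>w. w * exp (k w)) has_field_derivative exp (k 0)) (at 0)"
      by (auto intro!: derivative_eq_intros)
    then show "deriv (\<lambda>w. w * exp (k w)) 0 \<noteq> 0" by (simp add: DERIV_imp_deriv)
    show "(\<lambda>\<zeta>. \<i> * ?p \<zeta>) holomorphic_on left_half B'"
      by (intro holomorphic_intros holomorphic_on_subset[OF hol]) (use g(2) in auto)
    show "exp (\<i> * ?p \<zeta>) = exp \<zeta> * exp (k (exp \<zeta>))" if "Re \<zeta> < B'" for \<zeta>
      using form[OF that] \<open>\<gamma> = 1\<close> by simp
  qed auto
  with s show ?thesis by (rule that)
qed

text \<open>The fixed points of the monodromy decide. A fixed point at infinity or on the real line
  can be moved to infinity, which makes the monodromy affine; a fixed point in the upper half-plane
  is moved to the centre of the disc, and the resulting rotation contradicts the cusp.\<close>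

lemma cusp_log_form:
  fixes g :: "complex \<Rightarrow> complex" and h :: "complex \<Rightarrow> real"
  assumes hol: "g holomorphic_on left_half B" and B: "B \<le> 0" and mon: "moebius_monodromy B g"
    and im: "\<And>\<zeta>. Re \<zeta> < B \<Longrightarrow> Im (g \<zeta>) > 0"
    and met: "\<And>\<zeta>. Re \<zeta> < B \<Longrightarrow> cmod (deriv g \<zeta>) = exp (h (exp \<zeta>)) / (- Re \<zeta>) * Im (g \<zeta>)"
    and h: "(h \<longlongrightarrow> h0) (at 0)"
  obtains L where "L \<in> PSL2R" "log_form B (\<lambda>l. - \<i> * l) (L \<circ> g)"
proof -
  obtain a b c d :: real where abcd: "a * d - b * c = 1"
    and nz: "\<And>\<zeta>. Re \<zeta> < B \<Longrightarrow> c * g \<zeta> + d \<noteq> 0"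
    and eq: "\<And>\<zeta>. Re \<zeta> < B \<Longrightarrow> g (\<zeta> + 2 * of_real pi * \<i>) * (c * g \<zeta> + d) = a * g \<zeta> + b"
  proof (rule half_plane_monodromy[OF hol mon met im])
    show "exp (h (exp (\<zeta> + 2 * of_real pi * \<i>))) / - Re (\<zeta> + 2 * of_real pi * \<i>) = exp (h (exp \<zeta>)) / - Re \<zeta>"
      for \<zeta> by (simp add: exp_add)
  qed (use B in \<open>auto intro!: divide_pos_neg\<close>)
  \<comment> \<open>For any fixed point \<open>w\<close> of the monodromy, real or not,
    \<open>g - w\<close> is only multiplied by a factor, always with the same denominator
    \<open>c * g + d\<close>.\<close>
  have fixed_point: "g (\<zeta> + 2 * of_real pi * \<i>) - w = (a - c * w) * (g \<zeta> - w) / (c * g \<zeta> + d)"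
    if w: "c * w\<^sup>2 + (of_real d - of_real a) * w - b = 0" and re: "Re \<zeta> < B" for w :: complex and \<zeta>
  proof -
    have "(g (\<zeta> + 2 * of_real pi * \<i>) - w) * (c * g \<zeta> + d) = a * g \<zeta> + b - w * (c * g \<zeta> + d)"
      using eq[OF re] by (simp add: left_diff_distrib)
    also have "\<dots> = (a - c * w) * (g \<zeta> - w) - (c * w\<^sup>2 + (of_real d - of_real a) * w - b)"
      by (simp add: algebra_simps power2_eq_square)
    also have "\<dots> = (a - c * w) * (g \<zeta> - w)" unfolding w by simp
    finally show ?thesis using nz[OF re] by (simp add: eq_divide_eq)
  qed
  consider (inf) "c = 0" | (real) "c \<noteq> 0" "(a + d)\<^sup>2 \<ge> 4" | (ell) "c \<noteq> 0" "(a + d)\<^sup>2 < 4" by linarith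
  then show ?thesis
  proof cases
    case inf
    have "g (\<zeta> + 2 * of_real pi * \<i>) = of_real (a / d) * g \<zeta> + of_real (b / d)" if "Re \<zeta> < B" for \<zeta>
      using eq[OF that] inf abcd nz[OF that] by (simp add: field_simps)
    from affine_cusp_log_form[OF hol B im met h this]
    obtain s where s: "s > 0" "log_form B (\<lambda>l. - \<i> * l) (\<lambda>\<zeta>. of_real s * g \<zeta>)" by blast
    \<comment> \<open>The square roots give the multiplication by \<open>s\<close> determinant
      1.\<close>
    let ?L = "moebius (of_real (sqrt s)) (of_real 0) (of_real 0) (of_real (1 / sqrt s))"
    have "?L \<in> PSL2R" unfolding PSL2R_def using s(1) by fastforce
    moreover have "?L \<circ> g = (\<lambda>\<zeta>. of_real s * g \<zeta>)"
    proof
      fix \<zeta>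
      have "complex_of_real (sqrt s) * of_real (sqrt s) = of_real s"
        using s(1) by (simp flip: of_real_mult)
      then show "(?L \<circ> g) \<zeta> = of_real s * g \<zeta>" by (simp add: moebius_def mult_ac)
    qed
    ultimately show ?thesis using s(2) that by metis
  next
    case real
    \<comment> \<open>By determinant 1, the fixed-point equation c x^2 + (d - a) x - b = 0 has
      discriminant (a + d)^2 - 4.\<close>
    define r where "r = sqrt ((a + d)\<^sup>2 - 4)"
    define x0 where "x0 = (a - d + r) / (2 * c)"
    have r2: "r * r = (a + d)\<^sup>2 - 4" using real by (simp add: r_def)
    have "c * x0\<^sup>2 + (d - a) * x0 - b = (r * r - (a - d)\<^sup>2 - 4 * b * c) / (4 * c)"
      using real(1) by (simp add: x0_def power2_eq_square field_simps)
    also have "\<dots> = 0" unfolding r2 using abcd by (simp add: power2_eq_square algebra_simps)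
    finally have x0: "c * x0\<^sup>2 + (d - a) * x0 - b = 0" .
    then have x0': "of_real c * (of_real x0)\<^sup>2 + (of_real d - of_real a) * of_real x0 - of_real b = (0::complex)"
      by (metis of_real_0 of_real_add of_real_diff of_real_mult of_real_power)
    \<comment> \<open>The two factors are the eigenvalues of the matrix; being reciprocal, neither
      can vanish.\<close>
    have det: "(a - c * x0) * (d + c * x0) = 1"
    proof -
      have "(a - c * x0) * (d + c * x0) = a * d - b * c - c * (c * x0\<^sup>2 + (d - a) * x0 - b)"
        by (simp add: power2_eq_square algebra_simps)
      then show ?thesis using x0 abcd by simp
    qed
    have gx: "g \<zeta> - of_real x0 \<noteq> 0" if "Re \<zeta> < B" for \<zeta> using im[OF that] by (auto simp: complex_eq_iff)
    \<comment> \<open>This map sends the fixed point to infinity and preserves the upper half-plane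
      with its metric.\<close>
    define q where "q = (\<lambda>\<zeta>. - 1 / (g \<zeta> - of_real x0))"
    have qhol: "q holomorphic_on left_half B"
      unfolding q_def using gx by (intro holomorphic_intros hol) auto
    have qim: "Im (q \<zeta>) = Im (g \<zeta>) / (cmod (g \<zeta> - of_real x0))\<^sup>2" for \<zeta>
      by (simp add: q_def Im_divide cmod_power2)
    have qpos: "Im (q \<zeta>) > 0" if "Re \<zeta> < B" for \<zeta>
      using im[OF that] gx[OF that] by (simp add: qim)
    have qmet: "cmod (deriv q \<zeta>) = exp (h (exp \<zeta>)) / (- Re \<zeta>) * Im (q \<zeta>)" if re: "Re \<zeta> < B" for \<zeta>
    proof -
      have "(q has_field_derivative deriv g \<zeta> / (g \<zeta> - of_real x0)\<^sup>2) (at \<zeta>)"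
        unfolding q_def using gx[OF re]
        by (auto intro!: derivative_eq_intros has_deriv_left_half[OF hol re] simp: power2_eq_square)
      then have "deriv q \<zeta> = deriv g \<zeta> / (g \<zeta> - of_real x0)\<^sup>2" by (rule DERIV_imp_deriv)
      then show ?thesis using met[OF re] by (simp add: norm_divide norm_power qim)
    qed
    \<comment> \<open>With G = g - x0 one has c g + d = (d + c x0) + c G, so the quotient splits
      into a multiple of - 1 / G and a constant.\<close>
    have split: "- (Q + e * G) / (P * G) = Q / P * (- 1 / G) + - e / P" if "P \<noteq> 0" "G \<noteq> 0" for P Q e G :: complex
      using that by (simp add: field_simps)
    have "q (\<zeta> + 2 * of_real pi * \<i>) = of_real ((d + c * x0) / (a - c * x0)) * q \<zeta> + of_real (- c / (a - c * x0))"
      if re: "Re \<zeta> < B" for \<zeta>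
    proof -
      have ne: "a - c * x0 \<noteq> 0" using det by auto
      then have ne': "of_real (a - c * x0) \<noteq> (0::complex)"
        using of_real_eq_0_iff by blast
      have "q (\<zeta> + 2 * of_real pi * \<i>) = - (c * g \<zeta> + d) / ((a - c * x0) * (g \<zeta> - x0))"
        unfolding q_def fixed_point[OF x0' re] using nz[OF re] by simp
      also have "- (c * g \<zeta> + d) = - ((d + c * x0) + c * (g \<zeta> - x0))"
        by (simp add: algebra_simps)
      also have "- ((d + c * x0) + c * (g \<zeta> - x0)) / ((a - c * x0) * (g \<zeta> - x0))
          = (d + c * x0) / (a - c * x0) * (- 1 / (g \<zeta> - x0)) + - c / (a - c * x0)"
        using split[OF ne' gx[OF re], of "of_real (d + c * x0)" "of_real c"]
        by (simp only: of_real_divide of_real_minus)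
      finally show ?thesis by (simp add: q_def)
    qed
    from affine_cusp_log_form[OF qhol B qpos qmet h this]
    obtain s where s: "s > 0" "log_form B (\<lambda>l. - \<i> * l) (\<lambda>\<zeta>. of_real s * q \<zeta>)" by blast
    let ?s = "sqrt s"
    \<comment> \<open>The map w \<mapsto> - s / (w - x0), scaled to determinant 1.\<close>
    let ?L = "moebius (of_real 0) (of_real (- ?s)) (of_real (1 / ?s)) (of_real (- x0 / ?s))"
    have "0 * (- x0 / ?s) - - ?s * (1 / ?s) = 1" using s(1) by simp
    then have "?L \<in> PSL2R" unfolding PSL2R_def by blast
    moreover have "?L \<circ> g = (\<lambda>\<zeta>. of_real s * q \<zeta>)"
    proof
      fix \<zeta>
      have ss: "complex_of_real ?s * of_real ?s = of_real s" "complex_of_real ?s \<noteq> 0"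
        using s(1) by (simp_all flip: of_real_mult)
      have "(?L \<circ> g) \<zeta> = - of_real ?s / ((g \<zeta> - of_real x0) / of_real ?s)"
        by (simp add: moebius_def diff_divide_distrib)
      also have "\<dots> = - (of_real ?s * of_real ?s) / (g \<zeta> - of_real x0)" using ss(2) by simp
      finally show "(?L \<circ> g) \<zeta> = of_real s * q \<zeta>" unfolding ss(1) by (simp add: q_def)
    qed
    ultimately show ?thesis using s(2) that by metis
  next
    case ell
    \<comment> \<open>u + i v solves the same quadratic equation when its discriminant is negative;
      the absolute value of \<open>c\<close> selects the root in the upper half-plane.\<close>
    define v where "v = sqrt (4 - (a + d)\<^sup>2) / (2 * \<bar>c\<bar>)"
    define u where "u = (a - d) / (2 * c)"
    have v: "v > 0" using ell by (simp add: v_def)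
    have "v\<^sup>2 = (4 - (a + d)\<^sup>2) / (4 * c\<^sup>2)" using ell by (simp add: v_def power_divide power_mult_distrib)
    moreover have "u\<^sup>2 = (a - d)\<^sup>2 / (4 * c\<^sup>2)"
      by (simp add: u_def power_divide power_mult_distrib)
    ultimately have "u\<^sup>2 + v\<^sup>2 = ((a - d)\<^sup>2 + 4 - (a + d)\<^sup>2) / (4 * c\<^sup>2)"
      by (simp add: add_divide_distrib diff_divide_distrib)
    also have "(a - d)\<^sup>2 + 4 - (a + d)\<^sup>2 = - 4 * (b * c)" using abcd by (simp add: power2_eq_square algebra_simps)
    finally have uv: "c * (u\<^sup>2 + v\<^sup>2) = - b" using ell(1) by (simp add: power2_eq_square field_simps)
    have cu: "2 * c * u = a - d" using ell(1) by (simp add: u_def)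
    let ?w = "Complex u v"
    have w: "of_real c * ?w\<^sup>2 + (of_real d - of_real a) * ?w - of_real b = 0"
    proof -
      have da: "d - a = - (2 * c * u)" using cu by simp
      show ?thesis
        using uv unfolding of_real_diff[symmetric] da
        by (simp add: complex_eq_iff power2_eq_square algebra_simps)
    qed
    have w': "of_real c * (cnj ?w)\<^sup>2 + (of_real d - of_real a) * cnj ?w - of_real b = 0"
      using arg_cong[OF w, of cnj] by simp
    let ?\<mu> = "\<lambda>\<zeta>. exp (h (exp \<zeta>)) / (- Re \<zeta>)"
    note cay = cayley_disc[OF hol, of ?\<mu> ?w, OF im met]
    have Imw: "0 < Im ?w" using v by simp
    let ?q = "\<lambda>\<zeta>. (g \<zeta> - ?w) / (g \<zeta> - cnj ?w)"
    \<comment> \<open>In the quotient of the fixed-point formulas at \<open>?w\<close> and its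
      conjugate, \<open>c * g + d\<close> cancels and this factor remains; its numerator and
      denominator are conjugate.\<close>
    let ?c = "(of_real a - of_real c * ?w) / (of_real a - of_real c * cnj ?w)"
    have nzc: "of_real a - of_real c * cnj ?w \<noteq> 0" "of_real a - of_real c * ?w \<noteq> 0"
      using v ell(1) by (auto simp: complex_eq_iff)
    have "cmod ?c = 1"
    proof -
      have "of_real a - of_real c * cnj ?w = cnj (of_real a - of_real c * ?w)" by simp
      then have "cmod (of_real a - of_real c * cnj ?w) = cmod (of_real a - of_real c * ?w)"
        by (metis complex_mod_cnj)
      then show ?thesis using nzc by (simp add: norm_divide)
    qed
    have False
    proof (rule no_rotation_at_cusp[where h = h and c = ?c, OF _ B _ _ _ _ h])
      show "?q holomorphic_on left_half B" by (rule cay(1)) (use Imw in auto)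
      show "cmod (?q \<zeta>) < 1" if "Re \<zeta> < B" for \<zeta> by (rule cay(3)) (use that Imw in auto)
      show "2 * cmod (deriv ?q \<zeta>) = ?\<mu> \<zeta> * (1 - (cmod (?q \<zeta>))\<^sup>2)" if "Re \<zeta> < B" for \<zeta>
        by (rule cay(4)) (use that Imw in auto)
      show "?q (\<zeta> + 2 * of_real pi * \<i>) = ?c * ?q \<zeta>" if re: "Re \<zeta> < B" for \<zeta>
        unfolding fixed_point[OF w re] fixed_point[OF w' re] using nz[OF re] by simp
    qed fact
    then show ?thesis ..
  qed
qed

section \<open>Cones\<close>

text \<open>In the variable \<open>s = exp (\<alpha> \<zeta>)\<close> the map is Lipschitz on a half-disc, hence has a limit at \<open>0\<close>. A
  limit on the unit circle is impossible: the conformal factor then bounds the derivative by the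
  distance to the limit, and on a small half-disc every bound for this distance can be halved.\<close>

lemma cone_limit:
  fixes g :: "complex \<Rightarrow> complex"
  assumes hol: "g holomorphic_on left_half B" and \<alpha>: "\<alpha> > 0"
    and disc: "\<And>\<zeta>. Re \<zeta> < B \<Longrightarrow> cmod (g \<zeta>) < 1"
    and der: "\<And>\<zeta>. Re \<zeta> < B \<Longrightarrow> cmod (deriv g \<zeta>) \<le> C * exp (\<alpha> * Re \<zeta>) * (1 - (cmod (g \<zeta>))\<^sup>2)"
  obtains g0 where "cmod g0 < 1" "((\<lambda>x. g (of_real x)) \<longlongrightarrow> g0) at_bot"
    "((\<lambda>x. g (of_real x + 2 * of_real pi * \<i>)) \<longlongrightarrow> g0) at_bot"
proof -
  \<comment> \<open>The half-disc is the image under s = exp (\<alpha> \<zeta>) of a half-strip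
    around the real axis; it is convex and avoids the cut of \<open>Ln\<close>.\<close>
  define S where "S d = {s. 0 < Re s} \<inter> ball (0::complex) d" for d
  define R where "R = exp (\<alpha> * B)"
  define G where "G s = g (Ln s / of_real \<alpha>)" for s
  define K where "K = \<bar>C\<bar> / \<alpha>"
  have K: "K \<ge> 0" using \<alpha> by (simp add: K_def)
  have cvx: "convex (S d)" for d
    unfolding S_def by (intro convex_Int convex_halfspace_Re_gt convex_ball)
  have re: "Re (Ln s / of_real \<alpha>) < B" if "s \<in> S R" for s
  proof -
    have "s \<noteq> 0" "cmod s < exp (\<alpha> * B)" using that by (auto simp: S_def R_def)
    then have "ln (cmod s) < \<alpha> * B" using ln_less_cancel_iff[of "cmod s" "exp (\<alpha> * B)"] by simp
    then show ?thesis using \<alpha> \<open>s \<noteq> 0\<close> by (simp add: field_simps)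
  qed
  have G1: "cmod (G s) < 1" if "s \<in> S R" for s unfolding G_def by (rule disc[OF re[OF that]])
  have Gder: "(G has_field_derivative deriv g (Ln s / of_real \<alpha>) * (inverse s / of_real \<alpha>)) (at s)" if "s \<in> S R" for s
  proof -
    have "s \<notin> \<real>\<^sub>\<le>\<^sub>0" using that by (auto simp: S_def complex_nonpos_Reals_iff)
    then have "((\<lambda>s. Ln s / of_real \<alpha>) has_field_derivative inverse s / of_real \<alpha>) (at s)"
      by (intro DERIV_cdivide has_field_derivative_Ln)
    from DERIV_chain2[OF has_deriv_left_half[OF hol re[OF that]] this] show ?thesis
      unfolding G_def .
  qed
  \<comment> \<open>The chain rule contributes 1 / (\<alpha> s), which cancels the factor exp
    (\<alpha> Re \<zeta>) = |s| of the density.\<close>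
  have Gbd: "cmod (deriv g (Ln s / of_real \<alpha>) * (inverse s / of_real \<alpha>)) \<le> K * (1 - (cmod (G s))\<^sup>2)"
    if s: "s \<in> S R" for s
  proof -
    have s0: "s \<noteq> 0" using s by (auto simp: S_def)
    have nn: "0 \<le> 1 - (cmod (G s))\<^sup>2" using G1[OF s] abs_square_less_1[of "cmod (G s)"] by simp
    have e: "exp (\<alpha> * Re (Ln s / of_real \<alpha>)) = cmod s" using s0 \<alpha> by simp
    have "cmod (deriv g (Ln s / of_real \<alpha>)) \<le> C * cmod s * (1 - (cmod (G s))\<^sup>2)"
      using der[OF re[OF s]] unfolding e G_def .
    also have "\<dots> \<le> \<bar>C\<bar> * cmod s * (1 - (cmod (G s))\<^sup>2)"
      by (intro mult_right_mono nn) auto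
    finally have "cmod (deriv g (Ln s / of_real \<alpha>)) / (cmod s * \<alpha>) \<le> \<bar>C\<bar> * cmod s * (1 - (cmod (G s))\<^sup>2) / (cmod s * \<alpha>)"
      using \<alpha> by (intro divide_right_mono) auto
    then show ?thesis using s0 \<alpha> by (simp add: K_def norm_mult norm_divide norm_inverse field_simps)
  qed
  have lip: "cmod (G s - G t) \<le> M * cmod (s - t)"
    if "d \<le> R" "s \<in> S d" "t \<in> S d" "\<And>s. s \<in> S d \<Longrightarrow> K * (1 - (cmod (G s))\<^sup>2) \<le> M" for s t d M
  proof (rule field_differentiable_bound[OF cvx])
    fix z assume "z \<in> S d"
    then have z: "z \<in> S R" using that(1) by (auto simp: S_def)
    show "(G has_field_derivative deriv g (Ln z / of_real \<alpha>) * (inverse z / of_real \<alpha>)) (at z within S d)"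
      by (rule has_field_derivative_at_within[OF Gder[OF z]])
    show "cmod (deriv g (Ln z / of_real \<alpha>) * (inverse z / of_real \<alpha>)) \<le> M"
      using Gbd[OF z] that(4)[OF \<open>z \<in> S d\<close>] by linarith
  qed (use that in auto)
  have R: "R > 0" by (simp add: R_def)
  have cl: "0 \<in> closure (S d)" "at 0 within S d \<noteq> bot" if "d > 0" for d
  proof -
    have "0 islimpt S d"
      unfolding islimpt_approachable
    proof (intro allI impI)
      fix e :: real assume "e > 0"
      then show "\<exists>x'\<in>S d. x' \<noteq> 0 \<and> dist x' 0 < e"
        using that by (intro bexI[of _ "of_real (min e d / 2)"]) (auto simp: S_def)
    qed
    then show "0 \<in> closure (S d)" "at 0 within S d \<noteq> bot"
      by (auto simp: closure_def trivial_limit_within)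
  qed
  have "uniformly_continuous_on (S R) G"
  proof (rule lipschitz_on_uniformly_continuous)
    show "K-lipschitz_on (S R) G"
    proof (rule lipschitz_onI[OF _ K])
      show "dist (G s) (G t) \<le> K * dist s t" if "s \<in> S R" "t \<in> S R" for s t
        unfolding dist_norm using K by (intro lip[OF order_refl that]) (auto intro: mult_left_le)
    qed
  qed
  then obtain g0 where g0: "(G \<longlongrightarrow> g0) (at 0 within S R)"
    using uniformly_continuous_on_extension_at_closure cl(1)[OF R] by metis
  have g0le: "cmod g0 \<le> 1"
    by (rule Lim_norm_ubound[OF cl(2)[OF R] g0])
       (use G1 in \<open>auto simp: eventually_at_filter less_imp_le\<close>)
  have "cmod g0 \<noteq> 1"
  proof
    assume 1: "cmod g0 = 1"
    \<comment> \<open>If \<open>G\<close> is within A of a limit on the unit circle, then 1 - |G|^2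
      is at most 2 A and the derivative at most 2 K A, so on \<open>S d\<close> the bound improves
      to 2 K d A. The choice of \<open>d\<close> makes this at most A / 2.\<close>
    define d where "d = min R (1 / (4 * (K + 1)))"
    have d: "d > 0" "d \<le> R" using R K by (auto simp: d_def)
    have dK: "2 * K * d \<le> 1 / 2"
    proof -
      have "2 * K * d \<le> 2 * K * (1 / (4 * (K + 1)))" using K by (intro mult_left_mono) (auto simp: d_def)
      also have "\<dots> \<le> 1 / 2" using K by (simp add: field_simps)
      finally show ?thesis .
    qed
    have sub: "S d \<subseteq> S R" using d by (auto simp: S_def)
    have g0d: "(G \<longlongrightarrow> g0) (at 0 within S d)" by (rule tendsto_within_subset[OF g0 sub])
    have iter: "\<forall>s\<in>S d. cmod (G s - g0) \<le> 2 * (1 / 2) ^ n" for n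
    proof (induction n)
      case 0
      show ?case
      proof
        fix s assume "s \<in> S d"
        then show "cmod (G s - g0) \<le> 2 * (1 / 2) ^ 0"
          using norm_triangle_ineq4[of "G s" g0] G1[of s] sub 1 by auto
      qed
    next
      case (Suc n)
      let ?A = "2 * (1 / 2) ^ n :: real"
      show ?case
      proof
        fix s assume s: "s \<in> S d"
        have M: "K * (1 - (cmod (G t))\<^sup>2) \<le> 2 * K * ?A" if t: "t \<in> S d" for t
        proof -
          have "1 - (cmod (G t))\<^sup>2 = (1 - cmod (G t)) * (1 + cmod (G t))"
            by (simp add: power2_eq_square algebra_simps)
          also have "\<dots> \<le> ?A * 2"
          proof (rule mult_mono)
            have "1 - cmod (G t) \<le> cmod (g0 - G t)" using norm_triangle_ineq2[of g0 "G t"] 1 by simp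
            also have "\<dots> \<le> ?A" using Suc t by (simp add: norm_minus_commute)
            finally show "1 - cmod (G t) \<le> ?A" .
          qed (use G1[of t] t sub in auto)
          finally have "K * (1 - (cmod (G t))\<^sup>2) \<le> K * (?A * 2)" using K by (rule mult_left_mono)
          then show ?thesis by (simp add: mult_ac)
        qed
        have "cmod (G s - g0) \<le> 2 * K * ?A * cmod (s - 0)"
        proof (rule tendsto_le[OF cl(2)[OF d(1)]])
          show "((\<lambda>t. 2 * K * ?A * cmod (s - t)) \<longlongrightarrow> 2 * K * ?A * cmod (s - 0)) (at 0 within S d)"
            by (intro tendsto_intros)
          show "((\<lambda>t. cmod (G s - G t)) \<longlongrightarrow> cmod (G s - g0)) (at 0 within S d)"
            by (intro tendsto_intros g0d)
          show "\<forall>\<^sub>F t in at 0 within S d. cmod (G s - G t) \<le> 2 * K * ?A * cmod (s - t)"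
            unfolding eventually_at_filter using lip[OF d(2) s _ M] by auto
        qed
        also have "\<dots> \<le> 2 * K * ?A * d"
          using s K by (intro mult_left_mono) (auto simp: S_def)
        also have "\<dots> = (2 * K * d) * ?A" by simp
        also have "\<dots> \<le> 1 / 2 * ?A" by (intro mult_right_mono dK) auto
        finally show "cmod (G s - g0) \<le> 2 * (1 / 2) ^ Suc n" by simp
      qed
    qed
    let ?s = "of_real (d / 2) :: complex"
    have s: "?s \<in> S d" using d by (auto simp: S_def)
    have "(\<lambda>n. 2 * (1 / 2) ^ n :: real) \<longlonglongrightarrow> 2 * 0"
      by (intro tendsto_mult tendsto_const LIMSEQ_power_zero) auto
    then have "cmod (G ?s - g0) \<le> 2 * 0"
      by (rule tendsto_lowerbound) (use iter s in auto)
    then have "G ?s = g0" by simp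
    then show False using G1[of ?s] s sub 1 by auto
  qed
  with g0le have lt: "cmod g0 < 1" by simp
  have lim: "((\<lambda>x. g (of_real x)) \<longlongrightarrow> g0) at_bot"
  proof -
    let ?e = "\<lambda>x::real. of_real (exp (\<alpha> * x)) :: complex"
    have "filterlim ?e (at 0 within S R) at_bot"
      unfolding filterlim_at
    proof
      have "((\<lambda>x. exp (\<alpha> * x)) \<longlongrightarrow> 0) at_bot" using \<alpha> by real_asymp
      then show "(?e \<longlongrightarrow> 0) at_bot" by (metis of_real_0 tendsto_of_real)
      show "\<forall>\<^sub>F x in at_bot. ?e x \<in> S R \<and> ?e x \<noteq> 0"
        using eventually_gt_at_bot[of B]
      proof eventually_elim
        case (elim x)
        then show ?case using \<alpha> by (simp add: S_def R_def del: of_real_exp)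
      qed
    qed
    from filterlim_compose[OF g0 this]
    have "((\<lambda>x. G (?e x)) \<longlongrightarrow> g0) at_bot" .
    moreover have "G (?e x) = g (of_real x)" for x
    proof -
      have "Ln (?e x) = of_real (\<alpha> * x)" by (simp add: Ln_of_real)
      then show ?thesis using \<alpha> by (simp add: G_def)
    qed
    ultimately show ?thesis by simp
  qed
  \<comment> \<open>The shifted line may lie outside the half-strip that corresponds to the
    half-disc, so its limit is obtained from the first one by the derivative bound on vertical
    segments.\<close>
  have "((\<lambda>x. g (of_real x + 2 * of_real pi * \<i>) - g (of_real x)) \<longlongrightarrow> 0) at_bot"
  proof (rule Lim_null_comparison)
    show "((\<lambda>x. \<bar>C\<bar> * exp (\<alpha> * (x + 1)) * (2 * pi)) \<longlongrightarrow> 0) at_bot" using \<alpha> by real_asymp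
    show "\<forall>\<^sub>F x in at_bot. norm (g (of_real x + 2 * of_real pi * \<i>) - g (of_real x)) \<le> \<bar>C\<bar> * exp (\<alpha> * (x + 1)) * (2 * pi)"
      using eventually_gt_at_bot[of "B - 1"]
    proof eventually_elim
      case (elim x)
      show ?case
      proof (rule left_half_deriv_bound[OF holomorphic_on_subset[OF hol], where X = "x + 1"])
        fix \<zeta> :: complex assume z: "Re \<zeta> < x + 1"
        then have zB: "Re \<zeta> < B" using elim by simp
        have "cmod (deriv g \<zeta>) \<le> C * exp (\<alpha> * Re \<zeta>) * (1 - (cmod (g \<zeta>))\<^sup>2)" by (rule der[OF zB])
        also have "\<dots> \<le> \<bar>C\<bar> * exp (\<alpha> * (x + 1)) * 1"
        proof (rule mult_mono)
          show "C * exp (\<alpha> * Re \<zeta>) \<le> \<bar>C\<bar> * exp (\<alpha> * (x + 1))"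
            using z \<alpha> by (intro mult_mono) auto
          show "0 \<le> 1 - (cmod (g \<zeta>))\<^sup>2" using disc[OF zB] abs_square_less_1[of "cmod (g \<zeta>)"] by simp
        qed auto
        finally show "cmod (deriv g \<zeta>) \<le> \<bar>C\<bar> * exp (\<alpha> * (x + 1))" by simp
      qed (use elim in auto)
    qed
  qed
  from tendsto_add[OF this lim] have "((\<lambda>x. g (of_real x + 2 * of_real pi * \<i>)) \<longlongrightarrow> g0) at_bot" by simp
  with lt lim show ?thesis by (rule that)
qed

text \<open>The limit of \<open>g\<close> supplies a fixed point of the monodromy inside the disc.
  Once it is moved to 0, the rotation determines the exponent in \<open>rotation_form\<close> only
  modulo 1; the size of the metric near the cone singles out \<alpha>.\<close>

lemma cone_log_form:
  fixes g :: "complex \<Rightarrow> complex" and h :: "complex \<Rightarrow> real"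
  assumes hol: "g holomorphic_on left_half B" and \<alpha>: "\<alpha> > 0" and mon: "moebius_monodromy B g"
    and disc: "\<And>\<zeta>. Re \<zeta> < B \<Longrightarrow> cmod (g \<zeta>) < 1"
    and met: "\<And>\<zeta>. Re \<zeta> < B \<Longrightarrow> 2 * cmod (deriv g \<zeta>) = exp (\<alpha> * Re \<zeta> + h (exp \<zeta>)) * (1 - (cmod (g \<zeta>))\<^sup>2)"
    and h: "(h \<longlongrightarrow> h0) (at 0)"
  obtains L where "L \<in> PSU11" "log_form B (\<lambda>l. exp (of_real \<alpha> * l)) (L \<circ> g)"
proof -
  let ?\<mu> = "\<lambda>\<zeta>. exp (\<alpha> * Re \<zeta> + h (exp \<zeta>))"
  obtain a b where ab: "(cmod a)\<^sup>2 - (cmod b)\<^sup>2 = 1"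
    and nz: "\<And>\<zeta>. Re \<zeta> < B \<Longrightarrow> cnj b * g \<zeta> + cnj a \<noteq> 0"
    and eq: "\<And>\<zeta>. Re \<zeta> < B \<Longrightarrow> g (\<zeta> + 2 * of_real pi * \<i>) * (cnj b * g \<zeta> + cnj a) = a * g \<zeta> + b"
  proof (rule disc_monodromy[OF hol mon met disc])
    show "?\<mu> (\<zeta> + 2 * of_real pi * \<i>) = ?\<mu> \<zeta>" for \<zeta> by (simp add: exp_add)
  qed auto
  have "\<forall>\<^sub>F w in at 0. h w < h0 + 1" using order_tendstoD(2)[OF h, of "h0 + 1"] by simp
  then obtain d where d: "d > 0" "\<And>w. w \<noteq> 0 \<Longrightarrow> cmod w < d \<Longrightarrow> h w < h0 + 1"
    by (auto simp: eventually_at dist_norm)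
  \<comment> \<open>To the left of ln d the function \<open>h\<close> stays below h0 + 1, which
    supplies the constant for \<open>cone_limit\<close>.\<close>
  define B1 where "B1 = min B (ln d)"
  have B1: "B1 \<le> B" by (simp add: B1_def)
  have one: "(cmod (g \<zeta>))\<^sup>2 < 1" if "Re \<zeta> < B" for \<zeta>
    using disc[OF that] abs_square_less_1[of "cmod (g \<zeta>)"] by simp
  have der: "cmod (deriv g \<zeta>) \<le> exp (h0 + 1) * exp (\<alpha> * Re \<zeta>) * (1 - (cmod (g \<zeta>))\<^sup>2)" if re: "Re \<zeta> < B1" for \<zeta>
  proof -
    have "Re \<zeta> < ln d" using re by (simp add: B1_def)
    then have "exp (Re \<zeta>) < d" using d(1) by (metis exp_less_mono exp_ln)
    then have "h (exp \<zeta>) < h0 + 1" using d(2) by simp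
    then have "?\<mu> \<zeta> \<le> exp (h0 + 1 + \<alpha> * Re \<zeta>)" by simp
    then have "?\<mu> \<zeta> * (1 - (cmod (g \<zeta>))\<^sup>2) \<le> exp (h0 + 1) * exp (\<alpha> * Re \<zeta>) * (1 - (cmod (g \<zeta>))\<^sup>2)"
      unfolding exp_add[symmetric] using one[of \<zeta>] re B1 by (intro mult_right_mono) auto
    then show ?thesis using met[of \<zeta>] re B1 norm_ge_zero[of "deriv g \<zeta>"] by linarith
  qed
  obtain g0 where g0: "cmod g0 < 1" and lim: "((\<lambda>x. g (of_real x)) \<longlongrightarrow> g0) at_bot"
    and lim2: "((\<lambda>x. g (of_real x + 2 * of_real pi * \<i>)) \<longlongrightarrow> g0) at_bot"
  proof (rule cone_limit[OF holomorphic_on_subset[OF hol] \<alpha> _ der])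
    show "cmod (g \<zeta>) < 1" if "Re \<zeta> < B1" for \<zeta> using disc[of \<zeta>] that B1 by simp
  qed (use B1 in auto)
  have evB: "\<forall>\<^sub>F x in at_bot. x < B" by (rule eventually_gt_at_bot)
  \<comment> \<open>The real axis and its translate give the same limit, so the monodromy relation
    becomes a fixed-point equation for \<open>g0\<close>.\<close>
  have fix0: "g0 * (cnj b * g0 + cnj a) = a * g0 + b"
  proof (rule tendsto_unique)
    show "((\<lambda>x. a * g (of_real x) + b) \<longlongrightarrow> a * g0 + b) at_bot" by (intro tendsto_intros lim)
    have "((\<lambda>x. g (of_real x + 2 * of_real pi * \<i>) * (cnj b * g (of_real x) + cnj a)) \<longlongrightarrow> g0 * (cnj b * g0 + cnj a)) at_bot"
      by (intro tendsto_intros lim lim2)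
    then show "((\<lambda>x. a * g (of_real x) + b) \<longlongrightarrow> g0 * (cnj b * g0 + cnj a)) at_bot"
      by (rule Lim_transform_eventually) (use evB in \<open>eventually_elim, simp add: eq\<close>)
  qed simp
  define q where "q = (\<lambda>\<zeta>. (g \<zeta> - g0) / (1 - cnj g0 * g \<zeta>))"
  have den: "1 - cnj g0 * w \<noteq> 0" if "cmod w \<le> 1" for w
  proof
    assume "1 - cnj g0 * w = 0"
    then have "cmod (cnj g0 * w) = 1" by simp
    moreover have "cmod (cnj g0 * w) \<le> cmod g0 * 1"
      unfolding norm_mult using that by (intro mult_mono) auto
    ultimately show False using g0 by simp
  qed
  have dq: "1 - cnj g0 * g \<zeta> \<noteq> 0" if "Re \<zeta> < B" for \<zeta> using den disc[OF that] by simp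
  have qhol: "q holomorphic_on left_half B"
    unfolding q_def using dq by (intro holomorphic_intros hol) auto
  have e0: "1 - (cmod g0)\<^sup>2 > 0" using g0 abs_square_less_1[of "cmod g0"] by simp
  have q1: "1 - (cmod (q \<zeta>))\<^sup>2 = (1 - (cmod g0)\<^sup>2) * (1 - (cmod (g \<zeta>))\<^sup>2) / (cmod (1 - cnj g0 * g \<zeta>))\<^sup>2"
    if re: "Re \<zeta> < B" for \<zeta>
  proof -
    have "(cmod (1 - cnj g0 * g \<zeta>))\<^sup>2 - (cmod (g \<zeta> - g0))\<^sup>2 = (1 - (cmod g0)\<^sup>2) * (1 - (cmod (g \<zeta>))\<^sup>2)"
      unfolding cmod_power2 by (simp add: power2_eq_square algebra_simps)
    moreover have "(cmod (q \<zeta>))\<^sup>2 = (cmod (g \<zeta> - g0))\<^sup>2 / (cmod (1 - cnj g0 * g \<zeta>))\<^sup>2"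
      by (simp add: q_def norm_divide power_divide)
    moreover have "1 - y / z = (z - y) / z" if "z \<noteq> 0" for y z :: real using that by (simp add: diff_divide_distrib)
    ultimately show ?thesis using dq[OF re] by simp
  qed
  have qbd: "cmod (q \<zeta>) < 1" if re: "Re \<zeta> < B" for \<zeta>
  proof -
    have "0 < 1 - (cmod (q \<zeta>))\<^sup>2"
      unfolding q1[OF re] using e0 one[OF re] dq[OF re] by simp
    then show ?thesis using abs_square_less_1[of "cmod (q \<zeta>)"] by simp
  qed
  have qmet: "2 * cmod (deriv q \<zeta>) = ?\<mu> \<zeta> * (1 - (cmod (q \<zeta>))\<^sup>2)" if re: "Re \<zeta> < B" for \<zeta>
  proof -
    have "(q has_field_derivative deriv g \<zeta> * (1 - g0 * cnj g0) / (1 - cnj g0 * g \<zeta>)\<^sup>2) (at \<zeta>)"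
      unfolding q_def using dq[OF re]
      by (auto intro!: derivative_eq_intros has_deriv_left_half[OF hol re] simp: power2_eq_square algebra_simps)
    then have "deriv q \<zeta> = deriv g \<zeta> * (1 - g0 * cnj g0) / (1 - cnj g0 * g \<zeta>)\<^sup>2" by (rule DERIV_imp_deriv)
    moreover have "1 - g0 * cnj g0 = of_real (1 - (cmod g0)\<^sup>2)" by (simp add: complex_norm_square[symmetric] flip: of_real_power)
    ultimately have "2 * cmod (deriv q \<zeta>) = 2 * cmod (deriv g \<zeta>) * (1 - (cmod g0)\<^sup>2) / (cmod (1 - cnj g0 * g \<zeta>))\<^sup>2"
      using e0 by (simp add: norm_mult norm_divide norm_power del: of_real_diff)
    then show ?thesis unfolding q1[OF re] met[OF re] by (simp add: mult_ac)
  qed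
  \<comment> \<open>The multiplier of the monodromy at its fixed point \<open>g0\<close>. It is well
    defined because |b| < |a| and |g0| < 1.\<close>
  let ?c = "(a - cnj b * g0) / cnj (a - cnj b * g0)"
  have anz: "a - cnj b * g0 \<noteq> 0"
  proof
    assume "a - cnj b * g0 = 0"
    then have "cmod a = cmod b * cmod g0" by (simp add: norm_mult)
    also have "\<dots> \<le> cmod b * 1" using g0 by (intro mult_left_mono) auto
    finally have "(cmod a)\<^sup>2 \<le> (cmod b)\<^sup>2" by (intro power_mono) auto
    then show False using ab by linarith
  qed
  have c1: "cmod ?c = 1" using anz by (simp add: norm_divide del: complex_cnj_diff)
  have rot: "q (\<zeta> + 2 * of_real pi * \<i>) = ?c * q \<zeta>" if re: "Re \<zeta> < B" for \<zeta>
  proof -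
    let ?g = "g \<zeta>" and ?g1 = "g (\<zeta> + 2 * of_real pi * \<i>)" and ?D = "cnj b * g \<zeta> + cnj a"
    \<comment> \<open>The conjugated equation says that the reflection of \<open>g0\<close> in the
      unit circle is fixed as well; this handles the denominator of \<open>q\<close>.\<close>
    have f: "cnj g0 * (b * cnj g0 + a) = cnj a * cnj g0 + cnj b" using arg_cong[OF fix0, of cnj] by simp
    have "(?g1 - g0) * ?D = a * ?g + b - g0 * ?D" using eq[OF re] by (simp add: left_diff_distrib)
    also have "\<dots> = (a - cnj b * g0) * (?g - g0) - (g0 * (cnj b * g0 + cnj a) - (a * g0 + b))"
      by (simp add: algebra_simps)
    finally have 1: "(?g1 - g0) * ?D = (a - cnj b * g0) * (?g - g0)" unfolding fix0 by simp
    have "(1 - cnj g0 * ?g1) * ?D = ?D - cnj g0 * (a * ?g + b)" using eq[OF re] by (simp add: left_diff_distrib)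
    also have "\<dots> = (cnj a - b * cnj g0) * (1 - cnj g0 * ?g) - ?g * (cnj g0 * (b * cnj g0 + a) - (cnj a * cnj g0 + cnj b))"
      by (simp add: algebra_simps)
    finally have 2: "(1 - cnj g0 * ?g1) * ?D = cnj (a - cnj b * g0) * (1 - cnj g0 * ?g)" unfolding f by simp
    have "q (\<zeta> + 2 * of_real pi * \<i>) = ((?g1 - g0) * ?D) / ((1 - cnj g0 * ?g1) * ?D)"
      using nz[OF re] by (simp add: q_def)
    then show ?thesis unfolding 1 2 by (simp add: q_def)
  qed
  have "\<exists>\<zeta>0. Re \<zeta>0 < B \<and> q \<zeta>0 \<noteq> 0"
  proof (rule ccontr)
    assume "\<not> ?thesis"
    then have z: "\<And>\<zeta>. \<zeta> \<in> left_half B \<Longrightarrow> q \<zeta> = 0" by auto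
    have "deriv q (of_real (B - 1)) = 0"
      by (rule deriv_eq_on_open[OF DERIV_const open_left_half _ z]) auto
    then show False using qmet[of "of_real (B - 1)"] z[of "of_real (B - 1)"] by simp
  qed
  then obtain \<zeta>0 where \<zeta>0: "Re \<zeta>0 < B" "q \<zeta>0 \<noteq> 0" by blast
  obtain \<gamma> k B' where \<gamma>: "0 \<le> \<gamma>" "B' \<le> B" and k: "k holomorphic_on ball 0 (exp B')"
    and form: "\<And>\<zeta>. Re \<zeta> < B' \<Longrightarrow> q \<zeta> = exp (of_real \<gamma> * \<zeta>) * exp (k (exp \<zeta>))"
    by (rule rotation_form[OF qhol qbd rot c1 \<zeta>0]; (assumption | rule that))
  let ?e = "\<lambda>x. exp (complex_of_real x)"
  let ?m = "\<lambda>x. cmod (exp (k (?e x)))"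
  have mlim: "(?m \<longlongrightarrow> cmod (exp (k 0))) at_bot"
    by (intro tendsto_norm tendsto_exp holomorphic_at_0_tendsto[OF k])
  have evB': "\<forall>\<^sub>F x in at_bot. x < B'" by (rule eventually_gt_at_bot)
  have qx: "cmod (q (of_real x)) = exp (\<gamma> * x) * ?m x" if "x < B'" for x
    using form[of "of_real x"] that by (simp add: norm_mult)
  have q0: "((\<lambda>x. cmod (q (of_real x))) \<longlongrightarrow> 0) at_bot"
  proof -
    have "((\<lambda>x. q (of_real x)) \<longlongrightarrow> (g0 - g0) / (1 - cnj g0 * g0)) at_bot"
      unfolding q_def using den[of g0] g0 by (intro tendsto_intros lim) auto
    then show ?thesis using tendsto_norm by fastforce
  qed
  \<comment> \<open>For \<gamma> = 0 the modulus of \<open>q\<close> would tend to that of exp (k 0)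
    instead of 0.\<close>
  have "\<gamma> \<noteq> 0"
  proof
    assume "\<gamma> = 0"
    have "((\<lambda>x. cmod (q (of_real x))) \<longlongrightarrow> cmod (exp (k 0))) at_bot"
      by (rule Lim_transform_eventually[OF mlim]) (use evB' in \<open>eventually_elim, simp add: qx \<open>\<gamma> = 0\<close>\<close>)
    then have "cmod (exp (k 0)) = 0" using q0 by (rule tendsto_unique[rotated]) simp
    then show False by simp
  qed
  with \<gamma>(1) have \<gamma>p: "\<gamma> > 0" by simp
  \<comment> \<open>Each side of the metric equation on the real axis is an exponential times a
    factor with a nonzero limit. Hence exp ((\<gamma> - \<alpha>) x) has a positive finite limit,
    which is possible only for equal exponents.\<close>
  have "\<gamma> = \<alpha>"
  proof -
    have k': "deriv k holomorphic_on ball 0 (exp B')" using k by (intro holomorphic_deriv) auto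
    let ?n = "\<lambda>x. 2 * (?m x * cmod (of_real \<gamma> + deriv k (?e x) * ?e x))"
    let ?r = "\<lambda>x. exp (h (?e x)) * (1 - (cmod (q (of_real x)))\<^sup>2)"
    have nlim: "(?n \<longlongrightarrow> 2 * (cmod (exp (k 0)) * cmod (of_real \<gamma> + deriv k 0 * 0))) at_bot"
      by (intro tendsto_mult tendsto_const mlim tendsto_norm tendsto_add holomorphic_at_0_tendsto[OF k'] exp_real_tendsto_at_bot)
    have hl: "((\<lambda>x. h (?e x)) \<longlongrightarrow> h0) at_bot"
      by (rule filterlim_compose[OF h exp_real_at_0])
    have rlim: "(?r \<longlongrightarrow> exp h0 * (1 - 0\<^sup>2)) at_bot" by (intro tendsto_intros hl q0)
    have rel: "\<forall>\<^sub>F x in at_bot. exp (\<gamma> * x) * ?n x = exp (\<alpha> * x) * ?r x"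
      using evB'
    proof eventually_elim
      case (elim x)
      have "2 * cmod (deriv q (of_real x)) = exp (\<gamma> * x) * ?n x"
        using rotation_form_deriv[OF k form, of "of_real x"] elim by (simp add: norm_mult qx)
      then show ?case using qmet[of "of_real x"] elim \<gamma>(2) by (simp add: exp_add)
    qed
    let ?N = "2 * (cmod (exp (k 0)) * cmod (of_real \<gamma> + deriv k 0 * 0))"
    have Np: "?N \<noteq> 0" using \<gamma>p by simp
    have lim: "((\<lambda>x. ?r x / ?n x) \<longlongrightarrow> exp h0 * (1 - 0\<^sup>2) / ?N) at_bot"
      by (rule tendsto_divide[OF rlim nlim Np])
    have nev: "\<forall>\<^sub>F x in at_bot. ?n x \<noteq> 0"
      by (rule tendsto_imp_eventually_ne[OF nlim Np])
    have L: "((\<lambda>x. exp ((\<gamma> - \<alpha>) * x)) \<longlongrightarrow> exp h0 * (1 - 0\<^sup>2) / ?N) at_bot"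
    proof (rule Lim_transform_eventually[OF lim])
      show "\<forall>\<^sub>F x in at_bot. ?r x / ?n x = exp ((\<gamma> - \<alpha>) * x)"
        using rel nev
      proof eventually_elim
        case (elim x)
        have "exp ((\<gamma> - \<alpha>) * x) * exp (\<alpha> * x) = exp (\<gamma> * x)"
          by (simp add: left_diff_distrib flip: exp_add)
        moreover have "exp (\<alpha> * x) * (u * v) = (u * exp (\<alpha> * x)) * v" for u v by simp
        ultimately have "exp (\<alpha> * x) * (exp ((\<gamma> - \<alpha>) * x) * ?n x) = exp (\<alpha> * x) * ?r x"
          using elim(1) by metis
        then have e: "exp ((\<gamma> - \<alpha>) * x) * ?n x = ?r x" using mult_left_cancel[of "exp (\<alpha> * x)"] exp_not_eq_zero by blast
        show ?case unfolding nonzero_divide_eq_eq[OF elim(2)] by (rule e[symmetric])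
      qed
    qed
    have Lp: "exp h0 * (1 - 0\<^sup>2) / ?N > 0" using \<gamma>p by simp
    show ?thesis
    proof (rule linorder_cases[of \<gamma> \<alpha>])
      assume "\<gamma> < \<alpha>"
      then have "filterlim (\<lambda>x. exp ((\<gamma> - \<alpha>) * x)) at_infinity at_bot" by real_asymp
      then show ?thesis using L not_tendsto_and_filterlim_at_infinity[of at_bot] by (metis trivial_limit_at_bot_linorder)
    next
      assume "\<alpha> < \<gamma>"
      then have "((\<lambda>x. exp ((\<gamma> - \<alpha>) * x)) \<longlongrightarrow> 0) at_bot" by real_asymp
      then show ?thesis using L Lp tendsto_unique[of at_bot] by (metis trivial_limit_at_bot_linorder less_irrefl)
    qed
  qed
  \<comment> \<open>Without the factor \<open>s\<close> the matrix of \<open>q\<close> has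
    determinant 1 - |g0|^2.\<close>
  define s where "s = 1 / sqrt (1 - (cmod g0)\<^sup>2)"
  have s: "s * s * (1 - (cmod g0)\<^sup>2) = 1" "s > 0" using e0 by (auto simp: s_def)
  let ?a = "complex_of_real s" and ?b = "- of_real s * g0"
  let ?L = "moebius ?a ?b (cnj ?b) (cnj ?a)"
  have "(cmod ?a)\<^sup>2 - (cmod ?b)\<^sup>2 = 1"
    using s by (simp add: norm_mult power_mult_distrib power2_eq_square algebra_simps)
  then have LP: "?L \<in> PSU11" unfolding PSU11_def by blast
  have Lq: "?L \<circ> g = q"
  proof
    fix \<zeta>
    have "(?L \<circ> g) \<zeta> = (of_real s * (g \<zeta> - g0)) / (of_real s * (1 - cnj g0 * g \<zeta>))"
      by (simp add: moebius_def algebra_simps)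
    then show "(?L \<circ> g) \<zeta> = q \<zeta>" using s(2) by (simp add: q_def)
  qed
  have "log_form B (\<lambda>l. exp (of_real \<alpha> * l)) q"
    unfolding log_form_def
  proof (intro exI conjI allI impI)
    let ?u = "\<lambda>w. w * exp (k w / of_real \<alpha>)"
    show "B' \<le> B" by fact
    show "?u holomorphic_on ball 0 (exp B')" using \<alpha> by (intro holomorphic_intros k) auto
    have "(k has_field_derivative deriv k 0) (at 0)" using k by (intro holomorphic_derivI) auto
    then have "(?u has_field_derivative exp (k 0 / of_real \<alpha>)) (at 0)"
      using \<alpha> by (auto intro!: derivative_eq_intros)
    then show "deriv ?u 0 \<noteq> 0" by (simp add: DERIV_imp_deriv)
    have "(k \<circ> exp) holomorphic_on left_half B'"
      by (rule holomorphic_on_compose_gen[OF holomorphic_on_exp k]) auto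
    then show "(\<lambda>\<zeta>. \<zeta> + k (exp \<zeta>) / of_real \<alpha>) holomorphic_on left_half B'"
      using \<alpha> by (intro holomorphic_intros) (auto simp: o_def)
    show "exp (\<zeta> + k (exp \<zeta>) / of_real \<alpha>) = ?u (exp \<zeta>)" for \<zeta> by (simp add: exp_add)
    show "q \<zeta> = exp (of_real \<alpha> * (\<zeta> + k (exp \<zeta>) / of_real \<alpha>))" if "Re \<zeta> < B'" for \<zeta>
      using form[OF that] \<alpha> by (simp add: \<open>\<gamma> = \<alpha>\<close> ring_distribs exp_add)
  qed auto
  then show ?thesis using that[OF LP] unfolding Lq by blast
qed

section \<open>Coordinates\<close>

lemma coordinate_chart:
  assumes "coordinate X A U z"
  shows "openin X U" "U \<subseteq> topspace X" "inj_on z U" "open (z ` U)"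
    "homeomorphic_map (subtopology X U) (top_of_set (z ` U)) z"
proof -
  have c: "is_chart X U z" using assms by (simp add: coordinate_def)
  then show 1: "openin X U" "open (z ` U)" "homeomorphic_map (subtopology X U) (top_of_set (z ` U)) z"
    by (auto simp: is_chart_def)
  then show 2: "U \<subseteq> topspace X" by (simp add: openin_subset)
  have "topspace (subtopology X U) = U" using 2 by auto
  then show "inj_on z U" using homeomorphic_imp_injective_map[OF 1(3)] by simp
qed

lemma coordinate_open_image:
  assumes "coordinate X A U z" "openin X N"
  shows "open (z ` (U \<inter> N))"
proof -
  note c = coordinate_chart[OF assms(1)]
  have "openin (subtopology X U) (U \<inter> N)"
    using assms(2) by (metis Int_commute openin_subtopology_Int)
  then have "openin (top_of_set (z ` U)) (z ` (U \<inter> N))"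
    using homeomorphic_imp_open_map[OF c(5)] by (simp add: open_map_def)
  then show ?thesis using c(4) openin_open_trans by blast
qed

lemma coordinate_open_vimage:
  assumes "coordinate X A U z" "open S"
  shows "openin X {x \<in> U. z x \<in> S}"
proof -
  note c = coordinate_chart[OF assms(1)]
  have "openin (top_of_set (z ` U)) (z ` U \<inter> S)" using assms(2) by blast
  then have "openin (subtopology X U) {x \<in> topspace (subtopology X U). z x \<in> z ` U \<inter> S}"
    using homeomorphic_imp_continuous_map[OF c(5)] openin_continuous_map_preimage by blast
  also have "{x \<in> topspace (subtopology X U). z x \<in> z ` U \<inter> S} = {x \<in> U. z x \<in> S}"
    using c(2) by auto
  finally show ?thesis using c(1) openin_trans_full by blast
qed

lemma coordinate_inv_image:
  assumes "coordinate X A U z" "S \<subseteq> z ` U"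
  shows "inv_into U z ` S = {x \<in> U. z x \<in> S}"
proof (intro equalityI subsetI)
  fix x assume "x \<in> inv_into U z ` S"
  then obtain w where "w \<in> S" "x = inv_into U z w" by blast
  then show "x \<in> {x \<in> U. z x \<in> S}"
    using assms(2) f_inv_into_f[of w z U] inv_into_into[of w z U] by auto
next
  fix x assume "x \<in> {x \<in> U. z x \<in> S}"
  then show "x \<in> inv_into U z ` S"
    using inv_into_f_f[OF coordinate_chart(3)[OF assms(1)], of x] by force
qed

lemma coordinate_inv_continuous:
  assumes "coordinate X A U z"
  shows "continuous_map (top_of_set (z ` U)) (subtopology X U) (inv_into U z)"
  unfolding continuous_map
proof (intro conjI allI impI)
  note c = coordinate_chart[OF assms]
  show "inv_into U z ` topspace (top_of_set (z ` U)) \<subseteq> topspace (subtopology X U)"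
    using c(2) by (auto simp: inv_into_into)
  fix N assume "openin (subtopology X U) N"
  then have N: "openin X N" "N \<subseteq> U" using c(1) by (auto simp: openin_open_subtopology)
  have "{x \<in> topspace (top_of_set (z ` U)). inv_into U z x \<in> N} = z ` (U \<inter> N)"
    using N(2) c(3) by (auto simp: inv_into_f_f f_inv_into_f intro!: image_eqI)
  moreover have "openin (top_of_set (z ` U)) (z ` (U \<inter> N))"
    using coordinate_open_image[OF assms N(1)] by (intro open_subset) auto
  ultimately show "openin (top_of_set (z ` U)) {x \<in> topspace (top_of_set (z ` U)). inv_into U z x \<in> N}"
    by simp
qed

text \<open>\<open>inv_into\<close> depends on the chosen domain, so shrinking the domain of a
  coordinate changes the term for its inverse, though not the values on the smaller image.\<close>

lemma inv_into_image_subset: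
  assumes "inj_on z U" "V \<subseteq> U" "w \<in> z ` V"
  shows "inv_into V z w = inv_into U z w"
  using assms by (metis inj_on_subset image_iff inv_into_f_f subsetD)

lemma coordinate_subset:
  assumes "coordinate X A U z" "openin X V" "V \<subseteq> U"
  shows "coordinate X A V z"
  unfolding coordinate_def
proof (intro conjI ballI)
  note c = coordinate_chart[OF assms(1)]
  have UV: "U \<inter> V = V" using assms(3) by auto
  have "homeomorphic_map (subtopology (subtopology X U) V) (subtopology (top_of_set (z ` U)) (z ` V)) z"
    by (rule homeomorphic_map_subtopologies_alt[OF c(5)])
       (use c(2,3) assms(3) in \<open>auto dest: inj_onD\<close>)
  moreover have "subtopology (subtopology X U) V = subtopology X V"
    by (simp add: subtopology_subtopology UV)
  moreover have "subtopology (top_of_set (z ` U)) (z ` V) = top_of_set (z ` V)"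
    using assms(3) by (simp add: subtopology_subtopology Int_absorb1 image_mono)
  ultimately show "is_chart X V z"
    using assms(2) coordinate_open_image[OF assms(1,2)] by (simp add: is_chart_def UV)
  fix d assume d: "d \<in> A"
  obtain W w where dW: "d = (W, w)" by (cases d)
  have "compatible (U, z) (W, w)" using assms(1) d dW by (auto simp: coordinate_def)
  then have 1: "(w \<circ> inv_into U z) holomorphic_on z ` (U \<inter> W)" and 2: "(z \<circ> inv_into W w) holomorphic_on w ` (U \<inter> W)"
    by (auto simp: compatible_def)
  have "(w \<circ> inv_into V z) holomorphic_on z ` (V \<inter> W)"
  proof (rule holomorphic_transform)
    show "(w \<circ> inv_into U z) holomorphic_on z ` (V \<inter> W)"
      by (rule holomorphic_on_subset[OF 1]) (use assms(3) in auto)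
    show "(w \<circ> inv_into U z) x = (w \<circ> inv_into V z) x" if "x \<in> z ` (V \<inter> W)" for x
      using inv_into_image_subset[OF c(3) assms(3), of x] that by auto
  qed
  moreover have "(z \<circ> inv_into W w) holomorphic_on w ` (V \<inter> W)"
    by (rule holomorphic_on_subset[OF 2]) (use assms(3) in auto)
  ultimately show "compatible (V, z) d" by (simp add: compatible_def dW)
qed

lemma riemann_surface_coordinate:
  assumes "riemann_surface X A" "x \<in> topspace X"
  obtains W w where "(W, w) \<in> A" "coordinate X A W w" "x \<in> W"
proof -
  have "x \<in> \<Union> (fst ` A)" using assms by (simp add: riemann_surface_def)
  then obtain W w where W: "(W, w) \<in> A" "x \<in> W" by auto
  then have "coordinate X A W w" using assms(1) by (auto simp: riemann_surface_def coordinate_def)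
  with W show ?thesis by (intro that)
qed

text \<open>\<open>holomorphic_in\<close> tests only the charts of \<open>A\<close>; near each point
  a transition map to such a chart carries the property over to a coordinate of the maximal
  atlas.\<close>

lemma holomorphic_in_coordinate:
  assumes rs: "riemann_surface X A" and co: "coordinate X A U z" and V: "openin X V" "holomorphic_in A V f"
  shows "(f \<circ> inv_into U z) holomorphic_on z ` (U \<inter> V)"
proof (rule holomorphic_onI)
  fix y assume "y \<in> z ` (U \<inter> V)"
  then obtain x where x: "y = z x" "x \<in> U" "x \<in> V" by auto
  note c = coordinate_chart[OF co]
  obtain W w where W: "(W, w) \<in> A" "coordinate X A W w" "x \<in> W"
    using riemann_surface_coordinate[OF rs, of x] x(2) c(2) by blast
  note cw = coordinate_chart[OF W(2)]
  have "compatible (U, z) (W, w)" using co W(1) by (auto simp: coordinate_def)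
  then have 1: "(w \<circ> inv_into U z) holomorphic_on z ` (U \<inter> W)" by (simp add: compatible_def)
  have 2: "(f \<circ> inv_into W w) holomorphic_on w ` (W \<inter> V)" using V(2) W(1) by (auto simp: holomorphic_in_def)
  let ?S = "z ` (U \<inter> (V \<inter> W))"
  have "((f \<circ> inv_into W w) \<circ> (w \<circ> inv_into U z)) holomorphic_on ?S"
  proof (rule holomorphic_on_compose_gen[OF _ 2])
    show "(w \<circ> inv_into U z) holomorphic_on ?S" by (rule holomorphic_on_subset[OF 1]) auto
    show "(w \<circ> inv_into U z) ` ?S \<subseteq> w ` (W \<inter> V)"
      using c(3) by (auto simp: inv_into_f_f)
  qed
  then have "(f \<circ> inv_into U z) holomorphic_on ?S"
    by (rule holomorphic_transform) (use c(3) cw(3) in \<open>auto simp: inv_into_f_f\<close>)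
  moreover have "open ?S" by (rule coordinate_open_image[OF co]) (use V(1) cw(1) in auto)
  moreover have "y \<in> ?S" using x W(3) by auto
  ultimately show "(f \<circ> inv_into U z) field_differentiable at y within z ` (U \<inter> V)"
    by (meson field_differentiable_at_within holomorphic_on_imp_differentiable_at)
qed

text \<open>Conversely, one coordinate around all of \<open>V\<close> suffices, as every chart of
  \<open>A\<close> is related to it by a holomorphic transition map.\<close>

lemma holomorphic_in_coordinateI:
  assumes co: "coordinate X A U z" and V: "V \<subseteq> U" and hol: "(f \<circ> inv_into U z) holomorphic_on z ` V"
    and rs: "riemann_surface X A"
  shows "holomorphic_in A V f"
  unfolding holomorphic_in_def
proof (intro ballI, clarify)
  fix W w assume W: "(W, w) \<in> A"
  note c = coordinate_chart[OF co]
  have "compatible (U, z) (W, w)" using co W(1) by (auto simp: coordinate_def)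
  then have 1: "(z \<circ> inv_into W w) holomorphic_on w ` (U \<inter> W)" by (simp add: compatible_def)
  have "coordinate X A W w" using W rs by (auto simp: riemann_surface_def coordinate_def)
  note cw = coordinate_chart[OF this]
  have "((f \<circ> inv_into U z) \<circ> (z \<circ> inv_into W w)) holomorphic_on w ` (W \<inter> V)"
  proof (rule holomorphic_on_compose_gen[OF _ hol])
    show "(z \<circ> inv_into W w) holomorphic_on w ` (W \<inter> V)" by (rule holomorphic_on_subset[OF 1]) (use V in auto)
    show "(z \<circ> inv_into W w) ` (w ` (W \<inter> V)) \<subseteq> z ` V"
      using cw(3) by (auto simp: inv_into_f_f)
  qed
  then show "(f \<circ> inv_into W w) holomorphic_on w ` (W \<inter> V)"
    by (rule holomorphic_transform) (use c(3) cw(3) V in \<open>auto simp: inv_into_f_f subset_iff\<close>)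
qed

text \<open>An injective holomorphic map has a holomorphic inverse, so both transition maps of the
  new coordinate are compositions of holomorphic maps. In this way the normal form yields the
  coordinate in which it is stated.\<close>

lemma coordinate_compose:
  assumes co: "coordinate X A U z" and T: "open T" "z ` U \<subseteq> T"
    and u: "u holomorphic_on T" "inj_on u T" and rs: "riemann_surface X A"
  shows "coordinate X A U (u \<circ> z)"
  unfolding coordinate_def
proof (intro conjI ballI)
  note c = coordinate_chart[OF co]
  have inj: "inj_on (u \<circ> z) U" by (intro comp_inj_on c(3) inj_on_subset[OF u(2) T(2)])
  have uz: "u holomorphic_on z ` U" "inj_on u (z ` U)"
    using holomorphic_on_subset[OF u(1) T(2)] inj_on_subset[OF u(2) T(2)] by auto
  obtain v where v: "v holomorphic_on u ` (z ` U)" "\<And>y. y \<in> z ` U \<Longrightarrow> v (u y) = y"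
    using holomorphic_has_inverse[OF uz(1) c(4) uz(2)] by metis
  have op: "open (u ` z ` U)" by (rule open_mapping_thm3[OF uz(1) c(4) uz(2)])
  have "homeomorphic_map (top_of_set (z ` U)) (top_of_set (u ` z ` U)) u"
    unfolding homeomorphic_map_maps homeomorphic_maps_def
    by (rule exI[of _ v])
       (use holomorphic_on_imp_continuous_on[OF uz(1)] holomorphic_on_imp_continuous_on[OF v(1)] v(2) in auto)
  then have "homeomorphic_map (subtopology X U) (top_of_set ((u \<circ> z) ` U)) (u \<circ> z)"
    using homeomorphic_map_compose[OF c(5)] by (simp add: image_comp)
  then show "is_chart X U (u \<circ> z)" using c(1) op by (simp add: is_chart_def image_comp)
  have inv: "inv_into U (u \<circ> z) ((u \<circ> z) x) = inv_into U z (v (u (z x)))" if "x \<in> U" for x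
    using that inj c(3) v(2)[of "z x"] inv_into_f_f[OF inj that] by simp
  fix d assume d: "d \<in> A"
  obtain W w where dW: "d = (W, w)" by (cases d)
  have "compatible (U, z) (W, w)" using co d dW by (auto simp: coordinate_def)
  then have 1: "(w \<circ> inv_into U z) holomorphic_on z ` (U \<inter> W)" and 2: "(z \<circ> inv_into W w) holomorphic_on w ` (U \<inter> W)"
    by (auto simp: compatible_def)
  have W: "inj_on w W"
    using rs d coordinate_chart(3)[of X A W w] by (auto simp: dW riemann_surface_def coordinate_def)
  have "((w \<circ> inv_into U z) \<circ> v) holomorphic_on (u \<circ> z) ` (U \<inter> W)"
  proof (rule holomorphic_on_compose_gen[OF _ 1])
    show "v holomorphic_on (u \<circ> z) ` (U \<inter> W)" by (rule holomorphic_on_subset[OF v(1)]) auto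
  qed (use v(2) in auto)
  then have "(w \<circ> inv_into U (u \<circ> z)) holomorphic_on (u \<circ> z) ` (U \<inter> W)"
    by (rule holomorphic_transform) (use inv in auto)
  moreover have "(u \<circ> (z \<circ> inv_into W w)) holomorphic_on w ` (U \<inter> W)"
    by (rule holomorphic_on_compose_gen[OF 2 uz(1)]) (use W in \<open>auto simp: inv_into_f_f\<close>)
  ultimately show "compatible (U, u \<circ> z) d" by (simp add: compatible_def dW o_assoc)
qed

section \<open>Analytic continuation\<close>

lemma identity_germ:
  assumes "open B" "connected B" "f holomorphic_on B" "g holomorphic_on B" "x \<in> B" "y \<in> B"
    and "\<forall>\<^sub>F \<eta> in nhds x. f \<eta> = g \<eta>"
  shows "\<forall>\<^sub>F \<eta> in nhds y. f \<eta> = g \<eta>"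
proof -
  obtain N where N: "open N" "x \<in> N" "\<And>\<eta>. \<eta> \<in> N \<Longrightarrow> f \<eta> = g \<eta>"
    using assms(7) by (auto simp: eventually_nhds)
  have "f \<eta> = g \<eta>" if "\<eta> \<in> B" for \<eta>
    by (rule analytic_continuation_open[of "N \<inter> B" B f g]) (use assms N that in auto)
  then show ?thesis using assms(1,6) by (auto simp: eventually_nhds)
qed

lemma eventually_eq_cong:
  assumes "\<forall>\<^sub>F x in F. f x = g x"
  shows "(\<forall>\<^sub>F x in F. f x = h x) \<longleftrightarrow> (\<forall>\<^sub>F x in F. g x = h x)"
  by (rule eventually_subst, rule eventually_mono[OF assms]) simp

text \<open>Serves to carry a property of germs along a continuation, whose definition compares each
  time only with nearby times.\<close>

lemma locally_constant_unit_interval: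
  fixes P :: "real \<Rightarrow> bool"
  assumes "\<And>t. t \<in> {0..1} \<Longrightarrow> \<exists>\<epsilon>>0. \<forall>s\<in>{0..1}. \<bar>s - t\<bar> < \<epsilon> \<longrightarrow> P s = P t"
    and "s \<in> {0..1}" "t \<in> {0..1}" "P s"
  shows "P t"
proof -
  have "P constant_on {0..1}"
  proof (rule locally_constant_imp_constant)
    fix t :: real assume t: "t \<in> {0..1}"
    then obtain \<epsilon> where e: "\<epsilon> > 0" "\<And>s. s \<in> {0..1} \<Longrightarrow> \<bar>s - t\<bar> < \<epsilon> \<Longrightarrow> P s = P t"
      using assms(1) by blast
    show "\<exists>T. openin (top_of_set {0..1}) T \<and> t \<in> T \<and> (\<forall>x\<in>T. P x = P t)"
    proof (intro exI[of _ "{0..1} \<inter> ball t \<epsilon>"] conjI ballI)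
      show "P x = P t" if "x \<in> {0..1} \<inter> ball t \<epsilon>" for x
        by (rule e(2)) (use that in \<open>auto simp: dist_real_def\<close>)
    qed (use t e(1) in \<open>simp_all add: openin_open_Int\<close>)
  qed simp
  then show ?thesis using assms(2-4) by (auto simp: constant_on_def)
qed

text \<open>The monodromy theorem for continuations along the segments from \<open>\<zeta>0\<close>. The elements
  \<open>f e\<close> on \<open>D e\<close> are indexed by \<open>e\<close>; \<open>c \<zeta>\<close> is the continuation along the segment to \<open>\<zeta>\<close>.\<close>

lemma monodromy_segments:
  fixes D :: "'e \<Rightarrow> complex set" and f :: "'e \<Rightarrow> complex \<Rightarrow> complex" and c :: "complex \<Rightarrow> real \<Rightarrow> 'e"
    and \<zeta>0 :: complex
  defines "\<sigma> \<equiv> \<lambda>\<zeta> t. \<zeta>0 + of_real t * (\<zeta> - \<zeta>0)"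
  assumes H: "open H"
    and c0: "\<And>\<zeta>. \<zeta> \<in> H \<Longrightarrow> c \<zeta> 0 = e0"
    and op: "\<And>\<zeta> t. \<zeta> \<in> H \<Longrightarrow> t \<in> {0..1} \<Longrightarrow> open (D (c \<zeta> t))"
    and hol: "\<And>\<zeta> t. \<zeta> \<in> H \<Longrightarrow> t \<in> {0..1} \<Longrightarrow> f (c \<zeta> t) holomorphic_on D (c \<zeta> t)"
    and mem: "\<And>\<zeta> t. \<zeta> \<in> H \<Longrightarrow> t \<in> {0..1} \<Longrightarrow> \<sigma> \<zeta> t \<in> D (c \<zeta> t)"
    and cont: "\<And>\<zeta> t. \<zeta> \<in> H \<Longrightarrow> t \<in> {0..1} \<Longrightarrow> \<exists>\<epsilon>>0. \<forall>s\<in>{0..1}. \<bar>s - t\<bar> < \<epsilon> \<longrightarrow>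
        (\<forall>\<^sub>F \<eta> in nhds (\<sigma> \<zeta> s). f (c \<zeta> s) \<eta> = f (c \<zeta> t) \<eta>)"
    and z: "\<zeta> \<in> H"
  shows "\<forall>\<^sub>F \<eta> in nhds \<zeta>. f (c \<eta> 1) \<eta> = f (c \<zeta> 1) \<eta>"
proof -
  \<comment> \<open>\<open>Q t\<close> says that at time t the continuations along neighbouring
    segments have the same germs as the central one. It holds at time 0, where all start from
    \<open>e0\<close>, and it is shown to be locally constant in t.\<close>
  define Q where "Q t \<longleftrightarrow> (\<forall>\<^sub>F \<zeta>' in nhds \<zeta>. \<forall>\<^sub>F \<eta> in nhds (\<sigma> \<zeta>' t). f (c \<zeta>' t) \<eta> = f (c \<zeta> t) \<eta>)" for t
  have \<sigma>cont: "((\<lambda>\<zeta>'. \<sigma> \<zeta>' t) \<longlongrightarrow> \<sigma> \<zeta> t) (nhds \<zeta>)" for t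
    unfolding \<sigma>_def by (intro tendsto_intros filterlim_ident)
  have dist1: "dist (\<sigma> \<zeta>' s) (\<sigma> \<zeta> t) \<le> dist \<zeta>' \<zeta> + \<bar>s - t\<bar> * cmod (\<zeta> - \<zeta>0)" if "s \<in> {0..1}" for \<zeta>' s t
  proof -
    have "\<sigma> \<zeta>' s - \<sigma> \<zeta> t = of_real s * (\<zeta>' - \<zeta>) + of_real (s - t) * (\<zeta> - \<zeta>0)"
      by (simp add: \<sigma>_def algebra_simps)
    then have "cmod (\<sigma> \<zeta>' s - \<sigma> \<zeta> t) \<le> cmod (of_real s * (\<zeta>' - \<zeta>)) + cmod (of_real (s - t) * (\<zeta> - \<zeta>0))"
      by (simp only: norm_triangle_ineq)
    also have "\<dots> \<le> 1 * cmod (\<zeta>' - \<zeta>) + \<bar>s - t\<bar> * cmod (\<zeta> - \<zeta>0)"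
      unfolding norm_mult norm_of_real using that by (intro add_mono mult_right_mono) auto
    finally show ?thesis by (simp add: dist_norm)
  qed
  have loc: "\<exists>\<epsilon>>0. \<forall>s\<in>{0..1}. \<bar>s - t\<bar> < \<epsilon> \<longrightarrow> Q s = Q t" if t: "t \<in> {0..1}" for t
  proof -
    obtain \<epsilon>1 where \<epsilon>1: "\<epsilon>1 > 0" "\<And>s. s \<in> {0..1} \<Longrightarrow> \<bar>s - t\<bar> < \<epsilon>1 \<Longrightarrow>
        \<forall>\<^sub>F \<eta> in nhds (\<sigma> \<zeta> s). f (c \<zeta> s) \<eta> = f (c \<zeta> t) \<eta>"
      using cont[OF z t] by blast
    obtain \<rho> where \<rho>: "\<rho> > 0" "ball (\<sigma> \<zeta> t) \<rho> \<subseteq> D (c \<zeta> t)"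
      using op[OF z t] mem[OF z t] openE by blast
    \<comment> \<open>Moving the parameter and moving the end point may each use up half of the
      radius \<rho>; the summand 1 avoids a zero denominator.\<close>
    define \<epsilon> where "\<epsilon> = min \<epsilon>1 (\<rho> / (2 * (cmod (\<zeta> - \<zeta>0) + 1)))"
    have \<epsilon>: "\<epsilon> > 0" unfolding \<epsilon>_def using \<epsilon>1 \<rho> norm_ge_zero[of "\<zeta> - \<zeta>0"]
      by (auto intro!: divide_pos_pos add_nonneg_pos mult_pos_pos)
    have inB: "\<sigma> \<zeta>' s \<in> ball (\<sigma> \<zeta> t) \<rho>" if "s \<in> {0..1}" "\<bar>s - t\<bar> < \<epsilon>" "dist \<zeta>' \<zeta> < \<rho> / 2" for s \<zeta>'
    proof -
      have "\<bar>s - t\<bar> * cmod (\<zeta> - \<zeta>0) \<le> (\<rho> / (2 * (cmod (\<zeta> - \<zeta>0) + 1))) * (cmod (\<zeta> - \<zeta>0) + 1)"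
        using that(2) \<rho> by (intro mult_mono) (auto simp: \<epsilon>_def)
      also have "\<dots> = \<rho> / 2" using norm_ge_zero[of "\<zeta> - \<zeta>0"] by (simp add: field_simps add_nonneg_eq_0_iff)
      finally show ?thesis using dist1[OF that(1), of \<zeta>' t] that(3) by (simp add: dist_commute)
    qed
    \<comment> \<open>Neighbouring segments are compared with the fixed element at time t, which is
      holomorphic on the whole ball, rather than with the moving element at time s.\<close>
    define Q' where "Q' \<zeta>' s \<longleftrightarrow> (\<forall>\<^sub>F \<eta> in nhds (\<sigma> \<zeta>' s). f (c \<zeta>' s) \<eta> = f (c \<zeta> t) \<eta>)" for \<zeta>' s
    have QQ': "Q s \<longleftrightarrow> (\<forall>\<^sub>F \<zeta>' in nhds \<zeta>. Q' \<zeta>' s)" if s: "s \<in> {0..1}" "\<bar>s - t\<bar> < \<epsilon>" for s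
    proof -
      have "\<forall>\<^sub>F x in nhds (\<sigma> \<zeta> s). \<forall>\<^sub>F \<eta> in nhds x. f (c \<zeta> s) \<eta> = f (c \<zeta> t) \<eta>"
        using \<epsilon>1(2)[OF s(1)] s(2) by (simp add: \<epsilon>_def eventually_eventually)
      then have "\<forall>\<^sub>F \<zeta>' in nhds \<zeta>. \<forall>\<^sub>F \<eta> in nhds (\<sigma> \<zeta>' s). f (c \<zeta> s) \<eta> = f (c \<zeta> t) \<eta>"
        using \<sigma>cont[of s] by (auto simp: filterlim_iff)
      then have "\<forall>\<^sub>F \<zeta>' in nhds \<zeta>. (\<forall>\<^sub>F \<eta> in nhds (\<sigma> \<zeta>' s). f (c \<zeta>' s) \<eta> = f (c \<zeta> s) \<eta>) = Q' \<zeta>' s"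
      proof eventually_elim
        case (elim \<zeta>')
        then have "\<forall>\<^sub>F \<eta> in nhds (\<sigma> \<zeta>' s). (f (c \<zeta>' s) \<eta> = f (c \<zeta> s) \<eta>) = (f (c \<zeta>' s) \<eta> = f (c \<zeta> t) \<eta>)"
          by eventually_elim simp
        then show ?case unfolding Q'_def by (rule eventually_subst)
      qed
      then show ?thesis unfolding Q_def by (rule eventually_subst)
    qed
    \<comment> \<open>The \<epsilon> of the continuation along the segment to
      \<open>\<zeta>'\<close> depends on \<open>\<zeta>'\<close>. A uniform interval is nevertheless
      available: the identity theorem makes \<open>Q' \<zeta>'\<close> locally constant on
      \<open>?I\<close>, and this interval is connected.\<close>
    have Q'loc: "Q' \<zeta>' s \<longleftrightarrow> Q' \<zeta>' t" if s: "s \<in> {0..1}" "\<bar>s - t\<bar> < \<epsilon>" and z': "\<zeta>' \<in> H" "dist \<zeta>' \<zeta> < \<rho> / 2" for s \<zeta>'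
    proof -
      let ?I = "{0..1} \<inter> {t - \<epsilon> <..< t + \<epsilon>}"
      have "Q' \<zeta>' constant_on ?I"
      proof (rule locally_constant_imp_constant)
        show "connected ?I" by (intro convex_connected convex_Int) auto
        fix a assume a: "a \<in> ?I"
        then have a': "a \<in> {0..1}" "\<bar>a - t\<bar> < \<epsilon>" by auto
        obtain \<epsilon>2 where \<epsilon>2: "\<epsilon>2 > 0" "\<And>s. s \<in> {0..1} \<Longrightarrow> \<bar>s - a\<bar> < \<epsilon>2 \<Longrightarrow>
            \<forall>\<^sub>F \<eta> in nhds (\<sigma> \<zeta>' s). f (c \<zeta>' s) \<eta> = f (c \<zeta>' a) \<eta>"
          using cont[OF z'(1) a'(1)] by blast
        have "open (D (c \<zeta>' a) \<inter> ball (\<sigma> \<zeta> t) \<rho>)" using op[OF z'(1) a'(1)] by auto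
        moreover have "\<sigma> \<zeta>' a \<in> D (c \<zeta>' a) \<inter> ball (\<sigma> \<zeta> t) \<rho>" using mem[OF z'(1) a'(1)] inB[OF a' z'(2)] by auto
        ultimately obtain \<rho>2 where \<rho>2: "\<rho>2 > 0" "ball (\<sigma> \<zeta>' a) \<rho>2 \<subseteq> D (c \<zeta>' a) \<inter> ball (\<sigma> \<zeta> t) \<rho>"
          using openE by blast
        let ?B = "ball (\<sigma> \<zeta>' a) \<rho>2"
        have "continuous (at a) (\<sigma> \<zeta>')" unfolding \<sigma>_def by (intro continuous_intros)
        then obtain \<epsilon>3 where \<epsilon>3: "\<epsilon>3 > 0" "\<And>s. \<bar>s - a\<bar> < \<epsilon>3 \<Longrightarrow> dist (\<sigma> \<zeta>' s) (\<sigma> \<zeta>' a) < \<rho>2"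
          using \<rho>2(1) by (auto simp: continuous_at_eps_delta dist_real_def)
        have hB: "f (c \<zeta>' a) holomorphic_on ?B" "f (c \<zeta> t) holomorphic_on ?B"
          using holomorphic_on_subset[OF hol[OF z'(1) a'(1)], of ?B] holomorphic_on_subset[OF hol[OF z t], of ?B] \<rho>2(2) \<rho>(2)
          by auto
        have that': "Q' \<zeta>' s = Q' \<zeta>' a" if s: "s \<in> ?I" "\<bar>s - a\<bar> < min \<epsilon>2 \<epsilon>3" for s
        proof -
          have sB: "\<sigma> \<zeta>' s \<in> ?B" using \<epsilon>3(2)[of s] s(2) by (simp add: dist_commute)
          have aB: "\<sigma> \<zeta>' a \<in> ?B" using \<rho>2(1) by simp
          have ev: "\<forall>\<^sub>F \<eta> in nhds (\<sigma> \<zeta>' s). f (c \<zeta>' s) \<eta> = f (c \<zeta>' a) \<eta>" using \<epsilon>2(2)[of s] s by auto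
          have "Q' \<zeta>' s \<longleftrightarrow> (\<forall>\<^sub>F \<eta> in nhds (\<sigma> \<zeta>' s). f (c \<zeta>' a) \<eta> = f (c \<zeta> t) \<eta>)"
            unfolding Q'_def by (rule eventually_eq_cong[OF ev])
          also have "\<dots> \<longleftrightarrow> Q' \<zeta>' a"
            unfolding Q'_def
            using identity_germ[OF open_ball connected_ball hB sB aB] identity_germ[OF open_ball connected_ball hB aB sB] by blast
          finally show ?thesis .
        qed
        show "\<exists>T. openin (top_of_set ?I) T \<and> a \<in> T \<and> (\<forall>x\<in>T. Q' \<zeta>' x = Q' \<zeta>' a)"
          using a \<epsilon>2(1) \<epsilon>3(1)
          by (intro exI[of _ "?I \<inter> ball a (min \<epsilon>2 \<epsilon>3)"] conjI openin_open_Int open_ball ballI that')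
             (simp_all add: dist_real_def abs_minus_commute)
      qed
      moreover have "s \<in> ?I" "t \<in> ?I" using s t \<epsilon> by auto
      ultimately show ?thesis by (auto simp: constant_on_def)
    qed
    have near: "\<forall>\<^sub>F \<zeta>' in nhds \<zeta>. \<zeta>' \<in> H \<and> dist \<zeta>' \<zeta> < \<rho> / 2"
    proof -
      have "\<forall>\<^sub>F \<zeta>' in nhds \<zeta>. \<zeta>' \<in> H \<inter> ball \<zeta> (\<rho> / 2)"
        using H z \<rho>(1) by (intro eventually_nhds_in_open) auto
      then show ?thesis by eventually_elim (simp add: dist_commute)
    qed
    have "Q s = Q t" if s: "s \<in> {0..1}" "\<bar>s - t\<bar> < \<epsilon>" for s
    proof -
      have "(\<forall>\<^sub>F \<zeta>' in nhds \<zeta>. Q' \<zeta>' s) \<longleftrightarrow> (\<forall>\<^sub>F \<zeta>' in nhds \<zeta>. Q' \<zeta>' t)"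
        by (rule eventually_subst, rule eventually_mono[OF near]) (use Q'loc[OF s] in blast)
      then show ?thesis using QQ'[OF s] QQ'[OF t] \<epsilon> by simp
    qed
    then show ?thesis using \<epsilon> by blast
  qed
  have "Q 0"
  proof -
    have "\<forall>\<^sub>F \<zeta>' in nhds \<zeta>. \<zeta>' \<in> H" using H z by (rule eventually_nhds_in_open)
    then show ?thesis unfolding Q_def
      by eventually_elim (use c0 z in simp)
  qed
  then have "Q 1" using locally_constant_unit_interval[where P = Q and s = 0 and t = 1, OF loc] by simp
  then have "\<forall>\<^sub>F \<zeta>' in nhds \<zeta>. \<forall>\<^sub>F \<eta> in nhds \<zeta>'. f (c \<zeta>' 1) \<eta> = f (c \<zeta> 1) \<eta>"
    by (simp add: Q_def \<sigma>_def)
  \<comment> \<open>Each germ is used only at its own centre, which gives the diagonal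
    value.\<close>
  then show ?thesis by eventually_elim (rule eventually_nhds_x_imp_x)
qed

text \<open>The end point is recorded because a continuation can be prolonged, or its last element be shrunk,
  only there.\<close>

definition reached :: "'a topology \<Rightarrow> 'a chart set \<Rightarrow> 'a set \<Rightarrow> 'a elem \<Rightarrow> 'a \<Rightarrow> 'a elem \<Rightarrow> bool" where
  "reached X A Y e0 x e \<longleftrightarrow> (\<exists>\<gamma> E. continuation_along X A Y \<gamma> E \<and> E 0 = e0 \<and> E 1 = e \<and> \<gamma> 1 = x)"

lemma reached_continuations: "reached X A Y e0 x e \<Longrightarrow> e \<in> continuations X A Y e0"
  by (auto simp: reached_def continuations_def)

lemma continuation_alongD:
  assumes "continuation_along X A Y \<gamma> E" "t \<in> {0..1}"
  shows "function_element X A Y (E t)" "\<gamma> t \<in> fst (E t)" "\<gamma> t \<in> topspace X" "\<gamma> t \<in> Y"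
    "\<exists>\<epsilon>>0. \<forall>s\<in>{0..1}. \<bar>s - t\<bar> < \<epsilon> \<longrightarrow> same_germ X (\<gamma> s) (E s) (E t)"
proof -
  have "\<gamma> ` {0..1} \<subseteq> topspace (subtopology X Y)"
    using assms(1) continuous_map_image_subset_topspace[of "top_of_set {0..1}" "subtopology X Y" \<gamma>]
    by (simp add: continuation_along_def pathin_def)
  then show "\<gamma> t \<in> topspace X" "\<gamma> t \<in> Y" using assms(2) by auto
qed (use assms in \<open>auto simp: continuation_along_def\<close>)

lemma pathin_join:
  assumes "pathin X g1" "pathin X g2" "g1 1 = g2 0"
  shows "pathin X (\<lambda>t. if t \<le> 1 / 2 then g1 (2 * t) else g2 (2 * t - 1))"
proof -
  let ?T01 = "top_of_set {0..1::real}"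
  have "continuous_map ?T01 X (\<lambda>t. if t \<le> 1 / 2 then (g1 \<circ> (\<lambda>t. 2 * t)) t else (g2 \<circ> (\<lambda>t. 2 * t - 1)) t)"
  proof (intro continuous_map_cases_le continuous_map_compose, force, force)
    show "continuous_map (subtopology ?T01 {x \<in> topspace ?T01. x \<le> 1/2}) ?T01 (\<lambda>t. 2 * t)"
      unfolding continuous_map_in_subtopology subtopology_subtopology
      by (auto intro!: continuous_intros)
    show "continuous_map (subtopology ?T01 {x \<in> topspace ?T01. 1/2 \<le> x}) ?T01 (\<lambda>t. 2 * t - 1)"
      unfolding continuous_map_in_subtopology subtopology_subtopology
      by (auto intro!: continuous_intros)
    show "(g1 \<circ> (\<lambda>t. 2 * t)) x = (g2 \<circ> (\<lambda>t. 2 * t - 1)) x" if "x \<in> topspace ?T01" "x = 1/2" for x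
      using assms(3) by (simp add: that(2))
  qed (use assms in \<open>auto simp: pathin_def\<close>)
  then show ?thesis by (simp only: pathin_def o_def)
qed

lemma reached_trans:
  assumes "reached X A Y e0 x e" and 2: "continuation_along X A Y \<gamma>2 E2" and e: "E2 0 = e" "\<gamma>2 0 = x"
  shows "reached X A Y e0 (\<gamma>2 1) (E2 1)"
proof -
  obtain \<gamma>1 E1 where 1: "continuation_along X A Y \<gamma>1 E1" "E1 0 = e0" "E1 1 = e" "\<gamma>1 1 = x"
    using assms(1) by (auto simp: reached_def)
  define \<gamma> where "\<gamma> t = (if t \<le> 1 / 2 then \<gamma>1 (2 * t) else \<gamma>2 (2 * t - 1))" for t :: real
  define E where "E t = (if t \<le> 1 / 2 then E1 (2 * t) else E2 (2 * t - 1))" for t :: real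
  have l: "\<gamma> t = \<gamma>1 (2 * t)" "E t = E1 (2 * t)" if "t \<le> 1 / 2" for t
    using that by (auto simp: \<gamma>_def E_def)
  have r: "\<gamma> t = \<gamma>2 (2 * t - 1)" "E t = E2 (2 * t - 1)" if "t \<ge> 1 / 2" for t
  proof -
    have "\<gamma> t = \<gamma>2 (2 * t - 1) \<and> E t = E2 (2 * t - 1)"
    proof (cases "t = 1 / 2")
      case True
      show ?thesis unfolding True using 1(3,4) e by (simp add: \<gamma>_def E_def)
    next
      case False
      then show ?thesis using that by (simp add: \<gamma>_def E_def)
    qed
    then show "\<gamma> t = \<gamma>2 (2 * t - 1)" "E t = E2 (2 * t - 1)" by auto
  qed
  have "continuation_along X A Y \<gamma> E"
    unfolding continuation_along_def
  proof (intro conjI ballI)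
    show "pathin (subtopology X Y) \<gamma>"
      unfolding \<gamma>_def using 1 2 e by (intro pathin_join) (auto simp: continuation_along_def)
    fix t :: real assume t: "t \<in> {0..1}"
    have "function_element X A Y (E t) \<and> \<gamma> t \<in> fst (E t)"
    proof (cases "t \<le> 1 / 2")
      case True
      then show ?thesis using t continuation_alongD(1,2)[OF 1(1), of "2 * t"] by (simp add: l)
    next
      case False
      then show ?thesis using t continuation_alongD(1,2)[OF 2, of "2 * t - 1"] by (simp add: r)
    qed
    then show "function_element X A Y (E t)" "\<gamma> t \<in> fst (E t)" by auto
    \<comment> \<open>The parameters on the two sides of 1/2 are treated separately; if t lies
      strictly on the other side, a small \<epsilon> leaves nothing to check. At t = 1/2 both
      formulas are valid.\<close>
    have L: "\<exists>\<epsilon>>0. \<forall>s\<in>{0..1}. s \<le> 1 / 2 \<longrightarrow> \<bar>s - t\<bar> < \<epsilon> \<longrightarrow> same_germ X (\<gamma> s) (E s) (E t)"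
    proof (cases "t \<le> 1 / 2")
      case True
      then obtain \<epsilon> where "\<epsilon> > 0" "\<forall>s\<in>{0..1}. \<bar>s - 2 * t\<bar> < \<epsilon> \<longrightarrow> same_germ X (\<gamma>1 s) (E1 s) (E1 (2 * t))"
        using continuation_alongD(5)[OF 1(1), of "2 * t"] t by auto
      moreover have "\<bar>2 * s - 2 * t\<bar> < \<epsilon>" if "\<bar>s - t\<bar> < \<epsilon> / 2" for s using that by (simp add: abs_if split: if_splits)
      ultimately show ?thesis using True by (intro exI[of _ "\<epsilon> / 2"]) (simp add: l)
    next
      case False
      then show ?thesis by (intro exI[of _ "t - 1 / 2"]) auto
    qed
    have R: "\<exists>\<epsilon>>0. \<forall>s\<in>{0..1}. s \<ge> 1 / 2 \<longrightarrow> \<bar>s - t\<bar> < \<epsilon> \<longrightarrow> same_germ X (\<gamma> s) (E s) (E t)"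
    proof (cases "t \<ge> 1 / 2")
      case True
      then obtain \<epsilon> where "\<epsilon> > 0" "\<forall>s\<in>{0..1}. \<bar>s - (2 * t - 1)\<bar> < \<epsilon> \<longrightarrow> same_germ X (\<gamma>2 s) (E2 s) (E2 (2 * t - 1))"
        using continuation_alongD(5)[OF 2, of "2 * t - 1"] t by auto
      moreover have "\<bar>2 * s - 1 - (2 * t - 1)\<bar> < \<epsilon>" if "\<bar>s - t\<bar> < \<epsilon> / 2" for s using that by (simp add: abs_if split: if_splits)
      ultimately show ?thesis using True by (intro exI[of _ "\<epsilon> / 2"]) (simp add: r)
    next
      case False
      then show ?thesis by (intro exI[of _ "1 / 2 - t"]) auto
    qed
    obtain \<epsilon>1 \<epsilon>2 where "\<epsilon>1 > 0" "\<epsilon>2 > 0"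
      "\<forall>s\<in>{0..1}. s \<le> 1 / 2 \<longrightarrow> \<bar>s - t\<bar> < \<epsilon>1 \<longrightarrow> same_germ X (\<gamma> s) (E s) (E t)"
      "\<forall>s\<in>{0..1}. s \<ge> 1 / 2 \<longrightarrow> \<bar>s - t\<bar> < \<epsilon>2 \<longrightarrow> same_germ X (\<gamma> s) (E s) (E t)"
      using L R by blast
    then show "\<exists>\<epsilon>>0. \<forall>s\<in>{0..1}. \<bar>s - t\<bar> < \<epsilon> \<longrightarrow> same_germ X (\<gamma> s) (E s) (E t)"
      by (intro exI[of _ "min \<epsilon>1 \<epsilon>2"]) (metis min_less_iff_conj linear)
  qed
  moreover have "E 0 = e0" "E 1 = E2 1" "\<gamma> 1 = \<gamma>2 1" using 1(2) by (auto simp: E_def \<gamma>_def)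
  ultimately show ?thesis unfolding reached_def by blast
qed

text \<open>Only the element at time 1 is replaced. Near that time the path lies in
  \<open>V\<close>, where both elements have the same germs; at an earlier time t a smaller
  \<epsilon> excludes time 1.\<close>

lemma reached_restrict:
  assumes "reached X A Y e0 x (W, f)" and V: "function_element X A Y (V, f)" "x \<in> V" and ne: "openin X V"
  shows "reached X A Y e0 x (V, f)"
proof -
  obtain \<gamma> E where 1: "continuation_along X A Y \<gamma> E" "E 0 = e0" "E 1 = (W, f)" "\<gamma> 1 = x"
    using assms(1) by (auto simp: reached_def)
  have pth: "pathin (subtopology X Y) \<gamma>" using 1(1) by (simp add: continuation_along_def)
  have "openin (top_of_set {0..1}) {t \<in> topspace (top_of_set {0..1}). \<gamma> t \<in> V}"
    using pth ne by (intro openin_continuous_map_preimage[of _ X]) (auto simp: pathin_def continuous_map_in_subtopology)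
  moreover have "1 \<in> {t \<in> topspace (top_of_set {0..1}). \<gamma> t \<in> V}" using 1(4) V(2) by simp
  ultimately have "\<exists>\<epsilon>>0. \<forall>s\<in>{0..1}. \<bar>s - 1\<bar> < \<epsilon> \<longrightarrow> \<gamma> s \<in> V"
    unfolding openin_euclidean_subtopology_iff dist_real_def by blast
  then obtain \<epsilon>0 where \<epsilon>0: "\<epsilon>0 > 0" "\<forall>s\<in>{0..1}. \<bar>s - 1\<bar> < \<epsilon>0 \<longrightarrow> \<gamma> s \<in> V" by blast
  define E' where "E' = E(1 := (V, f))"
  have "continuation_along X A Y \<gamma> E'"
    unfolding continuation_along_def
  proof (intro conjI ballI pth)
    fix t :: real assume t: "t \<in> {0..1}"
    show "function_element X A Y (E' t)" "\<gamma> t \<in> fst (E' t)"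
      using continuation_alongD[OF 1(1) t] V 1(4) by (auto simp: E'_def)
    obtain \<epsilon> where \<epsilon>: "\<epsilon> > 0" "\<forall>s\<in>{0..1}. \<bar>s - t\<bar> < \<epsilon> \<longrightarrow> same_germ X (\<gamma> s) (E s) (E t)"
      using continuation_alongD(5)[OF 1(1) t] by blast
    show "\<exists>\<epsilon>>0. \<forall>s\<in>{0..1}. \<bar>s - t\<bar> < \<epsilon> \<longrightarrow> same_germ X (\<gamma> s) (E' s) (E' t)"
    proof (cases "t = 1")
      case True
      have "same_germ X (\<gamma> s) (E' s) (E' t)" if "s \<in> {0..1}" "\<bar>s - t\<bar> < min \<epsilon> \<epsilon>0" for s
        using that \<epsilon>(2) \<epsilon>0(2) True 1(3,4) V(2)
        by (auto simp: E'_def same_germ_def)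
      then show ?thesis using \<epsilon>(1) \<epsilon>0(1) by (intro exI[of _ "min \<epsilon> \<epsilon>0"]) auto
    next
      case False
      then show ?thesis using \<epsilon> t by (intro exI[of _ "min \<epsilon> (1 - t)"]) (auto simp: E'_def)
    qed
  qed
  moreover have "E' 0 = e0" "E' 1 = (V, f)" using 1(2) by (auto simp: E'_def)
  ultimately show ?thesis using 1(4) unfolding reached_def by blast
qed

lemma function_element_subset:
  assumes "function_element X A Y (V, f)" "openin X W" "connectedin X W" "W \<noteq> {}" "W \<subseteq> V"
  shows "function_element X A Y (W, f)"
  using assms holomorphic_on_subset unfolding function_element_def holomorphic_in_def by fastforce

section \<open>Path connectedness of the complement of a closed discrete set\<close>

lemma path_component_of_punctured:
  assumes co: "coordinate X A W w" and B: "ball (w x) \<rho> \<subseteq> w ` W" "x \<in> W"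
    and N: "N = {y \<in> W. w y \<in> ball (w x) \<rho>}" and S: "N \<inter> S \<subseteq> {x}"
    and ab: "a \<in> N - S" "b \<in> N - S"
  shows "path_component_of (subtopology X (topspace X - S)) a b"
proof -
  note c = coordinate_chart[OF co]
  \<comment> \<open>Only a point of \<open>S\<close> is removed from the disc; in both cases the
    planar set stays path connected.\<close>
  define P where "P = (if x \<in> S then ball (w x) \<rho> - {w x} else ball (w x) \<rho>)"
  have P: "P \<subseteq> w ` W" using B by (auto simp: P_def)
  have pc: "path_connected P"
    unfolding P_def using path_connected_open_delete[OF open_ball connected_ball, of "w x" \<rho> "w x"]
    by (simp add: convex_imp_path_connected)
  have img: "inv_into W w ` P = N - S"
    unfolding coordinate_inv_image[OF co P] using S B(2) c(3)
    by (auto simp: N P_def dest: inj_onD split: if_splits)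
  have "path_connectedin (top_of_set (w ` W)) P"
    using pc P by (simp add: path_connectedin_subtopology)
  then have "path_connectedin (subtopology X W) (inv_into W w ` P)"
    using path_connectedin_continuous_map_image[OF coordinate_inv_continuous[OF co]] by blast
  then have "path_connectedin X (N - S)" unfolding img by (simp add: path_connectedin_subtopology)
  then have "path_connectedin (subtopology X (topspace X - S)) (N - S)"
    using c(2) by (auto simp: path_connectedin_subtopology N)
  then show ?thesis using ab by (meson path_component_of_maximal subsetD mem_Collect_eq)
qed

text \<open>The clopen argument runs on the connected space \<open>X\<close> itself:
  \<open>T\<close> also contains the points of \<open>S\<close> whose small punctured neighbourhoods
  belong to the path component of \<open>a\<close>.\<close>

lemma complement_discrete_path_connected:
  assumes rs: "riemann_surface X A" and S: "closedin X S" "subtopology X S = discrete_topology S"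
    and ab: "a \<in> topspace X - S" "b \<in> topspace X - S"
  shows "path_component_of (subtopology X (topspace X - S)) a b"
proof -
  let ?Y = "subtopology X (topspace X - S)"
  \<comment> \<open>That \<open>N - {x}\<close> is nonempty guarantees points off \<open>S\<close>
    in every good neighbourhood, so a condition on \<open>N - S\<close> is never vacuous.\<close>
  define good where "good N x \<longleftrightarrow> openin X N \<and> x \<in> N \<and> N - {x} \<noteq> {} \<and> N \<inter> S \<subseteq> {x} \<and>
     (\<forall>c\<in>N - S. \<forall>d\<in>N - S. path_component_of ?Y c d)" for N x
  have ex: "\<exists>N. good N x \<and> N \<subseteq> M" if x: "x \<in> M" and M: "openin X M" for x M
  proof -
    have xX: "x \<in> topspace X" using x M openin_subset by blast
    obtain W w where W: "(W, w) \<in> A" "coordinate X A W w" "x \<in> W"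
      using riemann_surface_coordinate[OF rs xX] by blast
    note c = coordinate_chart[OF W(2)]
    have "closedin (subtopology X S) (S - {x})" unfolding S(2) by simp
    then have cl: "closedin X (S - {x})" using S(1) closedin_trans_full by blast
    define N' where "N' = M \<inter> (topspace X - (S - {x}))"
    have "openin X N'" unfolding N'_def using M cl by (intro openin_Int) auto
    then have "open (w ` (W \<inter> N'))" by (rule coordinate_open_image[OF W(2)])
    moreover have "w x \<in> w ` (W \<inter> N')" using x xX W(3) by (auto simp: N'_def)
    ultimately obtain \<rho> where \<rho>: "\<rho> > 0" "ball (w x) \<rho> \<subseteq> w ` (W \<inter> N')" by (meson openE)
    define N where "N = {y \<in> W. w y \<in> ball (w x) \<rho>}"
    have NN': "N \<subseteq> N'"
    proof
      fix y assume "y \<in> N"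
      then have "w y \<in> w ` (W \<inter> N')" "y \<in> W" using \<rho>(2) by (auto simp: N_def)
      then show "y \<in> N'" using c(3) by (auto dest: inj_onD)
    qed
    have NS: "N \<inter> S \<subseteq> {x}" using NN' by (auto simp: N'_def)
    have ballW: "ball (w x) \<rho> \<subseteq> w ` W" using \<rho>(2) by auto
    have "openin X N" unfolding N_def by (rule coordinate_open_vimage[OF W(2) open_ball])
    moreover have "x \<in> N" using W(3) \<rho>(1) by (simp add: N_def)
    moreover have "N - {x} \<noteq> {}"
    proof -
      have "w x + of_real (\<rho> / 2) \<in> ball (w x) \<rho>" using \<rho>(1) by (simp add: dist_norm)
      then obtain y where "y \<in> W" "w y = w x + of_real (\<rho> / 2)" using ballW by (metis imageE subsetD)
      then have "y \<in> N" "y \<noteq> x" using \<rho>(1) by (auto simp: N_def dist_norm)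
      then show ?thesis by blast
    qed
    moreover have "path_component_of ?Y a b" if "a \<in> N - S" "b \<in> N - S" for a b
      by (rule path_component_of_punctured[OF W(2) ballW W(3) N_def NS that])
    ultimately have "good N x" using NS by (simp add: good_def)
    then show ?thesis using NN' by (auto simp: N'_def)
  qed
  define T where "T = {x \<in> topspace X. \<exists>N. good N x \<and> (\<forall>y\<in>N - S. path_component_of ?Y a y)}"
  \<comment> \<open>Since \<open>N - S\<close> lies in one path component, a single point outside
    the component of \<open>a\<close> excludes all of \<open>N - S\<close>.\<close>
  have all: "\<exists>N. good N x \<and> (\<forall>y\<in>N - S. \<not> path_component_of ?Y a y)" if xT: "x \<in> topspace X - T" for x
  proof -
    obtain N where N: "good N x" using ex[of x "topspace X"] xT by auto
    then obtain y where y: "y \<in> N - S" "\<not> path_component_of ?Y a y" using xT by (auto simp: T_def)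
    then have "\<not> path_component_of ?Y a y'" if "y' \<in> N - S" for y'
      using N that y unfolding good_def by (meson path_component_of_trans)
    then show ?thesis using N by blast
  qed
  \<comment> \<open>A good neighbourhood of \<open>x'\<close> inside the intersection contains a
    point other than \<open>x'\<close>, and such a point is not in \<open>S\<close>.\<close>
  have nonempty: "\<exists>y. y \<in> N \<inter> N' - S" if "good N x" "good N' x'" "x' \<in> N" for N N' x x'
  proof -
    have o: "openin X (N \<inter> N')" and x': "x' \<in> N \<inter> N'" using that by (auto simp: good_def)
    from ex[OF x' o] obtain M where M: "good M x'" "M \<subseteq> N \<inter> N'" by blast
    from M(1) obtain y where "y \<in> M" "y \<noteq> x'" unfolding good_def by blast
    then have "y \<notin> S" using M(1) by (auto simp: good_def)
    then show ?thesis using M \<open>y \<in> M\<close> by blast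
  qed
  have opT: "openin X T"
  proof (subst openin_subopen, intro ballI)
    fix x assume "x \<in> T"
    then obtain N where N: "good N x" "\<forall>y\<in>N - S. path_component_of ?Y a y" by (auto simp: T_def)
    have "N \<subseteq> T"
    proof
      fix x' assume x': "x' \<in> N"
      then have xX: "x' \<in> topspace X" using N(1) openin_subset by (auto simp: good_def)
      show "x' \<in> T"
      proof (rule ccontr)
        assume "x' \<notin> T"
        then obtain N' where N': "good N' x'" "\<forall>y\<in>N' - S. \<not> path_component_of ?Y a y" using all xX by blast
        then show False using nonempty[OF N(1) N'(1) x'] N(2) by blast
      qed
    qed
    then show "\<exists>M. openin X M \<and> x \<in> M \<and> M \<subseteq> T" using N(1) by (auto simp: good_def)
  qed
  have "openin X (topspace X - T)"
  proof (subst openin_subopen, intro ballI)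
    fix x assume "x \<in> topspace X - T"
    then obtain N where N: "good N x" "\<forall>y\<in>N - S. \<not> path_component_of ?Y a y" using all by blast
    have "N \<subseteq> topspace X - T"
    proof
      fix x' assume x': "x' \<in> N"
      then have xX: "x' \<in> topspace X" using N(1) openin_subset by (auto simp: good_def)
      have "x' \<notin> T"
      proof
        assume "x' \<in> T"
        then obtain N' where N': "good N' x'" "\<forall>y\<in>N' - S. path_component_of ?Y a y" by (auto simp: T_def)
        then show False using nonempty[OF N(1) N'(1) x'] N(2) by blast
      qed
      with xX show "x' \<in> topspace X - T" by simp
    qed
    then show "\<exists>M. openin X M \<and> x \<in> M \<and> M \<subseteq> topspace X - T" using N(1) by (auto simp: good_def)
  qed
  then have "closedin X T" by (auto simp: closedin_def T_def)
  moreover have "connected_space X" using rs by (simp add: riemann_surface_def)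
  ultimately have "T = {} \<or> T = topspace X" using opT by (simp add: connected_space_clopen_in)
  moreover have "a \<in> T"
  proof -
    obtain N where N: "good N a" using ex[of a "topspace X"] ab by auto
    then have "\<forall>y\<in>N - S. path_component_of ?Y a y" using ab by (auto simp: good_def)
    then show ?thesis using N ab by (auto simp: T_def)
  qed
  ultimately have "b \<in> T" using ab by auto
  then show ?thesis using ab by (auto simp: T_def good_def)
qed

section \<open>Continuation in a punctured disc\<close>

text \<open>Writing the radius as exp R makes \<open>left_half R\<close> the half-plane of
  logarithms of the coordinate.\<close>

locale punctured_disc =
  fixes X :: "'a topology" and A :: "'a chart set" and U :: "'a set" and z :: "'a \<Rightarrow> complex" and p :: 'a and R :: real
  assumes rs: "riemann_surface X A" and co: "coordinate X A U z" and im: "z ` U = ball 0 (exp R)"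
    and p: "p \<in> U" "z p = 0"
begin

section \<open>The universal covering of the punctured disc by the half-plane of logarithms\<close>

definition pt :: "complex \<Rightarrow> 'a" where
  "pt \<zeta> = inv_into U z (exp \<zeta>)"

lemma exp_in: "Re \<zeta> < R \<Longrightarrow> exp \<zeta> \<in> z ` U"
  by (simp add: im)

lemma pt_in_U: "Re \<zeta> < R \<Longrightarrow> pt \<zeta> \<in> U"
  unfolding pt_def by (rule inv_into_into[OF exp_in])

lemma z_pt: "Re \<zeta> < R \<Longrightarrow> z (pt \<zeta>) = exp \<zeta>"
  unfolding pt_def by (rule f_inv_into_f[OF exp_in])

lemma pt_in: "Re \<zeta> < R \<Longrightarrow> pt \<zeta> \<in> U - {p}"
  using pt_in_U z_pt p(2) by force

lemma pt_topspace: "Re \<zeta> < R \<Longrightarrow> pt \<zeta> \<in> topspace X"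
  using pt_in_U coordinate_chart(2)[OF co] by blast

lemma pt_eq: "x \<in> U \<Longrightarrow> exp \<zeta> = z x \<Longrightarrow> pt \<zeta> = x"
  by (simp add: pt_def inv_into_f_f[OF coordinate_chart(3)[OF co]])

lemma exp_imp_Re: "x \<in> U \<Longrightarrow> exp \<zeta> = z x \<Longrightarrow> Re \<zeta> < R"
proof -
  assume "x \<in> U" "exp \<zeta> = z x"
  then have "exp \<zeta> \<in> ball 0 (exp R)" using im by auto
  then show ?thesis by simp
qed

lemma log_exists:
  assumes "x \<in> U - {p}"
  obtains \<zeta> where "exp \<zeta> = z x"
proof -
  have "z x \<noteq> 0" using assms p inj_onD[OF coordinate_chart(3)[OF co], of x p] by auto
  then show ?thesis using exp_Ln that by blast
qed

lemma pt_shift: "pt (\<zeta> + 2 * of_real pi * \<i>) = pt \<zeta>"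
  by (simp add: pt_def exp_add)

lemma pt_continuous_map: "continuous_map (top_of_set (left_half R)) X pt"
proof -
  have "continuous_map (top_of_set (left_half R)) (top_of_set (z ` U)) exp"
    by (auto simp: im intro!: continuous_intros)
  from continuous_map_compose[OF this coordinate_inv_continuous[OF co]]
  have "continuous_map (top_of_set (left_half R)) (subtopology X U) pt"
    by (simp add: o_def pt_def[abs_def])
  then show ?thesis by (simp add: continuous_map_in_subtopology)
qed

lemma open_pt_vimage:
  assumes "openin X N"
  shows "open {\<zeta>. Re \<zeta> < R \<and> pt \<zeta> \<in> N}"
proof -
  have "openin (top_of_set (left_half R)) {\<zeta> \<in> topspace (top_of_set (left_half R)). pt \<zeta> \<in> N}"
    by (rule openin_continuous_map_preimage[OF pt_continuous_map assms])
  then have "open {\<zeta> \<in> topspace (top_of_set (left_half R)). pt \<zeta> \<in> N}"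
    using open_left_half openin_open_trans by blast
  then show ?thesis by simp
qed

lemma openin_pt_image:
  assumes "open S" "S \<subseteq> left_half R"
  shows "openin X (pt ` S)"
proof -
  have nc: "\<not> (exp :: complex \<Rightarrow> complex) constant_on UNIV"
  proof
    assume "(exp :: complex \<Rightarrow> complex) constant_on UNIV"
    then have "exp (0::complex) = exp (Ln 2)" unfolding constant_on_def by force
    then show False by simp
  qed
  have "open (exp ` S)"
    by (rule open_mapping_thm[OF holomorphic_on_exp open_UNIV connected_UNIV assms(1) _ nc]) auto
  moreover have "pt ` S = {x \<in> U. z x \<in> exp ` S}"
  proof (intro equalityI subsetI)
    show "x \<in> {x \<in> U. z x \<in> exp ` S}" if "x \<in> pt ` S" for x
      using that assms(2) pt_in_U z_pt by auto
    show "x \<in> pt ` S" if "x \<in> {x \<in> U. z x \<in> exp ` S}" for x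
    proof -
      from that obtain \<zeta> where "x \<in> U" "z x = exp \<zeta>" "\<zeta> \<in> S" by blast
      then show ?thesis using pt_eq[of x \<zeta>] by (intro image_eqI[of _ _ \<zeta>]) auto
    qed
  qed
  ultimately show ?thesis using coordinate_open_vimage[OF co] by simp
qed

text \<open>\<open>pt\<close> is continuous and open, so germs on the surface can be handled as
  germs on the half-plane although \<open>pt\<close> is not injective.\<close>

lemma eventually_nhdsin_pt:
  assumes re: "Re \<zeta> < R"
  shows "eventually P (nhdsin X (pt \<zeta>)) \<longleftrightarrow> (\<forall>\<^sub>F \<eta> in nhds \<zeta>. P (pt \<eta>))"
proof
  assume "eventually P (nhdsin X (pt \<zeta>))"
  then obtain N where N: "openin X N" "pt \<zeta> \<in> N" "\<And>x. x \<in> N \<Longrightarrow> P x"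
    using pt_topspace[OF re] by (auto simp: eventually_nhdsin)
  then show "\<forall>\<^sub>F \<eta> in nhds \<zeta>. P (pt \<eta>)"
    unfolding eventually_nhds
    by (intro exI[of _ "{\<zeta>. Re \<zeta> < R \<and> pt \<zeta> \<in> N}"]) (use re open_pt_vimage in auto)
next
  assume "\<forall>\<^sub>F \<eta> in nhds \<zeta>. P (pt \<eta>)"
  then obtain S where S: "open S" "\<zeta> \<in> S" "\<And>\<eta>. \<eta> \<in> S \<Longrightarrow> P (pt \<eta>)"
    by (auto simp: eventually_nhds)
  show "eventually P (nhdsin X (pt \<zeta>))"
    unfolding eventually_nhdsin
    by (rule disjI2, rule exI[of _ "pt ` (S \<inter> left_half R)"])
       (use S re open_left_half in \<open>auto intro!: openin_pt_image\<close>)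
qed

lemma holomorphic_pt:
  assumes "openin X V" "holomorphic_in A V f"
  shows "(\<lambda>\<zeta>. f (pt \<zeta>)) holomorphic_on {\<zeta>. Re \<zeta> < R \<and> pt \<zeta> \<in> V}"
proof -
  have "((f \<circ> inv_into U z) \<circ> exp) holomorphic_on {\<zeta>. Re \<zeta> < R \<and> pt \<zeta> \<in> V}"
    by (rule holomorphic_on_compose_gen[OF holomorphic_on_exp holomorphic_in_coordinate[OF rs co assms]])
       (use pt_in_U z_pt in \<open>force intro: image_eqI\<close>)
  then show ?thesis by (simp add: o_def pt_def)
qed

lemma same_germ_pt:
  assumes "Re \<zeta> < R"
  shows "same_germ X (pt \<zeta>) e e' \<longleftrightarrow> pt \<zeta> \<in> fst e \<and> pt \<zeta> \<in> fst e' \<and>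
    (\<forall>\<^sub>F \<eta> in nhds \<zeta>. snd e (pt \<eta>) = snd e' (pt \<eta>))"
  by (simp add: same_germ_def eventually_nhdsin_pt[OF assms])

lemma pathin_pt:
  assumes "continuous_on {0..1} \<sigma>" "\<And>t. t \<in> {0..1} \<Longrightarrow> Re (\<sigma> t) < R" "U - {p} \<subseteq> Y"
  shows "pathin (subtopology X Y) (\<lambda>t. pt (\<sigma> t))"
proof -
  have "continuous_map (top_of_set {0..1}) (top_of_set (left_half R)) \<sigma>"
    using assms by auto
  from continuous_map_compose[OF this pt_continuous_map]
  moreover have "pt (\<sigma> t) \<in> Y" if "t \<in> {0..1}" for t using pt_in[OF assms(2)[OF that]] assms(3) by blast
  ultimately show ?thesis by (auto simp: pathin_def continuous_map_in_subtopology o_def)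
qed

section \<open>Local inverses of the covering and the function elements built from them\<close>

definition loginv :: "complex \<Rightarrow> 'a \<Rightarrow> complex" where
  "loginv \<zeta> x = Ln (z x / exp \<zeta>) + \<zeta>"

text \<open>At distance below 1 < pi the difference of the two points lies in the strip on which
  \<open>Ln\<close> inverts \<open>exp\<close>.\<close>

lemma loginv_pt:
  assumes "Re \<eta> < R" "dist \<zeta> \<eta> < 1"
  shows "loginv \<zeta> (pt \<eta>) = \<eta>"
proof -
  have "\<bar>Im (\<eta> - \<zeta>)\<bar> \<le> 1" using assms(2) abs_Im_le_cmod[of "\<eta> - \<zeta>"] by (simp add: dist_norm norm_minus_commute)
  then have "Ln (exp (\<eta> - \<zeta>)) = \<eta> - \<zeta>" using pi_gt3 by (intro Ln_exp) auto
  then show ?thesis by (simp add: loginv_def z_pt[OF assms(1)] exp_diff)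
qed

definition patch :: "complex \<Rightarrow> real \<Rightarrow> 'a set" where
  "patch \<zeta> \<epsilon> = pt ` (ball \<zeta> \<epsilon> \<inter> left_half R)"

lemma openin_patch: "openin X (patch \<zeta> \<epsilon>)"
  unfolding patch_def by (rule openin_pt_image) (auto intro: open_left_half)

lemma connectedin_patch: "connectedin X (patch \<zeta> \<epsilon>)"
  unfolding patch_def
  by (rule connectedin_continuous_map_image[OF pt_continuous_map])
     (auto simp: connectedin_subtopology intro!: convex_connected convex_Int convex_left_half)

lemma patch_subset: "patch \<zeta> \<epsilon> \<subseteq> U - {p}"
  using pt_in by (auto simp: patch_def)

text \<open>The local inverse of \<open>pt\<close> transports a holomorphic function near \<zeta> to
  the surface. Since \<open>f\<close> has to agree with the transported function only on the patch,
  this covers both newly built elements and given functions such as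
  \<open>L \<circ> f\<close>.\<close>

lemma function_element_patch:
  assumes \<phi>: "\<phi> holomorphic_on ball \<zeta> \<epsilon>" and re: "Re \<zeta> < R" and \<epsilon>: "0 < \<epsilon>" "\<epsilon> \<le> 1" and Y: "U - {p} \<subseteq> Y"
    and f: "\<And>x. x \<in> patch \<zeta> \<epsilon> \<Longrightarrow> f x = \<phi> (loginv \<zeta> x)"
  shows "function_element X A Y (patch \<zeta> \<epsilon>, f)"
  unfolding function_element_def prod.case
proof (intro conjI openin_patch connectedin_patch)
  have "\<zeta> \<in> ball \<zeta> \<epsilon> \<inter> left_half R" using re \<epsilon> by simp
  then show "patch \<zeta> \<epsilon> \<noteq> {}" unfolding patch_def by blast
  show "patch \<zeta> \<epsilon> \<subseteq> Y" using patch_subset Y by blast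
  show "holomorphic_in A (patch \<zeta> \<epsilon>) f"
  proof (rule holomorphic_in_coordinateI[OF co _ _ rs])
    show "patch \<zeta> \<epsilon> \<subseteq> U" using patch_subset by blast
    let ?l = "\<lambda>w. Ln (w / exp \<zeta>) + \<zeta>"
    have zim: "z ` patch \<zeta> \<epsilon> = exp ` (ball \<zeta> \<epsilon> \<inter> left_half R)"
      unfolding patch_def image_image using z_pt by (intro image_cong) auto
    \<comment> \<open>An imaginary part below 1 < pi / 2 puts exp \<eta> / exp \<zeta> into the
      right half-plane, away from the cut of \<open>Ln\<close>.\<close>
    have lw: "?l (exp \<eta>) = \<eta> \<and> exp \<eta> / exp \<zeta> \<notin> \<real>\<^sub>\<le>\<^sub>0" if "\<eta> \<in> ball \<zeta> \<epsilon> \<inter> left_half R" for \<eta>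
    proof -
      have d: "dist \<zeta> \<eta> < 1" "Re \<eta> < R" using that \<epsilon> by auto
      have "\<bar>Im (\<eta> - \<zeta>)\<bar> < 1" using d(1) abs_Im_le_cmod[of "\<eta> - \<zeta>"] by (simp add: dist_norm norm_minus_commute)
      then have "cos (Im (\<eta> - \<zeta>)) > 0" using pi_gt3 by (intro cos_gt_zero_pi) auto
      then have "Re (exp (\<eta> - \<zeta>)) > 0" by (simp add: Re_exp)
      then have "exp \<eta> / exp \<zeta> \<notin> \<real>\<^sub>\<le>\<^sub>0" by (auto simp: complex_nonpos_Reals_iff exp_diff)
      moreover have "?l (exp \<eta>) = \<eta>" using loginv_pt[OF d(2,1)] by (simp add: loginv_def z_pt[OF d(2)])
      ultimately show ?thesis by blast
    qed
    have "?l holomorphic_on z ` patch \<zeta> \<epsilon>"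
      unfolding zim by (intro holomorphic_intros) (use lw in auto)
    then have "(\<phi> \<circ> ?l) holomorphic_on z ` patch \<zeta> \<epsilon>"
      by (rule holomorphic_on_compose_gen[OF _ \<phi>]) (use lw in \<open>auto simp: zim\<close>)
    then show "(f \<circ> inv_into U z) holomorphic_on z ` patch \<zeta> \<epsilon>"
    proof (rule holomorphic_transform)
      fix w assume "w \<in> z ` patch \<zeta> \<epsilon>"
      then obtain x where x: "x \<in> patch \<zeta> \<epsilon>" "w = z x" by blast
      then have "x \<in> U" using patch_subset by blast
      then show "(\<phi> \<circ> ?l) w = (f \<circ> inv_into U z) w"
        using f[OF x(1)] x(2) by (simp add: inv_into_f_f[OF coordinate_chart(3)[OF co]] loginv_def)
    qed
  qed
qed

section \<open>Germs that are branches of \<open>\<phi> (log z)\<close>\<close>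

definition logtype :: "(complex \<Rightarrow> complex) \<Rightarrow> ('a \<Rightarrow> complex) \<Rightarrow> 'a \<Rightarrow> bool" where
  "logtype \<phi> h x \<longleftrightarrow> (\<exists>\<zeta>. exp \<zeta> = z x \<and> (\<forall>\<^sub>F \<eta> in nhds \<zeta>. h (pt \<eta>) = \<phi> \<eta>))"

text \<open>Two logarithms of \<open>z x\<close> differ by an integer multiple of 2 pi i, under
  which \<open>pt\<close> is invariant. At a fixed logarithm the branches are thus indexed by an
  integer, which can be kept while the point moves.\<close>

lemma logtype_iff:
  assumes "exp \<zeta> = z x"
  shows "logtype \<phi> h x \<longleftrightarrow> (\<exists>n::int. \<forall>\<^sub>F \<eta> in nhds \<zeta>. h (pt \<eta>) = \<phi> (\<eta> + of_int n * (2 * of_real pi * \<i>)))"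
proof -
  have sh: "(\<forall>\<^sub>F \<eta> in nhds (\<zeta> + of_int n * (2 * of_real pi * \<i>)). h (pt \<eta>) = \<phi> \<eta>) \<longleftrightarrow>
      (\<forall>\<^sub>F \<eta> in nhds \<zeta>. h (pt \<eta>) = \<phi> (\<eta> + of_int n * (2 * of_real pi * \<i>)))" for n :: int
  proof -
    let ?c = "of_int n * (2 * of_real pi * \<i>)"
    have e: "exp ?c = 1" by (auto simp: exp_eq_1)
    then have pc: "pt (\<eta> + ?c) = pt \<eta>" for \<eta> by (simp add: pt_def exp_add)
    have "nhds (\<zeta> + ?c) = filtermap (\<lambda>\<eta>. \<eta> + ?c) (nhds \<zeta>)"
      using filtermap_nhds_shift[of "- ?c" \<zeta>] by simp
    then show ?thesis unfolding eventually_filtermap by (simp only: pc eventually_filtermap)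
  qed
  show ?thesis
  proof
    assume "logtype \<phi> h x"
    then obtain \<zeta>' where \<zeta>': "exp \<zeta>' = z x" "\<forall>\<^sub>F \<eta> in nhds \<zeta>'. h (pt \<eta>) = \<phi> \<eta>"
      by (auto simp: logtype_def)
    have "exp \<zeta>' = exp \<zeta>" using \<zeta>'(1) assms by simp
    then obtain n :: int where "\<zeta>' = \<zeta> + (of_int (2 * n) * pi) * \<i>" unfolding exp_eq by blast
    then have "\<zeta>' = \<zeta> + of_int n * (2 * of_real pi * \<i>)" by simp
    then show "\<exists>n::int. \<forall>\<^sub>F \<eta> in nhds \<zeta>. h (pt \<eta>) = \<phi> (\<eta> + of_int n * (2 * of_real pi * \<i>))"
      using \<zeta>'(2) sh by blast
  next
    assume "\<exists>n::int. \<forall>\<^sub>F \<eta> in nhds \<zeta>. h (pt \<eta>) = \<phi> (\<eta> + of_int n * (2 * of_real pi * \<i>))"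
    then obtain n :: int where "\<forall>\<^sub>F \<eta> in nhds (\<zeta> + of_int n * (2 * of_real pi * \<i>)). h (pt \<eta>) = \<phi> \<eta>"
      using sh by blast
    moreover have "exp (\<zeta> + of_int n * (2 * of_real pi * \<i>)) = z x"
    proof -
      have "exp (of_int n * (2 * of_real pi * \<i>)) = (1::complex)" by (auto simp: exp_eq_1)
      then show ?thesis using assms by (simp add: exp_add)
    qed
    ultimately show "logtype \<phi> h x" unfolding logtype_def by blast
  qed
qed

lemma logtype_same_germ:
  assumes "same_germ X x e e'" "x \<in> U"
  shows "logtype \<phi> (snd e) x \<longleftrightarrow> logtype \<phi> (snd e') x"
proof -
  have "(\<forall>\<^sub>F \<eta> in nhds \<zeta>. snd e (pt \<eta>) = \<phi> \<eta>) \<longleftrightarrow> (\<forall>\<^sub>F \<eta> in nhds \<zeta>. snd e' (pt \<eta>) = \<phi> \<eta>)" if "exp \<zeta> = z x" for \<zeta>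
  proof (rule eventually_eq_cong)
    have "Re \<zeta> < R" "pt \<zeta> = x" using that assms(2) exp_imp_Re pt_eq by auto
    then show "\<forall>\<^sub>F \<eta> in nhds \<zeta>. snd e (pt \<eta>) = snd e' (pt \<eta>)"
      using assms(1) same_germ_pt[of \<zeta> e e'] by simp
  qed
  then show ?thesis unfolding logtype_def by blast
qed

text \<open>On one disc in the half-plane the identity theorem carries agreement with the branch of
  a given index from \<open>x\<close> to every nearby \<open>y\<close> and back.\<close>

lemma logtype_locally_constant:
  assumes W: "openin X W" "holomorphic_in A W h" and \<phi>: "\<phi> holomorphic_on UNIV" and x: "x \<in> W" "x \<in> U - {p}"
  shows "\<exists>N. openin X N \<and> x \<in> N \<and> (\<forall>y\<in>N. logtype \<phi> h y = logtype \<phi> h x)"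
proof -
  obtain \<zeta> where \<zeta>: "exp \<zeta> = z x" using log_exists x(2) by blast
  have re: "Re \<zeta> < R" and ptx: "pt \<zeta> = x" using \<zeta> x(2) exp_imp_Re pt_eq by auto
  let ?D = "{\<zeta>. Re \<zeta> < R \<and> pt \<zeta> \<in> W}"
  obtain \<epsilon> where \<epsilon>: "\<epsilon> > 0" "ball \<zeta> \<epsilon> \<subseteq> ?D"
    using openE[OF open_pt_vimage[OF W(1)], of \<zeta>] re ptx x(1) by auto
  show ?thesis
  proof (intro exI[of _ "pt ` ball \<zeta> \<epsilon>"] conjI ballI)
    show "openin X (pt ` ball \<zeta> \<epsilon>)" using \<epsilon> by (intro openin_pt_image) auto
    show "x \<in> pt ` ball \<zeta> \<epsilon>" using ptx \<epsilon>(1) by force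
    fix y assume "y \<in> pt ` ball \<zeta> \<epsilon>"
    then obtain \<eta> where \<eta>: "\<eta> \<in> ball \<zeta> \<epsilon>" "y = pt \<eta>" by blast
    then have e\<eta>: "exp \<eta> = z y" using z_pt \<epsilon>(2) by auto
    have h1: "(\<lambda>\<zeta>. h (pt \<zeta>)) holomorphic_on ball \<zeta> \<epsilon>"
      by (rule holomorphic_on_subset[OF holomorphic_pt[OF W] \<epsilon>(2)])
    have h2: "(\<lambda>\<eta>. \<phi> (\<eta> + of_int n * (2 * of_real pi * \<i>))) holomorphic_on ball \<zeta> \<epsilon>" for n :: int
    proof -
      have "(\<phi> \<circ> (\<lambda>\<eta>. \<eta> + of_int n * (2 * of_real pi * \<i>))) holomorphic_on ball \<zeta> \<epsilon>"
        by (rule holomorphic_on_compose_gen[OF _ \<phi>]) (auto intro!: holomorphic_intros)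
      then show ?thesis by (simp add: o_def)
    qed
    have c: "\<zeta> \<in> ball \<zeta> \<epsilon>" using \<epsilon>(1) by simp
    show "logtype \<phi> h y = logtype \<phi> h x"
      unfolding logtype_iff[OF e\<eta>] logtype_iff[OF \<zeta>]
      using identity_germ[OF open_ball connected_ball h1 h2 c \<eta>(1)]
        identity_germ[OF open_ball connected_ball h1 h2 \<eta>(1) c] by blast
  qed
qed

lemma logtype_connected:
  assumes W: "function_element X A Y (W, h)" "Y \<subseteq> U - {p}" and \<phi>: "\<phi> holomorphic_on UNIV"
    and xy: "x \<in> W" "y \<in> W" "logtype \<phi> h x"
  shows "logtype \<phi> h y"
proof (rule ccontr)
  assume n: "\<not> logtype \<phi> h y"
  have fe: "openin X W" "holomorphic_in A W h" "connectedin X W" "W \<subseteq> U - {p}"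
    using W by (auto simp: function_element_def)
  have op: "openin X {x \<in> W. P (logtype \<phi> h x)}" for P :: "bool \<Rightarrow> bool"
  proof (subst openin_subopen, intro ballI)
    fix x assume x: "x \<in> {x \<in> W. P (logtype \<phi> h x)}"
    then have x': "x \<in> W" "x \<in> U - {p}" using fe(4) by auto
    obtain N where N: "openin X N" "x \<in> N" "\<forall>y\<in>N. logtype \<phi> h y = logtype \<phi> h x"
      using logtype_locally_constant[OF fe(1,2) \<phi> x'] by blast
    show "\<exists>T. openin X T \<and> x \<in> T \<and> T \<subseteq> {x \<in> W. P (logtype \<phi> h x)}"
    proof (intro exI[of _ "N \<inter> W"] conjI subsetI openin_Int N(1) fe(1))
      show "x \<in> N \<inter> W" using N(2) x'(1) by blast
      fix y assume y: "y \<in> N \<inter> W"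
      then have "logtype \<phi> h y = logtype \<phi> h x" using N(3) by blast
      then show "y \<in> {x \<in> W. P (logtype \<phi> h x)}" using x y by simp
    qed
  qed
  define E1 E2 where E: "E1 = {x \<in> W. logtype \<phi> h x}" "E2 = {x \<in> W. \<not> logtype \<phi> h x}"
  have "openin X E1" "openin X E2"
    using op[of "\<lambda>b. b"] op[of "\<lambda>b. \<not> b"] by (auto simp: E)
  moreover have "W \<subseteq> E1 \<union> E2" "E1 \<inter> E2 \<inter> W = {}" by (auto simp: E)
  moreover have "E1 \<inter> W \<noteq> {}" "E2 \<inter> W \<noteq> {}" using xy n by (auto simp: E)
  ultimately have "\<exists>E1 E2. openin X E1 \<and> openin X E2 \<and> W \<subseteq> E1 \<union> E2 \<and> E1 \<inter> E2 \<inter> W = {} \<and> E1 \<inter> W \<noteq> {} \<and> E2 \<inter> W \<noteq> {}"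
    by (intro exI[of _ E1] exI[of _ E2] conjI)
  with fe(3)[unfolded connectedin, THEN conjunct2] show False by (rule notE)
qed

text \<open>Near each point \<open>loginv\<close> is the continuous logarithm that
  \<open>of_log\<close> demands.\<close>

lemma of_logI:
  assumes W: "function_element X A Y (W, h)" "Y \<subseteq> U - {p}" and lt: "\<And>x. x \<in> W \<Longrightarrow> logtype \<phi> h x"
  shows "(W, h) \<in> of_log X A Y \<phi> z"
  unfolding of_log_def
proof (simp only: mem_Collect_eq prod.case, intro conjI ballI W(1))
  fix x assume x: "x \<in> W"
  have fe: "openin X W" "W \<subseteq> U - {p}" using W by (auto simp: function_element_def)
  obtain \<zeta> where \<zeta>: "exp \<zeta> = z x" "\<forall>\<^sub>F \<eta> in nhds \<zeta>. h (pt \<eta>) = \<phi> \<eta>" using lt[OF x] by (auto simp: logtype_def)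
  have re: "Re \<zeta> < R" and ptx: "pt \<zeta> = x" using \<zeta>(1) x fe(2) exp_imp_Re pt_eq by auto
  obtain S where S: "open S" "\<zeta> \<in> S" "\<And>\<eta>. \<eta> \<in> S \<Longrightarrow> h (pt \<eta>) = \<phi> \<eta>" using \<zeta>(2) by (auto simp: eventually_nhds)
  have "open (S \<inter> {\<zeta>. Re \<zeta> < R \<and> pt \<zeta> \<in> W})" using S(1) open_pt_vimage[OF fe(1)] by auto
  then obtain \<epsilon>' where \<epsilon>': "\<epsilon>' > 0" "ball \<zeta> \<epsilon>' \<subseteq> S \<inter> {\<zeta>. Re \<zeta> < R \<and> pt \<zeta> \<in> W}"
    using openE[of _ \<zeta>] S(2) re ptx x by blast
  define B where "B = ball \<zeta> (min \<epsilon>' 1)"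
  have B: "open B" "B \<subseteq> left_half R" "\<zeta> \<in> B" "\<And>\<eta>. \<eta> \<in> B \<Longrightarrow> \<eta> \<in> S \<and> Re \<eta> < R \<and> pt \<eta> \<in> W \<and> dist \<zeta> \<eta> < 1"
    using \<epsilon>' by (auto simp: B_def)
  have l: "loginv \<zeta> (pt \<eta>) = \<eta>" if "\<eta> \<in> B" for \<eta> using loginv_pt B(4)[OF that] by blast
  show "\<exists>N l. openin X N \<and> x \<in> N \<and> N \<subseteq> W \<and> continuous_map (subtopology X N) euclidean l \<and>
      (\<forall>y\<in>N. exp (l y) = z y \<and> h y = \<phi> (l y))"
  proof (intro exI conjI ballI)
    show N: "openin X (pt ` B)" by (rule openin_pt_image[OF B(1,2)])
    show "x \<in> pt ` B" using B(3) ptx by blast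
    show "pt ` B \<subseteq> W" using B(4) by blast
    show "continuous_map (subtopology X (pt ` B)) euclidean (loginv \<zeta>)"
      unfolding continuous_map
    proof (intro conjI allI impI)
      fix O' :: "complex set" assume "openin euclidean O'"
      then have "openin X (pt ` (B \<inter> O'))" using B by (intro openin_pt_image) auto
      moreover have "{y \<in> topspace (subtopology X (pt ` B)). loginv \<zeta> y \<in> O'} = pt ` (B \<inter> O')"
        using l B(2) pt_topspace by (auto simp: subset_iff)
      ultimately show "openin (subtopology X (pt ` B)) {y \<in> topspace (subtopology X (pt ` B)). loginv \<zeta> y \<in> O'}"
        using N by (simp add: openin_open_subtopology image_mono)
    qed auto
    fix y assume "y \<in> pt ` B"
    then obtain \<eta> where \<eta>: "\<eta> \<in> B" "y = pt \<eta>" by blast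
    show "exp (loginv \<zeta> y) = z y" "h y = \<phi> (loginv \<zeta> y)"
      using \<eta> l[OF \<eta>(1)] B(4)[OF \<eta>(1)] z_pt S(3) by auto
  qed
qed

text \<open>Near \<open>x\<close>, continuity keeps \<open>l (pt \<eta>)\<close> within distance 2 <
  2 pi of \<eta>; as logarithms of the same number the two coincide.\<close>

lemma of_logD:
  assumes W: "(W, h) \<in> of_log X A Y \<phi> z" "x \<in> W" "Y \<subseteq> U - {p}"
  shows "logtype \<phi> h x"
proof -
  have fe: "function_element X A Y (W, h)" using W(1) by (simp add: of_log_def)
  then have xU: "x \<in> U" using W(2,3) by (auto simp: function_element_def)
  obtain N l where N: "openin X N" "x \<in> N" "N \<subseteq> W" "continuous_map (subtopology X N) euclidean l"
    "\<And>y. y \<in> N \<Longrightarrow> exp (l y) = z y \<and> h y = \<phi> (l y)"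
    using W(1,2) unfolding of_log_def by blast
  let ?\<zeta> = "l x"
  have e: "exp ?\<zeta> = z x" using N(2,5) by blast
  have re: "Re ?\<zeta> < R" and ptx: "pt ?\<zeta> = x" using e xU exp_imp_Re pt_eq by auto
  have "openin (subtopology X N) {y \<in> topspace (subtopology X N). l y \<in> ball ?\<zeta> 1}"
    by (rule openin_continuous_map_preimage[OF N(4)]) auto
  then have "openin X {y \<in> topspace (subtopology X N). l y \<in> ball ?\<zeta> 1}"
    using N(1) openin_trans_full by blast
  moreover have "topspace (subtopology X N) = N" using N(1) openin_subset by auto
  ultimately have o: "openin X {y \<in> N. l y \<in> ball ?\<zeta> 1}" by (simp only:)
  have "\<forall>\<^sub>F \<eta> in nhds ?\<zeta>. \<eta> \<in> {\<eta>. Re \<eta> < R \<and> pt \<eta> \<in> {y \<in> N. l y \<in> ball ?\<zeta> 1}} \<inter> ball ?\<zeta> 1"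
    by (rule eventually_nhds_in_open) (use open_pt_vimage[OF o] re ptx N(2) in auto)
  then have "\<forall>\<^sub>F \<eta> in nhds ?\<zeta>. h (pt \<eta>) = \<phi> \<eta>"
  proof eventually_elim
    case (elim \<eta>)
    have "l (pt \<eta>) = \<eta>"
    proof (rule exp_complex_eqI)
      have "dist (l (pt \<eta>)) \<eta> < 2" using elim dist_triangle_half_l[of "l (pt \<eta>)" ?\<zeta> 2 \<eta>] by (auto simp: dist_commute)
      then have "\<bar>Im (l (pt \<eta>)) - Im \<eta>\<bar> < 2" using abs_Im_le_cmod[of "l (pt \<eta>) - \<eta>"] by (simp add: dist_norm)
      then show "\<bar>Im (l (pt \<eta>)) - Im \<eta>\<bar> < 2 * pi" using pi_gt3 by simp
      show "exp (l (pt \<eta>)) = exp \<eta>" using elim N(5) z_pt by auto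
    qed
    then show ?case using elim N(5) by auto
  qed
  with e show ?thesis unfolding logtype_def by blast
qed

text \<open>Being a branch of \<phi> (log z) depends on the germ alone and spreads over the
  connected domain of an element, hence it persists along every continuation.\<close>

lemma continuations_subset_of_log:
  assumes \<phi>: "\<phi> holomorphic_on UNIV" and V: "(V, f) \<in> of_log X A (U - {p}) \<phi> z"
  shows "continuations X A (U - {p}) (V, f) \<subseteq> of_log X A (U - {p}) \<phi> z"
proof
  fix e assume "e \<in> continuations X A (U - {p}) (V, f)"
  then obtain \<gamma> E where E: "continuation_along X A (U - {p}) \<gamma> E" "E 0 = (V, f)" "E 1 = e"
    by (auto simp: continuations_def)
  note c = continuation_alongD[OF E(1)]
  define P where "P t \<longleftrightarrow> logtype \<phi> (snd (E t)) (\<gamma> t)" for t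
  have "\<exists>\<epsilon>>0. \<forall>s\<in>{0..1}. \<bar>s - t\<bar> < \<epsilon> \<longrightarrow> P s = P t" if t: "t \<in> {0..1}" for t
  proof -
    obtain \<epsilon> where \<epsilon>: "\<epsilon> > 0" "\<forall>s\<in>{0..1}. \<bar>s - t\<bar> < \<epsilon> \<longrightarrow> same_germ X (\<gamma> s) (E s) (E t)"
      using c(5)[OF t] by blast
    have "P s = P t" if s: "s \<in> {0..1}" "\<bar>s - t\<bar> < \<epsilon>" for s
    proof -
      have sg: "same_germ X (\<gamma> s) (E s) (E t)" using \<epsilon>(2) s by blast
      have "P s \<longleftrightarrow> logtype \<phi> (snd (E t)) (\<gamma> s)"
        unfolding P_def by (rule logtype_same_germ[OF sg]) (use c(4)[OF s(1)] in blast)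
      moreover have fe: "function_element X A (U - {p}) (fst (E t), snd (E t))" using c(1)[OF t] by simp
      moreover have "\<gamma> s \<in> fst (E t)" "\<gamma> t \<in> fst (E t)" using sg c(2)[OF t] by (auto simp: same_germ_def)
      ultimately show ?thesis
        unfolding P_def using logtype_connected[OF fe order_refl \<phi>] by blast
    qed
    then show ?thesis using \<epsilon>(1) by blast
  qed
  moreover have "P 0" unfolding P_def using of_logD[OF V _ order_refl, of "\<gamma> 0"] c(2)[of 0] E(2) by simp
  ultimately have "P 1" using locally_constant_unit_interval[of P 0 1] by simp
  have "(fst e, snd e) \<in> of_log X A (U - {p}) \<phi> z"
  proof (rule of_logI[OF _ order_refl])
    show fe: "function_element X A (U - {p}) (fst e, snd e)" using c(1)[of 1] E(3) by simp
    fix x assume "x \<in> fst e"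
    then show "logtype \<phi> (snd e) x"
      using logtype_connected[OF fe order_refl \<phi>, of "\<gamma> 1" x] \<open>P 1\<close> c(2)[of 1] E(3) by (simp add: P_def)
  qed
  then show "e \<in> of_log X A (U - {p}) \<phi> z" by simp
qed

text \<open>Two elements are joined by the image under \<open>pt\<close> of a segment between
  suitable logarithms; the change of branch is achieved by the winding of this image around
  \<open>p\<close>.\<close>

lemma of_log_subset_continuations:
  assumes \<phi>: "\<phi> holomorphic_on UNIV" and V: "(V, f) \<in> of_log X A (U - {p}) \<phi> z"
  shows "of_log X A (U - {p}) \<phi> z \<subseteq> continuations X A (U - {p}) (V, f)"
proof (rule subrelI)
  fix W h assume W: "(W, h) \<in> of_log X A (U - {p}) \<phi> z"
  have feV: "function_element X A (U - {p}) (V, f)" and feW: "function_element X A (U - {p}) (W, h)"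
    using V W by (auto simp: of_log_def)
  obtain x0 x1 where x: "x0 \<in> V" "x1 \<in> W" using feV feW by (auto simp: function_element_def)
  have xU: "x0 \<in> U" "x1 \<in> U" using x feV feW by (auto simp: function_element_def)
  obtain \<zeta>0 where \<zeta>0: "exp \<zeta>0 = z x0" "\<forall>\<^sub>F \<eta> in nhds \<zeta>0. f (pt \<eta>) = \<phi> \<eta>"
    using of_logD[OF V x(1) order_refl] by (auto simp: logtype_def)
  obtain \<zeta>1 where \<zeta>1: "exp \<zeta>1 = z x1" "\<forall>\<^sub>F \<eta> in nhds \<zeta>1. h (pt \<eta>) = \<phi> \<eta>"
    using of_logD[OF W x(2) order_refl] by (auto simp: logtype_def)
  have re: "Re \<zeta>0 < R" "Re \<zeta>1 < R" using exp_imp_Re xU \<zeta>0(1) \<zeta>1(1) by auto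
  define \<sigma> where "\<sigma> t = (1 - t) *\<^sub>R \<zeta>0 + t *\<^sub>R \<zeta>1" for t :: real
  have \<sigma>re: "Re (\<sigma> t) < R" if "t \<in> {0..1}" for t
    using convexD_alt[OF convex_left_half, of \<zeta>0 R \<zeta>1 t] re that by (auto simp: \<sigma>_def)
  have \<sigma>c: "isCont \<sigma> t" for t unfolding \<sigma>_def by (intro continuous_intros)
  \<comment> \<open>The prescribed elements stand at the ends and patches in between. All of them
    lift to \<phi> near the corresponding point of the segment, which makes neighbouring germs
    agree.\<close>
  define E where "E t = (if t = 0 then (V, f) else if t = 1 then (W, h)
      else (patch (\<sigma> t) 1, \<lambda>x. \<phi> (loginv (\<sigma> t) x)))" for t
  have pt01: "pt (\<sigma> 0) = x0" "pt (\<sigma> 1) = x1"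
    using pt_eq xU \<zeta>0(1) \<zeta>1(1) by (auto simp: \<sigma>_def)
  have fe: "function_element X A (U - {p}) (E t)" if "t \<in> {0..1}" for t
  proof (cases "t = 0 \<or> t = 1")
    case False
    have "function_element X A (U - {p}) (patch (\<sigma> t) 1, \<lambda>x. \<phi> (loginv (\<sigma> t) x))"
      by (rule function_element_patch[OF _ \<sigma>re[OF that]]) (auto intro: holomorphic_on_subset[OF \<phi>])
    then show ?thesis using False by (simp add: E_def)
  qed (auto simp: E_def feV feW)
  have mem: "pt (\<sigma> t) \<in> fst (E t)" if "t \<in> {0..1}" for t
    using \<sigma>re[OF that] x pt01 by (auto simp: E_def patch_def)
  have hat: "\<forall>\<^sub>F \<eta> in nhds (\<sigma> t). snd (E t) (pt \<eta>) = \<phi> \<eta>" if "t \<in> {0..1}" for t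
  proof (cases "t = 0 \<or> t = 1")
    case True
    then show ?thesis using \<zeta>0(2) \<zeta>1(2) by (auto simp: E_def \<sigma>_def)
  next
    case False
    have "\<forall>\<^sub>F \<eta> in nhds (\<sigma> t). \<eta> \<in> ball (\<sigma> t) 1 \<inter> left_half R"
      using \<sigma>re[OF that] by (intro eventually_nhds_in_open) (auto simp: open_left_half)
    then show ?thesis
      by eventually_elim (use False in \<open>auto simp: E_def loginv_pt\<close>)
  qed
  have "continuation_along X A (U - {p}) (\<lambda>t. pt (\<sigma> t)) E"
    unfolding continuation_along_def
  proof (intro conjI ballI fe mem)
    show "pathin (subtopology X (U - {p})) (\<lambda>t. pt (\<sigma> t))"
      by (rule pathin_pt) (use \<sigma>re \<sigma>c in \<open>auto intro: continuous_at_imp_continuous_on\<close>)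
    fix t :: real assume t: "t \<in> {0..1}"
    have opE: "openin X (fst (E t))" using fe[OF t] by (cases "E t") (auto simp: function_element_def)
    have "\<forall>\<^sub>F x in nhds (\<sigma> t). x \<in> {x. Re x < R \<and> pt x \<in> fst (E t)}"
      by (rule eventually_nhds_in_open[OF open_pt_vimage[OF opE]]) (use mem[OF t] \<sigma>re[OF t] in auto)
    moreover have "\<forall>\<^sub>F x in nhds (\<sigma> t). \<forall>\<^sub>F \<eta> in nhds x. snd (E t) (pt \<eta>) = \<phi> \<eta>"
      using hat[OF t] by (simp add: eventually_eventually)
    ultimately have ev: "\<forall>\<^sub>F x in nhds (\<sigma> t). pt x \<in> fst (E t) \<and> (\<forall>\<^sub>F \<eta> in nhds x. snd (E t) (pt \<eta>) = \<phi> \<eta>)"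
      by eventually_elim auto
    have "\<forall>\<^sub>F s in nhds t. pt (\<sigma> s) \<in> fst (E t) \<and> (\<forall>\<^sub>F \<eta> in nhds (\<sigma> s). snd (E t) (pt \<eta>) = \<phi> \<eta>)"
    proof -
      have "(\<sigma> \<longlongrightarrow> \<sigma> t) (nhds t)"
        unfolding \<sigma>_def by (intro tendsto_intros filterlim_ident)
      with ev show ?thesis unfolding filterlim_iff by blast
    qed
    then obtain \<epsilon> where \<epsilon>: "\<epsilon> > 0" "\<And>s. dist s t < \<epsilon> \<Longrightarrow>
        pt (\<sigma> s) \<in> fst (E t) \<and> (\<forall>\<^sub>F \<eta> in nhds (\<sigma> s). snd (E t) (pt \<eta>) = \<phi> \<eta>)"
      unfolding eventually_nhds_metric by blast
    have "same_germ X (pt (\<sigma> s)) (E s) (E t)" if s: "s \<in> {0..1}" "\<bar>s - t\<bar> < \<epsilon>" for s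
    proof -
      have d: "dist s t < \<epsilon>" using s(2) by (simp add: dist_real_def)
      have "\<forall>\<^sub>F \<eta> in nhds (\<sigma> s). snd (E s) (pt \<eta>) = snd (E t) (pt \<eta>)"
        using hat[OF s(1)] conjunct2[OF \<epsilon>(2)[OF d]] by eventually_elim simp
      then show ?thesis
        unfolding same_germ_pt[OF \<sigma>re[OF s(1)]] using mem[OF s(1)] \<epsilon>(2)[OF d] by blast
    qed
    then show "\<exists>\<epsilon>>0. \<forall>s\<in>{0..1}. \<bar>s - t\<bar> < \<epsilon> \<longrightarrow> same_germ X (pt (\<sigma> s)) (E s) (E t)"
      using \<epsilon>(1) by blast
  qed
  moreover have "E 0 = (V, f)" "E 1 = (W, h)" by (auto simp: E_def)
  ultimately show "(W, h) \<in> continuations X A (U - {p}) (V, f)"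
    unfolding continuations_def by blast
qed

text \<open>The half-plane is star-shaped about \<open>\<zeta>0\<close>, so the lift at \<eta> can
  be read off from the continuation along the image of the segment to \<eta>. These continuations
  are chosen independently for different end points; \<open>monodromy_segments\<close> makes them
  agree locally.\<close>

lemma multivalued_lift:
  assumes Y: "U - {p} \<subseteq> Y"
    and cont: "\<And>\<gamma>. pathin (subtopology X Y) \<gamma> \<Longrightarrow> \<gamma> 0 \<in> fst e1 \<Longrightarrow> \<exists>E. continuation_along X A Y \<gamma> E \<and> E 0 = e1"
    and e1: "reached X A Y e0 (pt \<zeta>0) e1" and \<zeta>0: "Re \<zeta>0 < R"
  shows "\<exists>g. \<forall>\<zeta>. Re \<zeta> < R \<longrightarrow> (\<exists>V f. reached X A Y e0 (pt \<zeta>) (V, f) \<and> (\<forall>\<^sub>F \<eta> in nhds \<zeta>. g \<eta> = f (pt \<eta>)))"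
proof -
  define \<sigma> where "\<sigma> \<zeta> t = \<zeta>0 + of_real t * (\<zeta> - \<zeta>0)" for \<zeta> :: complex and t :: real
  have \<sigma>re: "Re (\<sigma> \<zeta> t) < R" if "Re \<zeta> < R" "t \<in> {0..1}" for \<zeta> t
  proof -
    have "\<sigma> \<zeta> t = (1 - t) *\<^sub>R \<zeta>0 + t *\<^sub>R \<zeta>" by (simp add: \<sigma>_def scaleR_conv_of_real algebra_simps)
    then show ?thesis using convexD_alt[OF convex_left_half, of \<zeta>0 R \<zeta> t] \<zeta>0 that by auto
  qed
  have mem1: "pt \<zeta>0 \<in> fst e1"
  proof -
    obtain \<gamma> E where "continuation_along X A Y \<gamma> E" "E 1 = e1" "\<gamma> 1 = pt \<zeta>0" using e1 by (auto simp: reached_def)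
    then show ?thesis using continuation_alongD(2)[of X A Y \<gamma> E 1] by simp
  qed
  have "\<exists>E. continuation_along X A Y (\<lambda>t. pt (\<sigma> \<zeta> t)) E \<and> E 0 = e1" if "Re \<zeta> < R" for \<zeta>
  proof (rule cont)
    show "pathin (subtopology X Y) (\<lambda>t. pt (\<sigma> \<zeta> t))"
      by (rule pathin_pt[OF _ _ Y]) (use \<sigma>re[OF that] in \<open>auto simp: \<sigma>_def intro!: continuous_intros\<close>)
    show "pt (\<sigma> \<zeta> 0) \<in> fst e1" using mem1 by (simp add: \<sigma>_def)
  qed
  then obtain c where c: "\<And>\<zeta>. Re \<zeta> < R \<Longrightarrow> continuation_along X A Y (\<lambda>t. pt (\<sigma> \<zeta> t)) (c \<zeta>) \<and> c \<zeta> 0 = e1"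
    by metis
  define g where "g \<eta> = snd (c \<eta> 1) (pt \<eta>)" for \<eta>
  let ?D = "\<lambda>e. {\<zeta>. Re \<zeta> < R \<and> pt \<zeta> \<in> fst e}" and ?f = "\<lambda>e \<zeta>. snd e (pt \<zeta>)"
  have fe: "openin X (fst (c \<zeta> t))" "holomorphic_in A (fst (c \<zeta> t)) (snd (c \<zeta> t))" if "Re \<zeta> < R" "t \<in> {0..1}" for \<zeta> t
    using continuation_alongD(1)[OF conjunct1[OF c[OF that(1)]] that(2)]
    by (cases "c \<zeta> t"; simp add: function_element_def)+
  have "\<exists>V f. reached X A Y e0 (pt \<zeta>) (V, f) \<and> (\<forall>\<^sub>F \<eta> in nhds \<zeta>. g \<eta> = f (pt \<eta>))" if re: "Re \<zeta> < R" for \<zeta>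
  proof (intro exI conjI)
    have 1: "\<sigma> \<zeta> 1 = \<zeta>" by (simp add: \<sigma>_def)
    have "reached X A Y e0 (pt (\<sigma> \<zeta> 1)) (c \<zeta> 1)"
      by (rule reached_trans[OF e1]) (use c[OF re] in \<open>auto simp: \<sigma>_def\<close>)
    then show "reached X A Y e0 (pt \<zeta>) (fst (c \<zeta> 1), snd (c \<zeta> 1))" by (simp add: 1)
    show "\<forall>\<^sub>F \<eta> in nhds \<zeta>. g \<eta> = snd (c \<zeta> 1) (pt \<eta>)"
      unfolding g_def
    proof (rule monodromy_segments[OF open_left_half[of R], where D = ?D and f = ?f and c = c and ?e0.0 = e1 and ?\<zeta>0.0 = \<zeta>0])
      fix \<zeta> t assume z: "\<zeta> \<in> left_half R" and t: "t \<in> {0..1::real}"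
      then have re: "Re \<zeta> < R" by simp
      note ca = continuation_alongD[OF conjunct1[OF c[OF re]] t]
      show "open (?D (c \<zeta> t))" by (rule open_pt_vimage[OF fe(1)[OF re t]])
      show "?f (c \<zeta> t) holomorphic_on ?D (c \<zeta> t)" by (rule holomorphic_pt[OF fe[OF re t]])
      show "\<zeta>0 + of_real t * (\<zeta> - \<zeta>0) \<in> ?D (c \<zeta> t)"
        using ca(2) \<sigma>re[OF re t] by (simp add: \<sigma>_def)
      obtain \<epsilon> where \<epsilon>: "\<epsilon> > 0" "\<forall>s\<in>{0..1}. \<bar>s - t\<bar> < \<epsilon> \<longrightarrow> same_germ X (pt (\<sigma> \<zeta> s)) (c \<zeta> s) (c \<zeta> t)"
        using ca(5) by blast
      show "\<exists>\<epsilon>>0. \<forall>s\<in>{0..1}. \<bar>s - t\<bar> < \<epsilon> \<longrightarrow>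
          (\<forall>\<^sub>F \<eta> in nhds (\<zeta>0 + of_real s * (\<zeta> - \<zeta>0)). ?f (c \<zeta> s) \<eta> = ?f (c \<zeta> t) \<eta>)"
        using \<epsilon> same_germ_pt[OF \<sigma>re[OF re]] unfolding \<sigma>_def by blast
    qed (use c re in auto)
  qed
  then show ?thesis by blast
qed

text \<open>Lifting by \<open>pt\<close> turns the pullback condition into an equation on the
  half-plane; the derivative of exp contributes the square of exp (Re \<zeta>).\<close>

lemma developing_lift:
  assumes dev: "developing_map X A Y ds T \<rho> F" and Y: "U - {p} \<subseteq> Y"
    and pc: "\<And>a b. a \<in> Y \<Longrightarrow> b \<in> Y \<Longrightarrow> path_component_of (subtopology X Y) a b"
  obtains g e0 where "F = continuations X A Y e0"
    "\<And>\<zeta>. Re \<zeta> < R \<Longrightarrow> \<exists>V f. reached X A Y e0 (pt \<zeta>) (V, f) \<and> (\<forall>\<^sub>F \<eta> in nhds \<zeta>. g \<eta> = f (pt \<eta>))"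
    "g holomorphic_on left_half R" "\<And>\<zeta>. Re \<zeta> < R \<Longrightarrow> g \<zeta> \<in> T"
    "\<And>\<zeta>. Re \<zeta> < R \<Longrightarrow> ds z (pt \<zeta>) * (exp (Re \<zeta>))\<^sup>2 = \<rho> (g \<zeta>) * (cmod (deriv g \<zeta>))\<^sup>2"
    "moebius_monodromy R g"
proof -
  have proj: "projective_function X A Y F" and mv: "multivalued_function X A Y F"
    using dev by (auto simp: developing_map_def projective_function_def)
  obtain e0 where e0: "function_element X A Y e0" "F = continuations X A Y e0"
    using mv by (auto simp: multivalued_function_def)
  have cont: "\<exists>E. continuation_along X A Y \<gamma> E \<and> E 0 = e"
    if "e \<in> F" "pathin (subtopology X Y) \<gamma>" "\<gamma> 0 \<in> fst e" for e \<gamma>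
    using mv that unfolding multivalued_function_def by blast
  obtain x0 where x0: "x0 \<in> fst e0" "x0 \<in> Y" "x0 \<in> topspace X"
  proof -
    have "fst e0 \<noteq> {}" "fst e0 \<subseteq> Y" "openin X (fst e0)"
      using e0(1) by (cases e0; simp add: function_element_def)+
    then show ?thesis using that openin_subset by blast
  qed
  have "continuation_along X A Y (\<lambda>_. x0) (\<lambda>_. e0)"
    using e0(1) x0 by (auto simp: continuation_along_def same_germ_def intro: exI[of _ 1])
  then have e0F: "e0 \<in> F" unfolding e0(2) continuations_def by blast
  define \<zeta>0 :: complex where "\<zeta>0 = of_real (R - 1)"
  have \<zeta>0: "Re \<zeta>0 < R" by (simp add: \<zeta>0_def)
  \<comment> \<open>The generating element may lie far from \<open>p\<close>; this path leads it to
    the punctured disc.\<close>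
  obtain \<gamma> where \<gamma>: "pathin (subtopology X Y) \<gamma>" "\<gamma> 0 = x0" "\<gamma> 1 = pt \<zeta>0"
  proof -
    have "pt \<zeta>0 \<in> Y" using pt_in[OF \<zeta>0] Y by blast
    from pc[OF x0(2) this] show ?thesis using that by (auto simp: path_component_of_def)
  qed
  obtain E where E: "continuation_along X A Y \<gamma> E" "E 0 = e0"
    using cont[OF e0F \<gamma>(1)] \<gamma>(2) x0(1) by auto
  have r1: "reached X A Y e0 (pt \<zeta>0) (E 1)" using E \<gamma>(3) by (auto simp: reached_def)
  then have E1F: "E 1 \<in> F" unfolding e0(2) by (rule reached_continuations)
  obtain g where g: "\<And>\<zeta>. Re \<zeta> < R \<Longrightarrow> \<exists>V f. reached X A Y e0 (pt \<zeta>) (V, f) \<and> (\<forall>\<^sub>F \<eta> in nhds \<zeta>. g \<eta> = f (pt \<eta>))"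
    using multivalued_lift[OF Y cont[OF E1F] r1 \<zeta>0] by blast
  have elem: "\<exists>V f. (V, f) \<in> F \<and> pt \<zeta> \<in> V \<and> openin X V \<and> holomorphic_in A V f \<and> (\<forall>\<^sub>F \<eta> in nhds \<zeta>. g \<eta> = f (pt \<eta>))"
    if re: "Re \<zeta> < R" for \<zeta>
  proof -
    obtain V f where V: "reached X A Y e0 (pt \<zeta>) (V, f)" "\<forall>\<^sub>F \<eta> in nhds \<zeta>. g \<eta> = f (pt \<eta>)"
      using g[OF re] by blast
    obtain \<gamma> E where E: "continuation_along X A Y \<gamma> E" "E 1 = (V, f)" "\<gamma> 1 = pt \<zeta>"
      using V(1) by (auto simp: reached_def)
    have "function_element X A Y (V, f)" "pt \<zeta> \<in> V"
      using continuation_alongD(1,2)[OF E(1), of 1] E(2,3) by auto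
    then show ?thesis using V(2) reached_continuations[OF V(1)] e0(2) by (auto simp: function_element_def)
  qed
  have gat: "(g has_field_derivative deriv (f \<circ> inv_into U z) (exp \<zeta>) * exp \<zeta>) (at \<zeta>) \<and> g \<zeta> = f (pt \<zeta>)"
    if re: "Re \<zeta> < R" and V: "pt \<zeta> \<in> V" "openin X V" "holomorphic_in A V f" "\<forall>\<^sub>F \<eta> in nhds \<zeta>. g \<eta> = f (pt \<eta>)" for \<zeta> V f
  proof -
    have w: "exp \<zeta> \<in> z ` (U \<inter> V)" using z_pt[OF re] pt_in_U[OF re] V(1) by (metis IntI image_eqI)
    have "((f \<circ> inv_into U z) has_field_derivative deriv (f \<circ> inv_into U z) (exp \<zeta>)) (at (exp \<zeta>))"
      by (rule holomorphic_derivI[OF holomorphic_in_coordinate[OF rs co V(2,3)] coordinate_open_image[OF co V(2)] w])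
    from DERIV_chain2[OF this DERIV_exp]
    have "((\<lambda>\<eta>. f (pt \<eta>)) has_field_derivative deriv (f \<circ> inv_into U z) (exp \<zeta>) * exp \<zeta>) (at \<zeta>)"
      by (simp add: pt_def)
    then show ?thesis
      using DERIV_cong_ev[OF refl V(4) refl] eventually_nhds_x_imp_x[OF V(4)] by blast
  qed
  have hol: "g holomorphic_on left_half R"
  proof (rule holomorphic_onI)
    fix \<zeta> assume "\<zeta> \<in> left_half R"
    then have re: "Re \<zeta> < R" by simp
    obtain V f where V: "pt \<zeta> \<in> V" "openin X V" "holomorphic_in A V f" "\<forall>\<^sub>F \<eta> in nhds \<zeta>. g \<eta> = f (pt \<eta>)"
      using elem[OF re] by blast
    have "g field_differentiable at \<zeta>"
      unfolding field_differentiable_def using gat[OF re V] by blast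
    then show "g field_differentiable at \<zeta> within left_half R" by (rule field_differentiable_at_within)
  qed
  have dom: "g \<zeta> \<in> T \<and> ds z (pt \<zeta>) * (exp (Re \<zeta>))\<^sup>2 = \<rho> (g \<zeta>) * (cmod (deriv g \<zeta>))\<^sup>2" if re: "Re \<zeta> < R" for \<zeta>
  proof -
    obtain V f where V: "(V, f) \<in> F" "pt \<zeta> \<in> V" "openin X V" "holomorphic_in A V f" "\<forall>\<^sub>F \<eta> in nhds \<zeta>. g \<eta> = f (pt \<eta>)"
      using elem[OF re] by blast
    have "f ` V \<subseteq> T \<and> (\<forall>U z. coordinate X A U z \<longrightarrow> (\<forall>x\<in>U \<inter> V. ds z x = \<rho> (f x) * (cmod (coord_deriv U z f x))\<^sup>2))"
      using bspec[OF conjunct2[OF dev[unfolded developing_map_def]] V(1)] unfolding prod.case .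
    then have d: "f ` V \<subseteq> T" "\<And>x. x \<in> U \<inter> V \<Longrightarrow> ds z x = \<rho> (f x) * (cmod (coord_deriv U z f x))\<^sup>2"
      using co by auto
    have gg: "deriv g \<zeta> = deriv (f \<circ> inv_into U z) (exp \<zeta>) * exp \<zeta>" "g \<zeta> = f (pt \<zeta>)"
      using gat[OF re V(2-5)] by (auto intro: DERIV_imp_deriv)
    have "ds z (pt \<zeta>) = \<rho> (f (pt \<zeta>)) * (cmod (deriv (f \<circ> inv_into U z) (exp \<zeta>)))\<^sup>2"
      using d(2)[of "pt \<zeta>"] pt_in_U[OF re] V(2) z_pt[OF re] by (simp add: coord_deriv_def)
    then show ?thesis unfolding gg using d(1) V(2) by (auto simp: norm_mult power_mult_distrib)
  qed
  \<comment> \<open>\<open>\<zeta>0\<close> and its shift have the same image under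
    \<open>pt\<close>, so the lift uses there two elements of \<open>F\<close> over one point, and
    projectivity relates them.\<close>
  have "moebius_monodromy R g"
  proof -
    have re': "Re (\<zeta>0 + 2 * of_real pi * \<i>) < R" using \<zeta>0 by simp
    obtain V f where V: "(V, f) \<in> F" "pt \<zeta>0 \<in> V" "\<forall>\<^sub>F \<eta> in nhds \<zeta>0. g \<eta> = f (pt \<eta>)"
      using elem[OF \<zeta>0] by blast
    obtain W h where W: "(W, h) \<in> F" "pt \<zeta>0 \<in> W" "\<forall>\<^sub>F \<eta> in nhds (\<zeta>0 + 2 * of_real pi * \<i>). g \<eta> = h (pt \<eta>)"
      using elem[OF re'] unfolding pt_shift by blast
    have W': "\<forall>\<^sub>F \<eta> in nhds \<zeta>0. g (\<eta> + 2 * of_real pi * \<i>) = h (pt \<eta>)"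
    proof -
      have "((\<lambda>\<eta>. \<eta> + 2 * of_real pi * \<i>) \<longlongrightarrow> \<zeta>0 + 2 * of_real pi * \<i>) (nhds \<zeta>0)"
        by (intro tendsto_intros filterlim_ident)
      then have "\<forall>\<^sub>F \<eta> in nhds \<zeta>0. g (\<eta> + 2 * of_real pi * \<i>) = h (pt (\<eta> + 2 * of_real pi * \<i>))"
        using W(3) unfolding filterlim_iff by blast
      then show ?thesis by (simp only: pt_shift)
    qed
    obtain a b c d where m: "a * d - b * c \<noteq> 0"
      "\<forall>\<^sub>F x in nhdsin X (pt \<zeta>0). c * f x + d \<noteq> 0 \<and> h x = moebius a b c d (f x)"
      using proj V(1,2) W(1,2) unfolding projective_function_def by blast
    have "\<forall>\<^sub>F \<eta> in nhds \<zeta>0. c * f (pt \<eta>) + d \<noteq> 0 \<and> h (pt \<eta>) = moebius a b c d (f (pt \<eta>))"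
      using m(2) by (simp only: eventually_nhdsin_pt[OF \<zeta>0])
    then have "\<forall>\<^sub>F \<eta> in nhds \<zeta>0. c * g \<eta> + d \<noteq> 0 \<and> g (\<eta> + 2 * of_real pi * \<i>) = moebius a b c d (g \<eta>)"
      using V(3) W' by eventually_elim simp
    then show ?thesis unfolding moebius_monodromy_def using \<zeta>0 m(1) by blast
  qed
  with e0(2) g hol dom show ?thesis by (intro that) auto
qed

lemma holomorphic_in_continuous_map:
  assumes "openin X V" "V \<subseteq> U" "holomorphic_in A V f"
  shows "continuous_map (subtopology X V) euclidean f"
proof -
  note c = coordinate_chart[OF coordinate_subset[OF co assms(1,2)]]
  have UV: "U \<inter> V = V" using assms(2) by blast
  have "continuous_on (z ` V) (f \<circ> inv_into U z)"
    using holomorphic_in_coordinate[OF rs co assms(1,3)] unfolding UV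
    by (rule holomorphic_on_imp_continuous_on)
  then have "continuous_map (top_of_set (z ` V)) euclidean (f \<circ> inv_into U z)" by simp
  from continuous_map_compose[OF homeomorphic_imp_continuous_map[OF c(5)] this]
  show ?thesis
  proof (rule continuous_map_eq)
    fix x assume "x \<in> topspace (subtopology X V)"
    then have "x \<in> U" using assms(2) by auto
    then show "(f \<circ> inv_into U z \<circ> z) x = f x"
      by (simp add: inv_into_f_f[OF coordinate_chart(3)[OF co]])
  qed
qed

text \<open>In the coordinate \<open>u \<circ> z\<close> the function \<open>l\<close>, read on the
  surface, is a logarithm, so a small element of \<open>L \<circ> F\<close> belongs to the
  multi-valued function \<phi> (log (u z)). The two inclusions between its continuations and all
  elements of that function then give equality.\<close>

lemma log_form_has_form:
  assumes form: "log_form R \<phi> (L \<circ> g)" and \<phi>: "\<phi> holomorphic_on UNIV"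
    and F: "F = continuations X A Y e0"
    and g: "\<And>\<zeta>. Re \<zeta> < R \<Longrightarrow> \<exists>V f. reached X A Y e0 (pt \<zeta>) (V, f) \<and> (\<forall>\<^sub>F \<eta> in nhds \<zeta>. g \<eta> = f (pt \<eta>))"
    and S: "U \<inter> S = {p}"
  shows "\<exists>U' z'. coordinate X A U' z' \<and> U' \<inter> S = {p} \<and> z' p = 0 \<and>
    has_form_on X A (U' - {p}) L F (of_log X A (U' - {p}) \<phi> z')"
proof -
  obtain B u l where B: "B \<le> R" and u: "u holomorphic_on ball 0 (exp B)" "u 0 = 0" "deriv u 0 \<noteq> 0"
    and l: "l holomorphic_on left_half B"
    and ul: "\<And>\<zeta>. Re \<zeta> < B \<Longrightarrow> exp (l \<zeta>) = u (exp \<zeta>) \<and> (L \<circ> g) \<zeta> = \<phi> (l \<zeta>)"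
    using form unfolding log_form_def by blast
  obtain r where r: "r > 0" "ball 0 r \<subseteq> ball (0::complex) (exp B)" "inj_on u (ball 0 r)"
    by (rule has_complex_derivative_locally_injective[OF u(1) _ open_ball u(3)]) auto
  have ur: "u holomorphic_on ball 0 r" by (rule holomorphic_on_subset[OF u(1) r(2)])
  have "open (u ` ball 0 r)" by (rule open_mapping_thm3[OF ur open_ball r(3)])
  moreover have "0 \<in> u ` ball 0 r" using u(2) r(1) by force
  ultimately obtain \<rho> where \<rho>: "\<rho> > 0" "ball 0 \<rho> \<subseteq> u ` ball 0 r" using openE by blast
  \<comment> \<open>\<open>u\<close> is injective on the small disc, and restricting to the preimage
    of a disc makes the image of the new coordinate a full disc, as \<open>punctured_disc\<close>
    requires.\<close>
  define T where "T = {w \<in> ball 0 r. u w \<in> ball 0 \<rho>}"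
  have opT: "open T"
  proof -
    have "open (ball 0 r \<inter> u -` ball 0 \<rho>)"
      by (rule continuous_open_preimage[OF holomorphic_on_imp_continuous_on[OF ur]]) auto
    moreover have "T = ball 0 r \<inter> u -` ball 0 \<rho>" by (auto simp: T_def)
    ultimately show ?thesis by simp
  qed
  have uT: "u ` T = ball 0 \<rho>" using \<rho>(2) by (auto simp: T_def)
  have T0: "0 \<in> T" using r(1) \<rho>(1) u(2) by (simp add: T_def)
  have TB: "T \<subseteq> ball 0 (exp B)" using r(2) by (auto simp: T_def)
  have "ball 0 (exp B) \<subseteq> ball (0::complex) (exp R)" using B by (intro subset_ball) simp
  then have TR: "T \<subseteq> z ` U" using TB unfolding im by blast
  define U' where "U' = {x \<in> U. z x \<in> T}"
  have zU': "z ` U' = T" using TR by (auto simp: U'_def)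
  have oU': "openin X U'" unfolding U'_def by (rule coordinate_open_vimage[OF co opT])
  have co1: "coordinate X A U' z" by (rule coordinate_subset[OF co oU']) (auto simp: U'_def)
  have co': "coordinate X A U' (u \<circ> z)"
    by (rule coordinate_compose[OF co1 opT _ _ _ rs])
       (use zU' in \<open>auto intro: holomorphic_on_subset[OF ur] inj_on_subset[OF r(3)] simp: T_def\<close>)
  have pU': "p \<in> U'" using p T0 by (simp add: U'_def)
  \<comment> \<open>A second instance, for the new coordinate; unprefixed facts still refer to
    \<open>z\<close>, through which the lift \<open>g\<close> is given.\<close>
  interpret P: punctured_disc X A U' "u \<circ> z" p "ln \<rho>"
  proof
    have "(u \<circ> z) ` U' = ball 0 \<rho>" unfolding image_comp[symmetric] zU' uT ..
    then show "(u \<circ> z) ` U' = ball 0 (exp (ln \<rho>))" using \<rho>(1) by simp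
  qed (use rs co' pU' p u in auto)
  obtain w where w: "w \<in> T" "w \<noteq> 0"
  proof -
    have "0 islimpt T" using opT T0 by (simp add: interior_limit_point interior_open)
    then show ?thesis using that unfolding islimpt_def by (metis UNIV_I open_UNIV)
  qed
  define \<zeta>1 where "\<zeta>1 = Ln w"
  have e1: "exp \<zeta>1 = w" using w(2) by (simp add: \<zeta>1_def)
  have re1: "Re \<zeta>1 < B"
  proof -
    have "exp \<zeta>1 \<in> ball 0 (exp B)" using e1 w TB by auto
    then show ?thesis by simp
  qed
  have re1R: "Re \<zeta>1 < R" using re1 B by simp
  obtain V0 f where V0: "reached X A Y e0 (pt \<zeta>1) (V0, f)" "\<forall>\<^sub>F \<eta> in nhds \<zeta>1. g \<eta> = f (pt \<eta>)"
    using g[OF re1R] by blast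
  have V0': "function_element X A Y (V0, f)" "pt \<zeta>1 \<in> V0"
  proof -
    obtain \<gamma> E where "continuation_along X A Y \<gamma> E" "E 1 = (V0, f)" "\<gamma> 1 = pt \<zeta>1"
      using V0(1) by (auto simp: reached_def)
    then show "function_element X A Y (V0, f)" "pt \<zeta>1 \<in> V0"
      using continuation_alongD(1,2)[of X A Y \<gamma> E 1] by auto
  qed
  have oV0: "openin X V0" using V0'(1) by (simp add: function_element_def)
  obtain S1 where S1: "open S1" "\<zeta>1 \<in> S1" "\<And>\<eta>. \<eta> \<in> S1 \<Longrightarrow> g \<eta> = f (pt \<eta>)"
    using V0(2) by (auto simp: eventually_nhds)
  \<comment> \<open>Here \<open>f\<close> represents the lift, the normal form holds, and the image
    under \<open>pt\<close> stays both in \<open>V0\<close> and in the domain of the new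
    coordinate.\<close>
  let ?O = "S1 \<inter> {\<zeta>. Re \<zeta> < R \<and> pt \<zeta> \<in> V0} \<inter> left_half B \<inter> exp -` T"
  have "open ?O" using S1(1) open_pt_vimage[OF oV0] open_left_half opT
    by (intro open_Int open_vimage) (auto intro: continuous_intros)
  moreover have "\<zeta>1 \<in> ?O" using S1(2) re1R V0'(2) re1 e1 w(1) by auto
  ultimately obtain \<epsilon>' where \<epsilon>': "\<epsilon>' > 0" "ball \<zeta>1 \<epsilon>' \<subseteq> ?O" using openE by blast
  define \<epsilon> where "\<epsilon> = min \<epsilon>' 1"
  have \<epsilon>: "0 < \<epsilon>" "\<epsilon> \<le> 1" "ball \<zeta>1 \<epsilon> \<subseteq> ?O" using \<epsilon>' by (auto simp: \<epsilon>_def)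
  define V where "V = patch \<zeta>1 \<epsilon>"
  have Vpt: "\<exists>\<eta>. x = pt \<eta> \<and> \<eta> \<in> ?O \<and> loginv \<zeta>1 x = \<eta>" if x: "x \<in> V" for x
  proof -
    obtain \<eta> where \<eta>: "\<eta> \<in> ball \<zeta>1 \<epsilon> \<inter> left_half R" "x = pt \<eta>" using x by (auto simp: V_def patch_def)
    then have "loginv \<zeta>1 x = \<eta>" using loginv_pt[of \<eta> \<zeta>1] \<epsilon>(2) by auto
    then show ?thesis using \<eta> \<epsilon>(3) by blast
  qed
  have m1: "pt \<zeta>1 \<in> V" unfolding V_def patch_def using re1R \<epsilon>(1) by auto
  have VV0: "V \<subseteq> V0" using Vpt by blast
  have VU': "V \<subseteq> U' - {p}"
  proof
    fix x assume x: "x \<in> V"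
    obtain \<eta> where \<eta>: "x = pt \<eta>" "\<eta> \<in> ?O" using Vpt[OF x] by blast
    then have "z x \<in> T" "x \<in> U - {p}" using z_pt[of \<eta>] pt_in[of \<eta>] by auto
    then show "x \<in> U' - {p}" by (simp add: U'_def)
  qed
  have oV: "openin X V" unfolding V_def by (rule openin_patch)
  have "function_element X A Y (V, f)"
    by (rule function_element_subset[OF V0'(1) oV _ _ VV0]) (use m1 connectedin_patch in \<open>auto simp: V_def\<close>)
  \<comment> \<open>\<open>has_form_on\<close> asks for a member of \<open>F\<close> whose domain
    lies in the new neighbourhood, so the shrunk element must itself be a continuation of
    \<open>e0\<close>.\<close>
  then have "reached X A Y e0 (pt \<zeta>1) (V, f)" by (rule reached_restrict[OF V0(1) _ m1 oV])
  then have VF: "(V, f) \<in> F" unfolding F by (rule reached_continuations)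
  have lball: "l holomorphic_on ball \<zeta>1 \<epsilon>" by (rule holomorphic_on_subset[OF l]) (use \<epsilon>(3) in auto)
  have "\<phi> \<circ> l holomorphic_on ball \<zeta>1 \<epsilon>"
    by (rule holomorphic_on_compose_gen[OF lball \<phi>]) auto
  moreover have eqs: "(L \<circ> f) x = \<phi> (l (loginv \<zeta>1 x)) \<and> exp (l (loginv \<zeta>1 x)) = (u \<circ> z) x" if x: "x \<in> V" for x
  proof -
    obtain \<eta> where \<eta>: "x = pt \<eta>" "\<eta> \<in> ?O" "loginv \<zeta>1 x = \<eta>" using Vpt[OF x] by blast
    have gf: "g \<eta> = f x" using S1(3)[of \<eta>] \<eta> by auto
    then show ?thesis using \<eta> ul[of \<eta>] z_pt[of \<eta>] by auto
  qed
  ultimately have "function_element X A (U - {p}) (V, L \<circ> f)"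
    unfolding V_def by (intro function_element_patch[OF _ re1R \<epsilon>(1,2), where \<phi> = "\<phi> \<circ> l"]) auto
  then have feL: "function_element X A (U' - {p}) (V, L \<circ> f)"
    using VU' by (simp add: function_element_def)
  have "function_element X A (U - {p}) (V, \<lambda>x. l (loginv \<zeta>1 x))"
    unfolding V_def by (rule function_element_patch[OF lball re1R \<epsilon>(1,2)]) auto
  then have lc: "continuous_map (subtopology X V) euclidean (\<lambda>x. l (loginv \<zeta>1 x))"
    by (intro holomorphic_in_continuous_map[OF oV]) (auto simp: function_element_def)
  have "(V, L \<circ> f) \<in> of_log X A (U' - {p}) \<phi> (u \<circ> z)"
    unfolding of_log_def
  proof (simp only: mem_Collect_eq prod.case, intro conjI ballI feL)
    fix x assume "x \<in> V"
    then show "\<exists>N l. openin X N \<and> x \<in> N \<and> N \<subseteq> V \<and> continuous_map (subtopology X N) euclidean l \<and>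
      (\<forall>y\<in>N. exp (l y) = (u \<circ> z) y \<and> (L \<circ> f) y = \<phi> (l y))"
      using oV lc eqs by (intro exI[of _ V] exI[of _ "\<lambda>x. l (loginv \<zeta>1 x)"]) auto
  qed
  then have "continuations X A (U' - {p}) (V, L \<circ> f) = of_log X A (U' - {p}) \<phi> (u \<circ> z)"
    using P.continuations_subset_of_log[OF \<phi>] P.of_log_subset_continuations[OF \<phi>] by blast
  then have "has_form_on X A (U' - {p}) L F (of_log X A (U' - {p}) \<phi> (u \<circ> z))"
    unfolding has_form_on_def using VF VU' by blast
  moreover have "U' \<inter> S = {p}" using S pU' by (auto simp: U'_def)
  moreover have "(u \<circ> z) p = 0" using p u(2) by simp
  ultimately show ?thesis using co' by blast
qed

end

section \<open>The local form of developing maps\<close>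

lemma coordinate_disc:
  assumes rs: "riemann_surface X A" and co: "coordinate X A U z" and p: "p \<in> U" "z p = 0"
  obtains R V where "V \<subseteq> U" "punctured_disc X A V z p R" "\<And>x. x \<in> V \<longleftrightarrow> x \<in> U \<and> cmod (z x) < exp R"
proof -
  have "0 \<in> z ` U" using p by force
  then obtain r where r: "r > 0" "ball 0 r \<subseteq> z ` U" using coordinate_chart(4)[OF co] openE by blast
  define V where "V = {x \<in> U. z x \<in> ball 0 r}"
  have V: "openin X V" unfolding V_def by (rule coordinate_open_vimage[OF co open_ball])
  have zV: "z ` V = ball 0 r" using r(2) by (auto simp: V_def)
  show ?thesis
  proof (rule that[of V "ln r"])
    show "punctured_disc X A V z p (ln r)"
    proof
      show "coordinate X A V z" by (rule coordinate_subset[OF co V]) (auto simp: V_def)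
    qed (use rs zV r(1) p in \<open>auto simp: V_def\<close>)
  qed (use r(1) in \<open>auto simp: V_def\<close>)
qed

lemma continuous_map_tendsto_coordinate:
  assumes co: "coordinate X A U z" and p: "p \<in> U" "z p = 0" and h: "continuous_map (subtopology X U) euclideanreal h"
  shows "((\<lambda>w. h (inv_into U z w)) \<longlongrightarrow> h p) (at 0)"
proof -
  have "continuous_map (top_of_set (z ` U)) euclideanreal (h \<circ> inv_into U z)"
    by (rule continuous_map_compose[OF coordinate_inv_continuous[OF co] h])
  then have "continuous_on (z ` U) (\<lambda>w. h (inv_into U z w))" by (simp add: o_def)
  moreover have "0 \<in> z ` U" using p by force
  ultimately have "isCont (\<lambda>w. h (inv_into U z w)) 0"
    using coordinate_chart(4)[OF co] continuous_on_eq_continuous_at by blast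
  moreover have "inv_into U z 0 = p"
    using inv_into_f_f[OF coordinate_chart(3)[OF co] p(1)] p(2) by simp
  ultimately show ?thesis by (simp add: isCont_def)
qed

theorem theorem1p2:
  fixes X :: "'a topology" and A :: "'a chart set" and D :: "'a \<Rightarrow> real" and ds :: "'a density"
  assumes "riemann_surface X A"
    and "real_divisor X D" and "\<forall>p\<in>supp D. 0 \<le> D p + 1"
    and "hyperbolic_metric_representing X A D ds"
  shows "(\<forall>F p \<alpha>.
            developing_map X A (topspace X - supp D) ds unit_disc disc_density F \<and>
            p \<in> supp D \<and> \<alpha> > 0 \<and> conical_singularity X A (supp D) ds p \<alpha> \<longrightarrow>
            (\<exists>U z L. coordinate X A U z \<and> U \<inter> supp D = {p} \<and> z p = 0 \<and> L \<in> PSU11 \<and>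
               has_form_on X A (U - {p}) L F (multivalued_power X A (U - {p}) \<alpha> z)))
       \<and> (\<forall>F q.
            developing_map X A (topspace X - supp D) ds upper_half_plane half_plane_density F \<and>
            q \<in> supp D \<and> cusp_singularity X A (supp D) ds q \<longrightarrow>
            (\<exists>V z L. coordinate X A V z \<and> V \<inter> supp D = {q} \<and> z q = 0 \<and> L \<in> PSL2R \<and>
               has_form_on X A (V - {q}) L F (multivalued_minus_i_log X A (V - {q}) z)))"
proof -
  note rs = assms(1)
  have pc: "path_component_of (subtopology X (topspace X - supp D)) a b"
    if "a \<in> topspace X - supp D" "b \<in> topspace X - supp D" for a b
    using complement_discrete_path_connected[OF rs _ _ that] assms(2) by (simp add: real_divisor_def)
  have pos: "ds z x > 0" if "coordinate X A U z" "x \<in> U" "x \<notin> supp D" for U z x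
  proof -
    have "x \<in> topspace X" using coordinate_chart(2)[OF that(1)] that(2) by blast
    moreover have "conformal_metric_on X A (topspace X - supp D) ds"
      using assms(4) by (simp only: hyperbolic_metric_representing_def hyperbolic_metric_on_def)
    ultimately show ?thesis
      using that conformal_metric_on_def[THEN iffD1, THEN conjunct1, rule_format] by blast
  qed
  have sub: "U - {p} \<subseteq> topspace X - supp D" if "coordinate X A U z" "U \<inter> supp D = {p}" for U z p
    using coordinate_chart(2)[OF that(1)] that(2) by blast
  show ?thesis
  proof (intro conjI allI impI; elim conjE)
    fix F p \<alpha>
    assume dev: "developing_map X A (topspace X - supp D) ds unit_disc disc_density F"
      and p: "p \<in> supp D" and \<alpha>: "0 < \<alpha>" and con: "conical_singularity X A (supp D) ds p \<alpha>"
    obtain U z h where U: "coordinate X A U z" "U \<inter> supp D = {p}" "z p = 0"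
      and h: "continuous_map (subtopology X U) euclideanreal h"
      and hz: "\<forall>x\<in>U - {p}. h x = log_factor ds z x - (\<alpha> - 1) * ln (cmod (z x))"
      using con unfolding conical_singularity_def by blast
    have pU: "p \<in> U" using U(2) by blast
    obtain R V where V: "V \<subseteq> U" and P: "punctured_disc X A V z p R"
      by (rule coordinate_disc[OF rs U(1) pU U(3)])
    interpret P: punctured_disc X A V z p R by (rule P)
    have VS: "V \<inter> supp D = {p}" using V U(2) P.p(1) by blast
    obtain g e0 where F: "F = continuations X A (topspace X - supp D) e0"
      and el: "\<And>\<zeta>. Re \<zeta> < R \<Longrightarrow> \<exists>W f. reached X A (topspace X - supp D) e0 (P.pt \<zeta>) (W, f) \<and> (\<forall>\<^sub>F \<eta> in nhds \<zeta>. g \<eta> = f (P.pt \<eta>))"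
      and g: "g holomorphic_on left_half R" "\<And>\<zeta>. Re \<zeta> < R \<Longrightarrow> g \<zeta> \<in> unit_disc"
      and met: "\<And>\<zeta>. Re \<zeta> < R \<Longrightarrow> ds z (P.pt \<zeta>) * (exp (Re \<zeta>))\<^sup>2 = disc_density (g \<zeta>) * (cmod (deriv g \<zeta>))\<^sup>2"
      and mon: "moebius_monodromy R g"
      by (rule P.developing_lift[OF dev sub[OF P.co VS] pc]; (assumption | rule that))
    have disc: "cmod (g \<zeta>) < 1" if "Re \<zeta> < R" for \<zeta> using g(2)[OF that] by simp
    define k where "k w = h (inv_into U z w)" for w
    have k: "(k \<longlongrightarrow> h p) (at 0)" unfolding k_def by (rule continuous_map_tendsto_coordinate[OF U(1) pU U(3) h])
    \<comment> \<open>The metric is exp (2 u) with u = k + (\<alpha> - 1) Re \<zeta>. The factor exp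
      (2 Re \<zeta>) of the covering turns this into exp (2 (\<alpha> Re \<zeta> + k)), and positive
      square roots are taken.\<close>
    have met': "2 * cmod (deriv g \<zeta>) = exp (\<alpha> * Re \<zeta> + k (exp \<zeta>)) * (1 - (cmod (g \<zeta>))\<^sup>2)" if re: "Re \<zeta> < R" for \<zeta>
    proof -
      let ?x = "P.pt \<zeta>"
      have x: "?x \<in> U - {p}" using P.pt_in[OF re] V by blast
      \<comment> \<open>\<open>P.pt\<close> inverts \<open>z\<close> on the smaller set
        \<open>V\<close>, while \<open>k\<close> uses the inverse on \<open>U\<close>; injectivity
        on \<open>U\<close> identifies them.\<close>
      have "inv_into U z (exp \<zeta>) = ?x"
        using inv_into_f_f[OF coordinate_chart(3)[OF U(1)], of ?x] x P.z_pt[OF re] by simp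
      then have "k (exp \<zeta>) = ln (ds z ?x) / 2 - (\<alpha> - 1) * Re \<zeta>"
        using bspec[OF hz x] P.z_pt[OF re] by (simp add: k_def log_factor_def)
      then have "ln (ds z ?x) = 2 * (k (exp \<zeta>) + (\<alpha> - 1) * Re \<zeta>)" by simp
      moreover have "ds z ?x > 0" by (rule pos[OF U(1)]) (use x U(2) in auto)
      ultimately have "ds z ?x = exp (2 * (k (exp \<zeta>) + (\<alpha> - 1) * Re \<zeta>))" by (metis exp_ln)
      then have "ds z ?x * (exp (Re \<zeta>))\<^sup>2 = (exp (\<alpha> * Re \<zeta> + k (exp \<zeta>)))\<^sup>2"
        by (simp add: power2_eq_square algebra_simps flip: exp_add)
      also have "ds z ?x * (exp (Re \<zeta>))\<^sup>2 = (2 * cmod (deriv g \<zeta>) / (1 - (cmod (g \<zeta>))\<^sup>2))\<^sup>2"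
        unfolding met[OF re] by (simp add: disc_density_def power_divide power_mult_distrib)
      finally have sq: "(2 * cmod (deriv g \<zeta>) / (1 - (cmod (g \<zeta>))\<^sup>2))\<^sup>2 = (exp (\<alpha> * Re \<zeta> + k (exp \<zeta>)))\<^sup>2" .
      have lt: "0 < 1 - (cmod (g \<zeta>))\<^sup>2" using disc[OF re] abs_square_less_1[of "cmod (g \<zeta>)"] by simp
      have "2 * cmod (deriv g \<zeta>) / (1 - (cmod (g \<zeta>))\<^sup>2) = exp (\<alpha> * Re \<zeta> + k (exp \<zeta>))"
        by (rule power2_eq_imp_eq[OF sq]) (use lt in auto)
      then show ?thesis using lt by (simp add: divide_eq_eq)
    qed
    obtain L where L: "L \<in> PSU11" "log_form R (\<lambda>l. exp (of_real \<alpha> * l)) (L \<circ> g)"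
      by (rule cone_log_form[OF g(1) \<alpha> mon disc met' k])
    have "(\<lambda>l. exp (of_real \<alpha> * l)) holomorphic_on UNIV" by (intro holomorphic_intros)
    from P.log_form_has_form[OF L(2) this F el VS]
    show "\<exists>U z L. coordinate X A U z \<and> U \<inter> supp D = {p} \<and> z p = 0 \<and> L \<in> PSU11 \<and>
        has_form_on X A (U - {p}) L F (multivalued_power X A (U - {p}) \<alpha> z)"
      using L(1) unfolding multivalued_power_def by blast
  next
    fix F q
    assume dev: "developing_map X A (topspace X - supp D) ds upper_half_plane half_plane_density F"
      and p: "q \<in> supp D" and cusp: "cusp_singularity X A (supp D) ds q"
    obtain U z h where U: "coordinate X A U z" "U \<inter> supp D = {q}" "z q = 0"
      and z1: "\<forall>x\<in>U. cmod (z x) < 1"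
      and h: "continuous_map (subtopology X U) euclideanreal h"
      and hz: "\<forall>x\<in>U - {q}. h x = log_factor ds z x + ln (cmod (z x)) + ln (- ln (cmod (z x)))"
      using cusp unfolding cusp_singularity_def by blast
    have pU: "q \<in> U" using U(2) by blast
    obtain R V where V: "V \<subseteq> U" and P: "punctured_disc X A V z q R"
      by (rule coordinate_disc[OF rs U(1) pU U(3)])
    interpret P: punctured_disc X A V z q R by (rule P)
    have VS: "V \<inter> supp D = {q}" using V U(2) P.p(1) by blast
    \<comment> \<open>The bound |z| < 1 in the cusp coordinate makes - Re \<zeta> = - ln |z|
      positive.\<close>
    have neg: "Re \<zeta> < 0" if "Re \<zeta> < R" for \<zeta>
    proof -
      have "P.pt \<zeta> \<in> U" using P.pt_in_U[OF that] V by blast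
      with z1 have "cmod (z (P.pt \<zeta>)) < 1" by blast
      then show ?thesis by (simp add: P.z_pt[OF that])
    qed
    have R0: "R \<le> 0"
    proof (rule ccontr)
      assume "\<not> R \<le> 0"
      then show False using neg[of 0] by simp
    qed
    obtain g e0 where F: "F = continuations X A (topspace X - supp D) e0"
      and el: "\<And>\<zeta>. Re \<zeta> < R \<Longrightarrow> \<exists>W f. reached X A (topspace X - supp D) e0 (P.pt \<zeta>) (W, f) \<and> (\<forall>\<^sub>F \<eta> in nhds \<zeta>. g \<eta> = f (P.pt \<eta>))"
      and g: "g holomorphic_on left_half R" "\<And>\<zeta>. Re \<zeta> < R \<Longrightarrow> g \<zeta> \<in> upper_half_plane"
      and met: "\<And>\<zeta>. Re \<zeta> < R \<Longrightarrow> ds z (P.pt \<zeta>) * (exp (Re \<zeta>))\<^sup>2 = half_plane_density (g \<zeta>) * (cmod (deriv g \<zeta>))\<^sup>2"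
      and mon: "moebius_monodromy R g"
      by (rule P.developing_lift[OF dev sub[OF P.co VS] pc]; (assumption | rule that))
    have im: "Im (g \<zeta>) > 0" if "Re \<zeta> < R" for \<zeta> using g(2)[OF that] by simp
    define k where "k w = h (inv_into U z w)" for w
    have k: "(k \<longlongrightarrow> h q) (at 0)" unfolding k_def by (rule continuous_map_tendsto_coordinate[OF U(1) pU U(3) h])
    \<comment> \<open>Here u = k - Re \<zeta> - ln (- Re \<zeta>), and the factor exp (2 Re \<zeta>)
      of the covering cancels the term - Re \<zeta>.\<close>
    have met': "cmod (deriv g \<zeta>) = exp (k (exp \<zeta>)) / (- Re \<zeta>) * Im (g \<zeta>)" if re: "Re \<zeta> < R" for \<zeta>
    proof -
      let ?x = "P.pt \<zeta>"
      have x: "?x \<in> U - {q}" using P.pt_in[OF re] V by blast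
      have "inv_into U z (exp \<zeta>) = ?x"
        using inv_into_f_f[OF coordinate_chart(3)[OF U(1)], of ?x] x P.z_pt[OF re] by simp
      then have "k (exp \<zeta>) = ln (ds z ?x) / 2 + Re \<zeta> + ln (- Re \<zeta>)"
        using bspec[OF hz x] P.z_pt[OF re] by (simp add: k_def log_factor_def)
      then have l: "ln (ds z ?x) = 2 * (k (exp \<zeta>) - Re \<zeta> - ln (- Re \<zeta>))" by simp
      moreover have "ds z ?x > 0" by (rule pos[OF U(1)]) (use x U(2) in auto)
      ultimately have "ds z ?x = exp (2 * (k (exp \<zeta>) - Re \<zeta> - ln (- Re \<zeta>)))" by (metis exp_ln)
      then have "ds z ?x * (exp (Re \<zeta>))\<^sup>2 = (exp (k (exp \<zeta>) - ln (- Re \<zeta>)))\<^sup>2"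
        by (simp add: power2_eq_square algebra_simps flip: exp_add)
      also have "exp (k (exp \<zeta>) - ln (- Re \<zeta>)) = exp (k (exp \<zeta>)) / (- Re \<zeta>)"
        using neg[OF re] by (simp add: exp_diff)
      also have "ds z ?x * (exp (Re \<zeta>))\<^sup>2 = (cmod (deriv g \<zeta>) / Im (g \<zeta>))\<^sup>2"
        unfolding met[OF re] by (simp add: half_plane_density_def power_divide)
      finally have sq: "(cmod (deriv g \<zeta>) / Im (g \<zeta>))\<^sup>2 = (exp (k (exp \<zeta>)) / (- Re \<zeta>))\<^sup>2" .
      have "cmod (deriv g \<zeta>) / Im (g \<zeta>) = exp (k (exp \<zeta>)) / (- Re \<zeta>)"
      proof (rule power2_eq_imp_eq[OF sq])
        show "0 \<le> cmod (deriv g \<zeta>) / Im (g \<zeta>)" using im[OF re] by simp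
        show "0 \<le> exp (k (exp \<zeta>)) / - Re \<zeta>" using neg[OF re] by (intro divide_nonneg_nonneg) auto
      qed
      then show ?thesis using im[OF re] by (metis divide_eq_eq less_irrefl)
    qed
    obtain L where L: "L \<in> PSL2R" "log_form R (\<lambda>l. - \<i> * l) (L \<circ> g)"
      by (rule cusp_log_form[OF g(1) R0 mon im met' k])
    have "(\<lambda>l. - \<i> * l) holomorphic_on UNIV" by (intro holomorphic_intros)
    from P.log_form_has_form[OF L(2) this F el VS]
    show "\<exists>V z L. coordinate X A V z \<and> V \<inter> supp D = {q} \<and> z q = 0 \<and> L \<in> PSL2R \<and>
        has_form_on X A (V - {q}) L F (multivalued_minus_i_log X A (V - {q}) z)"
      using L(1) unfolding multivalued_minus_i_log_def by blast
  qed
qed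

end
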